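(* Let $Y=(Y(t))_{t\ge 0}$ be a spectrally negative Lévy process such that for every $t>0$ the random variable $Y(t)$ is absolutely continuous with density $x\mapsto p(x,t)$. Let $c_1,c_2\ge 0$, $u>0$, $0<T<S\le\infty$ ($S$ is finite or $S=\infty$), and let $c(t)=c_1t$ for $t\in[0,T]$ and $c(t)=c_2(t-T)+c_1T$ for $t\in(T,\infty)$. Then $$\mathbb{P}\Big(\sup_{t<S}(Y(t)-c(t))>u\Big)=A+B,$$ where $$A=\mathbb{P}\Big(\sup_{t<T}(Y(t)-c_1t)>u\Big)=u\int_0^T\frac{p(u+c_1s,s)}{s}\,ds$$ and $$B=\int_0^\infty \mathbb{P}\Big(\sup_{t<S-T}(Y(t)-c_2t)>z\Big)p(-z+u+c_1T,T)\,dz$$ $$\qquad-u\int_0^\infty \mathbb{P}\Big(\sup_{t<S-T}(Y(t)-c_2t)>z\Big)\left(\int_0^T\frac{p(-z+c_1s,s)}{T-s}\,p(u+c_1(T-s),T-s)\,ds\right)dz.$$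
   Context: All processes are real-valued with time parameter $t\in[0,\infty)$. A spectrally negative Lévy process is a Lévy process (started at $0$) with no positive jumps. Notation: $\sup_{t<r}$ means the supremum over $t\in[0,r)$; and $S-T=\infty$ when $S=\infty$.
   Formalization: The density p is assumed jointly measurable in (x,t), and for almost every s in (0,T) its value p(u+c₁s,s) is the right derivative of the distribution function of Y(s); for an arbitrary version of the density (e.g. p=0 on that line) the formula fails. *)

theory Defs
  imports "HOL-Probability.Probability"
begin

text \<open>
  Time is the half-line \<open>t \<ge> 0\<close>; values of a process at negative times are junk
  and are never constrained. As usual, the path properties are required almost surely.
\<close>

locale levy_process = prob_space M for M :: "'a measure" +
  fixes Y :: "real \<Rightarrow> 'a \<Rightarrow> real"
  assumes random_variable: "\<And>t. 0 \<le> t \<Longrightarrow> random_variable borel (Y t)"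
    and start_zero: "AE \<omega> in M. Y 0 \<omega> = 0"
    and indep_increments:
      "\<And>(n::nat) (t::nat \<Rightarrow> real). 0 \<le> t 0 \<Longrightarrow> (\<And>i. i < n \<Longrightarrow> t i \<le> t (Suc i)) \<Longrightarrow>
         indep_vars (\<lambda>_. borel) (\<lambda>i \<omega>. Y (t (Suc i)) \<omega> - Y (t i) \<omega>) {..<n}"
    and stationary_increments:
      "\<And>s t. 0 \<le> s \<Longrightarrow> s \<le> t \<Longrightarrow>
         distr M borel (\<lambda>\<omega>. Y t \<omega> - Y s \<omega>) = distr M borel (Y (t - s))"
    and cadlag:
      "AE \<omega> in M. (\<forall>t\<ge>0. continuous (at_right t) (\<lambda>s. Y s \<omega>)) \<and>
                  (\<forall>t>0. \<exists>l. ((\<lambda>s. Y s \<omega>) \<longlongrightarrow> l) (at_left t))"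

locale spectrally_negative_levy_process = levy_process +
  assumes no_positive_jumps:
    "AE \<omega> in M. \<forall>t>0. Y t \<omega> - Lim (at_left t) (\<lambda>s. Y s \<omega>) \<le> 0"

text \<open>
  The probability that the supremum of \<open>X t\<close> over \<open>t \<in> [0, r)\<close> exceeds \<open>x\<close>. The supremum
  is taken in the extended reals, since it may be infinite. The completion is needed because
  for paths that are only almost surely regular the event is measurable up to a null set.
\<close>

definition prob_sup_gt :: "'a measure \<Rightarrow> (real \<Rightarrow> 'a \<Rightarrow> real) \<Rightarrow> ereal \<Rightarrow> real \<Rightarrow> real" where
  "prob_sup_gt M X r x =
     measure (completion M)
       {\<omega> \<in> space M. (SUP t \<in> {t. 0 \<le> t \<and> ereal t < r}. ereal (X t \<omega>)) > ereal x}"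

end

(* Let X t = Y t - c1 t, let tau be its first passage time over u and M its running supremum.
   Paths creep over u, so X tau = u.  Rotating the increments of the random walk X (n d)
   cyclically, the last-record gaps telescope to the final position; as d tends to 0 this gives
   Kendall's identity integrated over levels,
     int_0^x P(M t > y) dy = int_0^t E[X s; 0 < X s <= x] / s ds,
   hence P(tau_y in ds) = y pX(y, s) / s ds for almost every level y.  For the given level u take
   difference quotients in x: their s-densities converge to u pX(u, s) / s by the assumption on
   the version of p, and they are uniformly integrable because passage over u splits, by the
   strong Markov property, into passage over a good level y0 < u (which has a density) followed by
   an independent passage over u - y0.
   After time T, condition on X T = u - z: the independent future exceeds u with probability Q z,
   and the part of the law of X T with tau < T is, again by the strong Markov property, the
   convolution of the passage density at u with the density of X. *)

theory Submission
  imports Defs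
begin

section \<open>Path laws of processes with stationary independent increments\<close>

text \<open>The walk sampled on a grid jumps over levels, so it has no exact hitting identity at one
  level. Integrating over levels repairs this: a record gap is the length of the set of levels first
  exceeded at that step. The cap \<open>x\<close> on the crossing position bounds the gap although
  increments may have no mean, and it costs nothing in the limit because regular paths creep. Times
  near 0 are cut off at first, since \<open>1 / s\<close> is unbounded there. The price is that one
  prescribed level \<open>u\<close> stays out of reach. The difference quotients at \<open>u\<close>
  have integrals squeezed between passage probabilities at \<open>u + e\<close> and at
  \<open>u\<close>, so the limit of the integrals is known; Fatou's lemma then gives one inequality
  only, since mass might concentrate on small sets of times. Splitting at a good level below
  \<open>u\<close> excludes this: almost everywhere each quotient is one fixed integrable function
  convolved with a kernel of mass at most 1. Integrals are taken in \<open>ennreal\<close>, and the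
  subtracted part of \<open>B\<close> first appears as a summand on the other side of a balance, so
  its finiteness is a consequence and not a premise.\<close>

lemma finite_time_grid:
  fixes F :: "real set"
  assumes "finite F" "0 \<in> F" "\<And>s. s \<in> F \<Longrightarrow> 0 \<le> s"
  obtains \<tau> :: "nat \<Rightarrow> real" and n where "\<tau> 0 = 0" "mono \<tau>" "\<tau> ` {..n} = F"
proof -
  define L where "L = sorted_list_of_set F"
  have L: "sorted L" "set L = F" using assms by (auto simp: L_def)
  have ne: "L \<noteq> []" using assms(2) L by auto
  define n where "n = length L - 1"
  \<comment> \<open>Freezing the index at \<open>n\<close> makes the enumeration monotone on all
    natural numbers, not only up to \<open>n\<close>.\<close>
  define \<tau> where "\<tau> i = L ! min i n" for i
  have n: "n < length L" using ne by (simp add: n_def)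
  have "mono \<tau>"
  proof (rule monoI)
    fix i j :: nat assume "i \<le> j"
    then have "min i n \<le> min j n" by simp
    then show "\<tau> i \<le> \<tau> j"
      unfolding \<tau>_def using n by (intro sorted_nth_mono[OF L(1)]) auto
  qed
  moreover have im: "\<tau> ` {..n} = F"
  proof -
    have "\<tau> ` {..n} = (\<lambda>i. L ! i) ` {..<length L}"
      using n by (intro image_cong) (auto simp: \<tau>_def n_def)
    also have "\<dots> = F" using L by (auto simp: set_conv_nth)
    finally show ?thesis .
  qed
  moreover have "\<tau> 0 = 0"
  proof -
    obtain i where "\<tau> i = 0" using assms(2) im by force
    then have "\<tau> 0 \<le> 0" using \<open>mono \<tau>\<close> monoD[of \<tau> 0 i] by auto
    moreover have "\<tau> 0 \<in> F" using im by blast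
    ultimately show ?thesis using assms(3) by force
  qed
  ultimately show ?thesis using that by blast
qed

text \<open>Path regularity is kept out of this locale: the law of the path and the independence of
  past and future are statements about finitely many times, and the process restarted at
  \<open>t\<close> is then an instance again.\<close>

locale levy_increments = prob_space M for M :: "'a measure" +
  fixes X :: "real \<Rightarrow> 'a \<Rightarrow> real"
  assumes rv: "\<And>t. 0 \<le> t \<Longrightarrow> X t \<in> borel_measurable M"
    and start: "\<And>\<omega>. X 0 \<omega> = 0"
    and indep_increments:
      "\<And>(n::nat) (t::nat \<Rightarrow> real). 0 \<le> t 0 \<Longrightarrow> (\<And>i. i < n \<Longrightarrow> t i \<le> t (Suc i)) \<Longrightarrow>
         indep_vars (\<lambda>_. borel) (\<lambda>i \<omega>. X (t (Suc i)) \<omega> - X (t i) \<omega>) {..<n}"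
    and stationary_increments:
      "\<And>s t. 0 \<le> s \<Longrightarrow> s \<le> t \<Longrightarrow>
         distr M borel (\<lambda>\<omega>. X t \<omega> - X s \<omega>) = distr M borel (X (t - s))"
begin

text \<open>Points of a product space are extensional functions; the restriction makes the path such
  a point and discards the junk values at negative times.\<close>

definition path :: "'a \<Rightarrow> real \<Rightarrow> real" where
  "path \<omega> = (\<lambda>t\<in>{0..}. X t \<omega>)"

definition shifted :: "real \<Rightarrow> 'a \<Rightarrow> real \<Rightarrow> real" where
  "shifted t \<omega> = (\<lambda>r\<in>{0..}. X (t + r) \<omega> - X t \<omega>)"

definition past :: "real \<Rightarrow> 'a \<Rightarrow> real \<Rightarrow> real" where
  "past t \<omega> = (\<lambda>s\<in>{0..t}. X s \<omega>)"

abbreviation "paths \<equiv> (\<Pi>\<^sub>M t\<in>{0::real..}. (borel :: real measure))"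

lemma path_measurable [measurable]: "path \<in> measurable M paths"
  unfolding path_def by (intro measurable_restrict) (auto intro: rv)

lemma shifted_measurable: "0 \<le> t \<Longrightarrow> shifted t \<in> measurable M paths"
  unfolding shifted_def by (intro measurable_restrict borel_measurable_diff rv) auto

lemma past_measurable: "past t \<in> measurable M (\<Pi>\<^sub>M s\<in>{0..t}. borel)"
  unfolding past_def by (intro measurable_restrict) (auto intro: rv)

lemma levy_increments_shifted:
  assumes t: "0 \<le> t"
  shows "levy_increments M (\<lambda>r \<omega>. X (t + r) \<omega> - X t \<omega>)"
proof unfold_locales
  fix n :: nat and u :: "nat \<Rightarrow> real"
  assume u: "0 \<le> u 0" "\<And>i. i < n \<Longrightarrow> u i \<le> u (Suc i)"
  show "indep_vars (\<lambda>_. borel)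
     (\<lambda>i \<omega>. X (t + u (Suc i)) \<omega> - X t \<omega> - (X (t + u i) \<omega> - X t \<omega>)) {..<n}"
    using indep_increments[of "\<lambda>i. t + u i" n] u t by simp
next
  fix r s :: real assume rs: "0 \<le> r" "r \<le> s"
  have "distr M borel (\<lambda>\<omega>. X (t + s) \<omega> - X (t + r) \<omega>) = distr M borel (X (s - r))"
    using stationary_increments[of "t + r" "t + s"] rs t by simp
  also have "\<dots> = distr M borel (\<lambda>\<omega>. X (t + (s - r)) \<omega> - X t \<omega>)"
    using stationary_increments[of t "t + (s - r)"] rs t by simp
  finally show "distr M borel (\<lambda>\<omega>. X (t + s) \<omega> - X t \<omega> - (X (t + r) \<omega> - X t \<omega>)) =
       distr M borel (\<lambda>\<omega>. X (t + (s - r)) \<omega> - X t \<omega>)" by simp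
qed (use t rv start in auto)

lemma sum_increments: "\<tau> 0 = 0 \<Longrightarrow> X (\<tau> j) \<omega> = (\<Sum>i<j. X (\<tau> (Suc i)) \<omega> - X (\<tau> i) \<omega>)"
  using sum_lessThan_telescope[of "\<lambda>i. X (\<tau> i) \<omega>" j] by (simp add: start)

lemma sum_increments_from:
  "m \<le> j \<Longrightarrow> X (\<tau> j) \<omega> - X (\<tau> m) \<omega> = (\<Sum>i=m..<j. X (\<tau> (Suc i)) \<omega> - X (\<tau> i) \<omega>)"
  using sum_Suc_diff'[of m j "\<lambda>i. X (\<tau> i) \<omega>"] by simp

lemma distr_increment_vector:
  assumes "mono \<tau>" "\<tau> 0 = 0" "0 < n"
  shows "distr M (\<Pi>\<^sub>M i\<in>{..<n}. borel) (\<lambda>\<omega>. \<lambda>i\<in>{..<n}. X (\<tau> (Suc i)) \<omega> - X (\<tau> i) \<omega>)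
       = (\<Pi>\<^sub>M i\<in>{..<n}. distr M borel (X (\<tau> (Suc i) - \<tau> i)))"
proof -
  have nn: "0 \<le> \<tau> i" for i using assms(1,2) monoD[of \<tau> 0 i] by auto
  have le: "\<tau> i \<le> \<tau> (Suc i)" for i using assms(1) by (auto intro: monoD)
  have "indep_vars (\<lambda>_. borel) (\<lambda>i \<omega>. X (\<tau> (Suc i)) \<omega> - X (\<tau> i) \<omega>) {..<n}"
    using indep_increments[of \<tau> n] nn le by simp
  moreover have "{..<n} \<noteq> {}" using assms(3) by auto
  moreover have "(\<lambda>\<omega>. X (\<tau> (Suc i)) \<omega> - X (\<tau> i) \<omega>) \<in> borel_measurable M" for i
    using rv nn by simp
  ultimately have "distr M (\<Pi>\<^sub>M i\<in>{..<n}. borel) (\<lambda>\<omega>. \<lambda>i\<in>{..<n}. X (\<tau> (Suc i)) \<omega> - X (\<tau> i) \<omega>)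
       = (\<Pi>\<^sub>M i\<in>{..<n}. distr M borel (\<lambda>\<omega>. X (\<tau> (Suc i)) \<omega> - X (\<tau> i) \<omega>))"
    by (subst (asm) indep_vars_iff_distr_eq_PiM') auto
  then show ?thesis using stationary_increments[OF nn le] by simp
qed

text \<open>Positions are partial sums of independent increments. The point of the form is that the
  right-hand side depends on \<open>X\<close> only through its one-dimensional laws, so two
  processes can be compared.\<close>

lemma measure_fdd:
  assumes "mono \<tau>" "\<tau> 0 = 0" "0 < n" and "K \<subseteq> \<tau> ` {..n}"
    and A: "\<And>k. k \<in> K \<Longrightarrow> A k \<in> sets borel"
  shows "emeasure M {\<omega> \<in> space M. \<forall>k\<in>K. X k \<omega> \<in> A k} =
    emeasure (\<Pi>\<^sub>M i\<in>{..<n}. distr M borel (X (\<tau> (Suc i) - \<tau> i)))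
      {z \<in> space (\<Pi>\<^sub>M i\<in>{..<n}. borel). \<forall>j\<in>{j\<in>{..n}. \<tau> j \<in> K}. (\<Sum>i<j. z i) \<in> A (\<tau> j)}"
    (is "_ = emeasure _ ?B")
proof -
  have nn: "0 \<le> \<tau> i" for i using assms(1,2) monoD[of \<tau> 0 i] by auto
  have meas: "(\<lambda>\<omega>. \<lambda>i\<in>{..<n}. X (\<tau> (Suc i)) \<omega> - X (\<tau> i) \<omega>) \<in> measurable M (\<Pi>\<^sub>M i\<in>{..<n}. borel)"
    using rv nn by (intro measurable_restrict) simp
  have B: "?B \<in> sets (\<Pi>\<^sub>M i\<in>{..<n}. borel)"
  proof (rule sets.sets_Collect_finite_All)
    fix j assume j: "j \<in> {j \<in> {..n}. \<tau> j \<in> K}"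
    have "(\<lambda>z. \<Sum>i<j. z i) \<in> borel_measurable (\<Pi>\<^sub>M i\<in>{..<n}. (borel::real measure))"
      using j by (intro borel_measurable_sum measurable_component_singleton) auto
    then have "(\<lambda>z. \<Sum>i<j. z i) -` A (\<tau> j) \<inter> space (\<Pi>\<^sub>M i\<in>{..<n}. (borel::real measure)) \<in> sets (\<Pi>\<^sub>M i\<in>{..<n}. (borel::real measure))"
      using A[of "\<tau> j"] j by (auto intro: measurable_sets)
    then show "{z \<in> space (\<Pi>\<^sub>M i\<in>{..<n}. borel). (\<Sum>i<j. z i) \<in> A (\<tau> j)} \<in> sets (\<Pi>\<^sub>M i\<in>{..<n}. (borel::real measure))"
      by (simp add: vimage_def Int_def conj_commute)
  qed auto
  have "{\<omega> \<in> space M. \<forall>k\<in>K. X k \<omega> \<in> A k} =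
      (\<lambda>\<omega>. \<lambda>i\<in>{..<n}. X (\<tau> (Suc i)) \<omega> - X (\<tau> i) \<omega>) -` ?B \<inter> space M"
  proof -
    have "(\<Sum>i<j. (\<lambda>i\<in>{..<n}. X (\<tau> (Suc i)) \<omega> - X (\<tau> i) \<omega>) i) = X (\<tau> j) \<omega>" if "j \<le> n" for j \<omega>
      using that by (subst sum_increments[of \<tau>, OF assms(2)]) (auto intro!: sum.cong)
    then show ?thesis
      using assms(4) by (auto simp: space_PiM)
  qed
  then have "emeasure M {\<omega> \<in> space M. \<forall>k\<in>K. X k \<omega> \<in> A k} =
    emeasure (distr M (\<Pi>\<^sub>M i\<in>{..<n}. borel) (\<lambda>\<omega>. \<lambda>i\<in>{..<n}. X (\<tau> (Suc i)) \<omega> - X (\<tau> i) \<omega>)) ?B"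
    using emeasure_distr[OF meas B] by simp
  then show ?thesis using distr_increment_vector[OF assms(1-3)] by simp
qed

lemma path_vimage_cylinder:
  assumes "J \<subseteq> {0..}"
  shows "path -` prod_emb {0..} (\<lambda>_. borel) J (Pi\<^sub>E J A) \<inter> space M = {\<omega> \<in> space M. \<forall>k\<in>J. X k \<omega> \<in> A k}"
proof -
  have "path \<omega> \<in> prod_emb {0..} (\<lambda>_. borel) J (Pi\<^sub>E J A) \<longleftrightarrow> (\<forall>k\<in>J. X k \<omega> \<in> A k)" for \<omega>
  proof -
    have "path \<omega> \<in> prod_emb {0..} (\<lambda>_. borel) J (Pi\<^sub>E J A) \<longleftrightarrow> (\<forall>k\<in>J. path \<omega> k \<in> A k)"
      unfolding prod_emb_iff restrict_PiE_iff by (simp add: path_def)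
    also have "\<dots> \<longleftrightarrow> (\<forall>k\<in>J. X k \<omega> \<in> A k)"
      using assms by (intro ball_cong refl) (force simp: path_def)
    finally show ?thesis .
  qed
  then show ?thesis by blast
qed

text \<open>Finite cylinders determine a measure on the product space, and
  \<open>measure_fdd\<close> expresses their probabilities through the marginals alone.\<close>

lemma path_law_unique:
  assumes X': "levy_increments M X'"
    and eq: "\<And>t. 0 \<le> t \<Longrightarrow> distr M borel (X t) = distr M borel (X' t)"
  shows "distr M paths path = distr M paths (levy_increments.path X')"
proof -
  interpret X': levy_increments M X' by fact
  have prob: "prob_space (distr M paths path)" by (rule prob_space_distr) simp
  show ?thesis
  proof (rule measure_eqI_PiM_infinite)
    show "finite_measure (distr M paths path)"
      using prob by (simp add: prob_space_def)
    show "sets (distr M paths path) = sets paths" "sets (distr M paths X'.path) = sets paths"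
      by simp_all
    fix A :: "real \<Rightarrow> real set" and J
    assume J: "finite J" "J \<subseteq> {0..}" and A: "\<And>i. i \<in> J \<Longrightarrow> A i \<in> sets borel"
    \<comment> \<open>The time 1 is added so that the grid has at least one increment, even if
      \<open>J\<close> is empty or contains only 0.\<close>
    have F: "finite (insert 0 (insert 1 J))" "0 \<in> insert 0 (insert 1 J)"
      and F0: "\<And>s. s \<in> insert 0 (insert 1 J) \<Longrightarrow> 0 \<le> s" using J by auto
    obtain \<tau> :: "nat \<Rightarrow> real" and n where \<tau>: "\<tau> 0 = 0" "mono \<tau>" "\<tau> ` {..n} = insert 0 (insert 1 J)"
      by (rule finite_time_grid[OF F F0])
    have "0 < n"
    proof (rule ccontr)
      assume "\<not> 0 < n"
      then have "n = 0" by simp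
      moreover have "1 \<in> \<tau> ` {..n}" using \<tau>(3) by simp
      ultimately show False using \<tau>(1) by simp
    qed
    have nn: "0 \<le> \<tau> (Suc i) - \<tau> i" for i using \<tau>(2) by (auto intro: monoD)
    have Jsub: "J \<subseteq> \<tau> ` {..n}" using \<tau>(3) by auto
    have "emeasure M {\<omega> \<in> space M. \<forall>k\<in>J. X k \<omega> \<in> A k} =
        emeasure M {\<omega> \<in> space M. \<forall>k\<in>J. X' k \<omega> \<in> A k}"
      using measure_fdd[OF \<tau>(2,1) \<open>0 < n\<close> Jsub A] X'.measure_fdd[OF \<tau>(2,1) \<open>0 < n\<close> Jsub A]
      by (simp add: eq[OF nn])
    moreover have "path -` prod_emb {0..} (\<lambda>_. borel) J (Pi\<^sub>E J A) \<inter> space M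
         = {\<omega> \<in> space M. \<forall>k\<in>J. X k \<omega> \<in> A k}"
      by (rule path_vimage_cylinder[OF J(2)])
    moreover have "X'.path -` prod_emb {0..} (\<lambda>_. borel) J (Pi\<^sub>E J A) \<inter> space M
         = {\<omega> \<in> space M. \<forall>k\<in>J. X' k \<omega> \<in> A k}"
      by (rule X'.path_vimage_cylinder[OF J(2)])
    moreover have "prod_emb {0..} (\<lambda>_. borel) J (Pi\<^sub>E J A) \<in> sets paths"
      using J A by (intro sets_PiM_I) auto
    ultimately show "emeasure (distr M paths path) (prod_emb {0..} (\<lambda>_. borel) J (Pi\<^sub>E J A)) =
       emeasure (distr M paths X'.path) (prod_emb {0..} (\<lambda>_. borel) J (Pi\<^sub>E J A))"
      by (simp add: emeasure_distr)
  qed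
qed

text \<open>Stationarity passes from single increments to whole paths, because the restarted process
  has the same marginals.\<close>

lemma distr_shifted:
  assumes t: "0 \<le> t"
  shows "distr M paths (shifted t) = distr M paths path"
proof -
  interpret S: levy_increments M "\<lambda>r \<omega>. X (t + r) \<omega> - X t \<omega>"
    by (rule levy_increments_shifted[OF t])
  have "S.path = shifted t" by (simp add: fun_eq_iff S.path_def shifted_def)
  moreover have "distr M borel (\<lambda>\<omega>. X (t + r) \<omega> - X t \<omega>) = distr M borel (X r)" if "0 \<le> r" for r
    using stationary_increments[of t "t + r"] t that by simp
  ultimately show ?thesis
    using path_law_unique[OF S.levy_increments_axioms] by simp
qed

text \<open>One grid contains \<open>t\<close> and the times of both cylinders. Cut at
  \<open>t\<close>, its increments form two disjoint blocks, each cylinder depends on one block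
  only, and disjoint blocks of independent variables are independent.\<close>

lemma cylinder_events_indep:
  assumes t: "0 \<le> t" and J: "finite J" "J \<subseteq> {0..t}" and K: "finite K" "K \<subseteq> {0..}"
    and A: "\<And>k. k \<in> J \<Longrightarrow> A k \<in> sets borel" and B: "\<And>k. k \<in> K \<Longrightarrow> B k \<in> sets borel"
  shows "prob ({\<omega> \<in> space M. \<forall>s\<in>J. X s \<omega> \<in> A s} \<inter> {\<omega> \<in> space M. \<forall>r\<in>K. X (t + r) \<omega> - X t \<omega> \<in> B r})
    = prob {\<omega> \<in> space M. \<forall>s\<in>J. X s \<omega> \<in> A s} * prob {\<omega> \<in> space M. \<forall>r\<in>K. X (t + r) \<omega> - X t \<omega> \<in> B r}"
proof -
  let ?F = "insert 0 (insert t (J \<union> (\<lambda>r. t + r) ` K))"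
  have F: "finite ?F" "0 \<in> ?F" and F0: "\<And>s. s \<in> ?F \<Longrightarrow> 0 \<le> s" using J K t by auto
  obtain \<tau> :: "nat \<Rightarrow> real" and n where \<tau>: "\<tau> 0 = 0" "mono \<tau>" "\<tau> ` {..n} = ?F"
    by (rule finite_time_grid[OF F F0])
  obtain m where m: "m \<le> n" "\<tau> m = t"
    using \<tau>(3) by (metis atMost_iff imageE insertCI)
  have nn: "0 \<le> \<tau> i" for i using \<tau>(1,2) monoD[of \<tau> 0 i] by auto
  have le: "\<tau> i \<le> \<tau> (Suc i)" for i using \<tau>(2) by (auto intro: monoD)
  define Z where "Z i \<omega> = X (\<tau> (Suc i)) \<omega> - X (\<tau> i) \<omega>" for i \<omega>
  have "indep_vars (\<lambda>_. borel) Z {..<n}"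
    unfolding Z_def using indep_increments[of \<tau> n] nn le by simp
  then have ind: "indep_var (PiM {..<m} (\<lambda>_. borel)) (\<lambda>\<omega>. restrict (\<lambda>i. Z i \<omega>) {..<m})
      (PiM {m..<n} (\<lambda>_. borel)) (\<lambda>\<omega>. restrict (\<lambda>i. Z i \<omega>) {m..<n})"
    using m by (intro indep_var_restrict) auto
  define C1 where "C1 = {z \<in> space (PiM {..<m} (\<lambda>_. borel :: real measure)). \<forall>j\<in>{j\<in>{..m}. \<tau> j \<in> J}. (\<Sum>i<j. z i) \<in> A (\<tau> j)}"
  define C2 where "C2 = {z \<in> space (PiM {m..<n} (\<lambda>_. borel :: real measure)). \<forall>j\<in>{j\<in>{..n}. \<tau> j - t \<in> K}. (\<Sum>i=m..<j. z i) \<in> B (\<tau> j - t)}"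
  have C1: "C1 \<in> sets (PiM {..<m} (\<lambda>_. borel))" unfolding C1_def
  proof (rule sets.sets_Collect_finite_All)
    fix j assume j: "j \<in> {j\<in>{..m}. \<tau> j \<in> J}"
    have "(\<lambda>z. \<Sum>i<j. z i) \<in> borel_measurable (\<Pi>\<^sub>M i\<in>{..<m}. (borel::real measure))"
      using j by (intro borel_measurable_sum measurable_component_singleton) auto
    then show "{z \<in> space (PiM {..<m} (\<lambda>_. borel)). (\<Sum>i<j. z i) \<in> A (\<tau> j)} \<in> sets (PiM {..<m} (\<lambda>_. borel :: real measure))"
      using A[of "\<tau> j"] j by (auto dest: measurable_sets simp: vimage_def Int_def conj_commute)
  qed auto
  have C2: "C2 \<in> sets (PiM {m..<n} (\<lambda>_. borel))" unfolding C2_def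
  proof (rule sets.sets_Collect_finite_All)
    fix j assume j: "j \<in> {j\<in>{..n}. \<tau> j - t \<in> K}"
    have "(\<lambda>z. \<Sum>i=m..<j. z i) \<in> borel_measurable (\<Pi>\<^sub>M i\<in>{m..<n}. (borel::real measure))"
      using j by (intro borel_measurable_sum measurable_component_singleton) auto
    then show "{z \<in> space (PiM {m..<n} (\<lambda>_. borel)). (\<Sum>i=m..<j. z i) \<in> B (\<tau> j - t)} \<in> sets (PiM {m..<n} (\<lambda>_. borel :: real measure))"
      using B[of "\<tau> j - t"] j by (auto dest: measurable_sets simp: vimage_def Int_def conj_commute)
  qed auto
  have E1: "{\<omega> \<in> space M. \<forall>s\<in>J. X s \<omega> \<in> A s} = (\<lambda>\<omega>. restrict (\<lambda>i. Z i \<omega>) {..<m}) -` C1 \<inter> space M"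
  proof -
    have *: "(\<Sum>i<j. Z i \<omega>) = X (\<tau> j) \<omega>" for j \<omega>
      unfolding Z_def by (subst sum_increments[of \<tau>, OF \<tau>(1)]) simp
    \<comment> \<open>The grid is known to be monotone but not injective; a time of \<open>J\<close>
      found at an index above \<open>m\<close> is squeezed between \<open>t\<close> and
      \<open>t\<close>, so it is also the grid point with index \<open>m\<close>.\<close>
    have **: "J \<subseteq> \<tau> ` {..m}"
    proof
      fix s assume s: "s \<in> J"
      then obtain j where j: "j \<le> n" "\<tau> j = s" using \<tau>(3) by (metis UnI1 atMost_iff imageE insertCI)
      show "s \<in> \<tau> ` {..m}"
      proof (cases "j \<le> m")
        case False
        then have "t \<le> s" using j m \<tau>(2) monoD[of \<tau> m j] by auto
        then have "s = \<tau> m" using s J m by auto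
        then show ?thesis by blast
      qed (use j in blast)
    qed
    show ?thesis
      unfolding C1_def using ** by (auto simp flip: * simp: space_PiM)
  qed
  have E2: "{\<omega> \<in> space M. \<forall>r\<in>K. X (t + r) \<omega> - X t \<omega> \<in> B r} = (\<lambda>\<omega>. restrict (\<lambda>i. Z i \<omega>) {m..<n}) -` C2 \<inter> space M"
  proof -
    have *: "(\<Sum>i=m..<j. restrict (\<lambda>i. Z i \<omega>) {m..<n} i) = X (t + (\<tau> j - t)) \<omega> - X t \<omega>"
      if "j \<le> n" "\<tau> j - t \<in> K" for j \<omega>
    proof (cases "m \<le> j")
      case True
      have "(\<Sum>i=m..<j. restrict (\<lambda>i. Z i \<omega>) {m..<n} i) = (\<Sum>i=m..<j. Z i \<omega>)"
        using that by (intro sum.cong) auto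
      also have "\<dots> = X (\<tau> j) \<omega> - X (\<tau> m) \<omega>"
        unfolding Z_def by (rule sum_increments_from[OF True, symmetric])
      finally show ?thesis using m by simp
    next
      case False
      then have "\<tau> j \<le> t" using m \<tau>(2) monoD[of \<tau> j m] by auto
      then have "\<tau> j = t" using that K by force
      then show ?thesis using False by simp
    qed
    have **: "\<exists>j\<le>n. \<tau> j - t = r" if "r \<in> K" for r
    proof -
      have "t + r \<in> \<tau> ` {..n}" using that \<tau>(3) by auto
      then show ?thesis by auto
    qed
    have "restrict (\<lambda>i. Z i \<omega>) {m..<n} \<in> C2 \<longleftrightarrow> (\<forall>r\<in>K. X (t + r) \<omega> - X t \<omega> \<in> B r)" for \<omega>
    proof -
      have "restrict (\<lambda>i. Z i \<omega>) {m..<n} \<in> C2 \<longleftrightarrow>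
          (\<forall>j\<in>{j\<in>{..n}. \<tau> j - t \<in> K}. (\<Sum>i=m..<j. restrict (\<lambda>i. Z i \<omega>) {m..<n} i) \<in> B (\<tau> j - t))"
        unfolding C2_def by (simp add: space_PiM)
      also have "\<dots> \<longleftrightarrow> (\<forall>j\<in>{j\<in>{..n}. \<tau> j - t \<in> K}. X (t + (\<tau> j - t)) \<omega> - X t \<omega> \<in> B (\<tau> j - t))"
        by (intro ball_cong refl arg_cong2[where f="(\<in>)"] *) auto
      also have "\<dots> \<longleftrightarrow> (\<forall>r\<in>K. X (t + r) \<omega> - X t \<omega> \<in> B r)"
      proof (intro iffI ballI)
        fix r assume "\<forall>j\<in>{j\<in>{..n}. \<tau> j - t \<in> K}. X (t + (\<tau> j - t)) \<omega> - X t \<omega> \<in> B (\<tau> j - t)" "r \<in> K"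
        moreover obtain j where "j \<le> n" "\<tau> j - t = r" using **[OF \<open>r \<in> K\<close>] by blast
        ultimately show "X (t + r) \<omega> - X t \<omega> \<in> B r" by blast
      qed blast
      finally show ?thesis .
    qed
    then show ?thesis by blast
  qed
  show ?thesis
    using indep_varD[OF ind C1 C2] unfolding E1 E2 by (simp add: vimage_def Int_def conj_ac)
qed

text \<open>Finite cylinders are stable under intersection and make all coordinates measurable, so
  their product rule extends to the whole past and the whole future.\<close>

lemma indep_past_shifted:
  assumes t: "0 \<le> t"
  shows "indep_var (\<Pi>\<^sub>M s\<in>{0..t}. borel) (past t) paths (shifted t)"
proof -
  define G1 where "G1 = {E. \<exists>J A. finite J \<and> J \<subseteq> {0..t} \<and> (\<forall>k\<in>J. A k \<in> sets borel) \<and> E = {\<omega> \<in> space M. \<forall>s\<in>J. X s \<omega> \<in> A s}}"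
  define G2 where "G2 = {E. \<exists>J A. finite J \<and> J \<subseteq> {0..} \<and> (\<forall>k\<in>J. A k \<in> sets borel) \<and> E = {\<omega> \<in> space M. \<forall>r\<in>J. X (t + r) \<omega> - X t \<omega> \<in> A r}}"
  have stable: "Int_stable {E. \<exists>J A. finite J \<and> J \<subseteq> I \<and> (\<forall>k\<in>J. A k \<in> sets borel) \<and> E = {\<omega> \<in> space M. \<forall>s\<in>J. f s \<omega> \<in> A s}}"
    for f :: "real \<Rightarrow> 'a \<Rightarrow> real" and I
  proof (rule Int_stableI)
    fix a b
    assume "a \<in> {E. \<exists>J A. finite J \<and> J \<subseteq> I \<and> (\<forall>k\<in>J. A k \<in> sets borel) \<and> E = {\<omega> \<in> space M. \<forall>s\<in>J. f s \<omega> \<in> A s}}"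
      "b \<in> {E. \<exists>J A. finite J \<and> J \<subseteq> I \<and> (\<forall>k\<in>J. A k \<in> sets borel) \<and> E = {\<omega> \<in> space M. \<forall>s\<in>J. f s \<omega> \<in> A s}}"
    then obtain J A J' A' where
      J: "finite J" "J \<subseteq> I" "\<forall>k\<in>J. A k \<in> sets borel" "a = {\<omega> \<in> space M. \<forall>s\<in>J. f s \<omega> \<in> A s}"
      and J': "finite J'" "J' \<subseteq> I" "\<forall>k\<in>J'. A' k \<in> sets borel" "b = {\<omega> \<in> space M. \<forall>s\<in>J'. f s \<omega> \<in> A' s}"
      by blast
    \<comment> \<open>A time that occurs in one cylinder only is left unconstrained by the other
      through \<open>UNIV\<close>.\<close>
    define D where "D s = (if s \<in> J then A s else UNIV) \<inter> (if s \<in> J' then A' s else UNIV)" for s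
    have "a \<inter> b = {\<omega> \<in> space M. \<forall>s\<in>J \<union> J'. f s \<omega> \<in> D s}"
      unfolding J(4) J'(4) D_def by auto
    moreover have "\<forall>k\<in>J \<union> J'. D k \<in> sets borel" using J J' by (auto simp: D_def)
    ultimately show "a \<inter> b \<in> {E. \<exists>J A. finite J \<and> J \<subseteq> I \<and> (\<forall>k\<in>J. A k \<in> sets borel) \<and> E = {\<omega> \<in> space M. \<forall>s\<in>J. f s \<omega> \<in> A s}}"
      using J J' by (intro CollectI exI[of _ "J \<union> J'"] exI[of _ D]) auto
  qed
  have ev: "{\<omega> \<in> space M. \<forall>s\<in>J. f s \<omega> \<in> A s} \<in> events"
    if "finite J" "\<forall>k\<in>J. A k \<in> sets borel" "\<And>k. k \<in> J \<Longrightarrow> f k \<in> borel_measurable M"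
    for f :: "real \<Rightarrow> 'a \<Rightarrow> real" and J A
    using that by (intro sets.sets_Collect_finite_All) (auto dest: measurable_sets simp: vimage_def Int_def conj_commute)
  have G1e: "G1 \<subseteq> events" unfolding G1_def by (auto intro!: ev rv)
  have G2e: "G2 \<subseteq> events" unfolding G2_def using t by (auto intro!: ev borel_measurable_diff rv)
  have "indep_set G1 G2"
  proof (rule indep_setI)
    fix a b assume "a \<in> G1" "b \<in> G2"
    then show "prob (a \<inter> b) = prob a * prob b"
      unfolding G1_def G2_def using cylinder_events_indep[OF t] by auto
  qed (use G1e G2e in auto)
  then have ind: "indep_set (sigma_sets (space M) G1) (sigma_sets (space M) G2)"
    by (rule indep_set_sigma_sets) (use stable in \<open>simp_all add: G1_def G2_def\<close>)
  have Gp: "G1 \<subseteq> Pow (space M)" "G2 \<subseteq> Pow (space M)" using G1e G2e sets.sets_into_space[of _ M] by blast+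
  have m1: "past t \<in> measurable (sigma (space M) G1) (\<Pi>\<^sub>M s\<in>{0..t}. borel)"
  proof (unfold past_def, rule measurable_restrict, rule measurableI)
    fix s and D :: "real set" assume s: "s \<in> {0..t}" and D: "D \<in> sets borel"
    have "X s -` D \<inter> space M \<in> G1"
      unfolding G1_def using s D by (intro CollectI exI[of _ "{s}"] exI[of _ "\<lambda>_. D"]) auto
    then show "X s -` D \<inter> space (sigma (space M) G1) \<in> sets (sigma (space M) G1)"
      using Gp by auto
  qed auto
  have m2: "shifted t \<in> measurable (sigma (space M) G2) paths"
  proof (unfold shifted_def, rule measurable_restrict, rule measurableI)
    fix s :: real and D :: "real set" assume s: "s \<in> {0..}" and D: "D \<in> sets borel"
    have "(\<lambda>\<omega>. X (t + s) \<omega> - X t \<omega>) -` D \<inter> space M \<in> G2"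
      unfolding G2_def using s D by (intro CollectI exI[of _ "{s}"] exI[of _ "\<lambda>_. D"]) auto
    then show "(\<lambda>\<omega>. X (t + s) \<omega> - X t \<omega>) -` D \<inter> space (sigma (space M) G2) \<in> sets (sigma (space M) G2)"
      using Gp by auto
  qed auto
  have s1: "sigma_sets (space M) {past t -` A \<inter> space M |A. A \<in> sets (\<Pi>\<^sub>M s\<in>{0..t}. borel)} \<subseteq> sigma_sets (space M) G1"
    using measurable_sets[OF m1] Gp by (intro sigma_sets_subseteq sigma_sets_mono) auto
  have s2: "sigma_sets (space M) {shifted t -` A \<inter> space M |A. A \<in> sets paths} \<subseteq> sigma_sets (space M) G2"
    using measurable_sets[OF m2] Gp by (intro sigma_sets_subseteq sigma_sets_mono) auto
  have "indep_set (sigma_sets (space M) {past t -` A \<inter> space M |A. A \<in> sets (\<Pi>\<^sub>M s\<in>{0..t}. borel)})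
     (sigma_sets (space M) {shifted t -` A \<inter> space M |A. A \<in> sets paths})"
    using ind s1 s2 unfolding indep_set_def by (elim indep_sets_mono_sets) (auto split: bool.split)
  then show ?thesis
    unfolding indep_var_eq using past_measurable shifted_measurable[OF t] by simp
qed

end

section \<open>First passage of paths without positive jumps\<close>

definition regular_path :: "(real \<Rightarrow> real) \<Rightarrow> bool" where
  "regular_path f \<longleftrightarrow> f 0 = 0 \<and> (\<forall>t\<ge>0. (f \<longlongrightarrow> f t) (at_right t)) \<and>
     (\<forall>t>0. \<exists>l\<ge>f t. (f \<longlongrightarrow> l) (at_left t))"

text \<open>A relation rather than an infimum: a path that never exceeds \<open>a\<close> simply has
  no passage time, and no default value has to be excluded.\<close>

definition first_passage :: "(real \<Rightarrow> real) \<Rightarrow> real \<Rightarrow> real \<Rightarrow> bool" where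
  "first_passage f a \<sigma> \<longleftrightarrow> 0 \<le> \<sigma> \<and> (\<forall>v. 0 \<le> v \<longrightarrow> v \<le> \<sigma> \<longrightarrow> f v \<le> a) \<and>
     (\<forall>e>\<sigma>. \<exists>v. \<sigma> < v \<and> v < e \<and> a < f v)"

lemma right_continuous_stays_above:
  fixes f :: "real \<Rightarrow> real"
  assumes "(f \<longlongrightarrow> f t) (at_right t)" "a < f t"
  obtains e where "t < e" "\<And>v. t \<le> v \<Longrightarrow> v < e \<Longrightarrow> a < f v"
proof -
  have "eventually (\<lambda>v. a < f v) (at_right t)" using order_tendstoD(1)[OF assms] .
  then obtain e where e: "t < e" "\<And>v. t < v \<Longrightarrow> v < e \<Longrightarrow> a < f v"
    unfolding eventually_at_right_field by blast
  then show ?thesis using assms(2) that by (metis order_le_less)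
qed

lemma right_continuous_stays_below:
  fixes f :: "real \<Rightarrow> real"
  assumes "(f \<longlongrightarrow> f t) (at_right t)" "f t < a"
  obtains e where "t < e" "\<And>v. t \<le> v \<Longrightarrow> v < e \<Longrightarrow> f v < a"
proof -
  have "eventually (\<lambda>v. f v < a) (at_right t)" using order_tendstoD(2)[OF assms] .
  then obtain e where e: "t < e" "\<And>v. t < v \<Longrightarrow> v < e \<Longrightarrow> f v < a"
    unfolding eventually_at_right_field by blast
  then show ?thesis using assms(2) that by (metis order_le_less)
qed

text \<open>Turns passage events into countable unions. The rational is found to the right of the
  given time, so the strict time bound leaves the room for it.\<close>

lemma right_continuous_exceeds_iff_Rats:
  fixes f :: "real \<Rightarrow> real" and r :: ereal
  assumes "\<And>t. 0 \<le> t \<Longrightarrow> (f \<longlongrightarrow> f t) (at_right t)"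
  shows "(\<exists>s. 0 \<le> s \<and> ereal s < r \<and> z < f s) \<longleftrightarrow> (\<exists>q\<in>\<rat>. 0 \<le> q \<and> ereal q < r \<and> z < f q)"
proof
  assume "\<exists>s. 0 \<le> s \<and> ereal s < r \<and> z < f s"
  then obtain s where s: "0 \<le> s" "ereal s < r" "z < f s" by blast
  obtain e where e: "s < e" "\<And>v. s \<le> v \<Longrightarrow> v < e \<Longrightarrow> z < f v"
    using right_continuous_stays_above[OF assms[OF s(1)] s(3)] by blast
  obtain b where b: "s < b" "ereal b < r"
    using ereal_dense2[OF s(2)] by auto
  obtain q where q: "q \<in> \<rat>" "s < q" "q < min e b" using Rats_dense_in_real[of s "min e b"] e b by auto
  have "ereal q < r" using q b(2) by (metis ereal_less_eq(3) le_less_trans less_imp_le min_less_iff_conj)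
  then show "\<exists>q\<in>\<rat>. 0 \<le> q \<and> ereal q < r \<and> z < f q"
    using q e(2)[of q] s(1) by (intro bexI[of _ q]) auto
qed blast

text \<open>This is where jumps being downward enters: the value at \<open>t\<close> is at most the
  left limit, which inherits the bound.\<close>

lemma regular_path_le_at_end:
  assumes f: "regular_path f" and t: "0 < t" and le: "\<And>v. 0 \<le> v \<Longrightarrow> v < t \<Longrightarrow> f v \<le> a"
  shows "f t \<le> a"
proof -
  obtain l where l: "f t \<le> l" "(f \<longlongrightarrow> l) (at_left t)" using f t unfolding regular_path_def by blast
  have "eventually (\<lambda>v. f v \<le> a) (at_left t)"
    unfolding eventually_at_left_field using t le by (intro exI[of _ 0]) auto
  then have "l \<le> a" using l(2) by (intro tendsto_upperbound[OF l(2)]) auto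
  then show ?thesis using l by simp
qed

lemma first_passage_exists:
  assumes f: "regular_path f" and a: "0 \<le> a" and s: "0 \<le> s" "a < f s"
  obtains \<sigma> where "first_passage f a \<sigma>"
proof -
  define D where "D = {v. 0 \<le> v \<and> a < f v}"
  define \<sigma> where "\<sigma> = Inf D"
  have D: "D \<noteq> {}" "bdd_below D" using s by (auto simp: D_def intro!: bdd_belowI[of _ 0])
  have s0: "0 \<le> \<sigma>" unfolding \<sigma>_def using D by (intro cInf_greatest) (auto simp: D_def)
  have before: "f v \<le> a" if "0 \<le> v" "v < \<sigma>" for v
    using cInf_lower[of v D] D that by (force simp: D_def \<sigma>_def)
  have at: "f \<sigma> \<le> a"
  proof (cases "\<sigma> = 0")
    case True then show ?thesis using f a by (simp add: regular_path_def)
  next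
    case False
    then show ?thesis using regular_path_le_at_end[OF f _ before] s0 by auto
  qed
  have "\<exists>v. \<sigma> < v \<and> v < e \<and> a < f v" if e: "\<sigma> < e" for e
  proof -
    obtain v where v: "v \<in> D" "v < e" using cInf_lessD[of D e] D(1) e unfolding \<sigma>_def by blast
    have "\<sigma> \<le> v" using v D by (auto simp: \<sigma>_def intro: cInf_lower)
    moreover have "v \<noteq> \<sigma>" using v at by (auto simp: D_def)
    ultimately show ?thesis using v by (intro exI[of _ v]) (auto simp: D_def)
  qed
  then have "first_passage f a \<sigma>" unfolding first_passage_def using s0 before at by (metis order_le_less)
  then show ?thesis by (rule that)
qed

lemma first_passage_exceeds_iff:
  assumes "first_passage f a \<sigma>"
  shows "(\<exists>s. 0 \<le> s \<and> s < t \<and> a < f s) \<longleftrightarrow> \<sigma> < t"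
proof
  assume "\<exists>s. 0 \<le> s \<and> s < t \<and> a < f s"
  then obtain s where "0 \<le> s" "s < t" "a < f s" by blast
  then have "\<not> s \<le> \<sigma>" using assms by (force simp: first_passage_def)
  then show "\<sigma> < t" using \<open>s < t\<close> by simp
next
  assume "\<sigma> < t"
  then obtain v where "\<sigma> < v" "v < t" "a < f v" using assms by (auto simp: first_passage_def)
  then show "\<exists>s. 0 \<le> s \<and> s < t \<and> a < f s" using assms by (intro exI[of _ v]) (auto simp: first_passage_def)
qed

text \<open>Creeping over the level. The upper bound is part of \<open>first_passage\<close>, so the
  absence of positive jumps has entered through the existence of the passage time; the lower bound
  is right-continuity.\<close>

lemma first_passage_value:
  assumes f: "regular_path f" and \<sigma>: "first_passage f a \<sigma>"
  shows "f \<sigma> = a"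
proof (rule antisym)
  show "f \<sigma> \<le> a" using \<sigma> by (auto simp: first_passage_def)
  show "a \<le> f \<sigma>"
  proof (rule ccontr)
    assume "\<not> a \<le> f \<sigma>"
    then have lt: "f \<sigma> < a" by simp
    have "(f \<longlongrightarrow> f \<sigma>) (at_right \<sigma>)" using f \<sigma> by (auto simp: first_passage_def regular_path_def)
    then obtain e where e: "\<sigma> < e" "\<And>v. \<sigma> \<le> v \<Longrightarrow> v < e \<Longrightarrow> f v < a"
      using right_continuous_stays_below[of f \<sigma> a] lt by blast
    obtain v where "\<sigma> < v" "v < e" "a < f v" using \<sigma> e(1) by (auto simp: first_passage_def)
    then show False using e(2)[of v] by auto
  qed
qed

text \<open>Just after \<sigma> the path is still below \<open>x\<close>, and inside this window
  there is a stretch on which it stays above \<open>y\<close>. A mesh shorter than that stretch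
  cannot miss it.\<close>

lemma first_passage_on_grid:
  assumes f: "regular_path f" and \<sigma>: "first_passage f y \<sigma>" and "y < x" and e: "\<sigma> < e"
  obtains d where "0 < d" and
    "\<And>\<delta>. 0 < \<delta> \<Longrightarrow> \<delta> < d \<Longrightarrow>
      \<exists>n. \<sigma> < real n * \<delta> \<and> real n * \<delta> < e \<and> (\<forall>i<n. f (real i * \<delta>) \<le> y) \<and> y < f (real n * \<delta>) \<and> f (real n * \<delta>) \<le> x"
proof -
  have s0: "0 \<le> \<sigma>" using \<sigma> by (simp add: first_passage_def)
  have rc: "(f \<longlongrightarrow> f t) (at_right t)" if "0 \<le> t" for t using f that by (simp add: regular_path_def)
  have "f \<sigma> < x" using first_passage_value[OF f \<sigma>] \<open>y < x\<close> by simp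
  then obtain e1 where e1: "\<sigma> < e1" "\<And>v. \<sigma> \<le> v \<Longrightarrow> v < e1 \<Longrightarrow> f v < x"
    using right_continuous_stays_below[OF rc[OF s0]] by blast
  obtain v where v: "\<sigma> < v" "v < min e e1" "y < f v"
    using \<sigma> e e1(1) unfolding first_passage_def by (metis min_less_iff_conj)
  obtain e2 where e2: "v < e2" "\<And>w. v \<le> w \<Longrightarrow> w < e2 \<Longrightarrow> y < f w"
    using right_continuous_stays_above[OF rc v(3)] v(1) s0 by auto
  \<comment> \<open>The length of the stretch after \<open>v\<close> on which the path is above
    \<open>y\<close>, cut so as to remain before \<open>e\<close> and in the window below
    \<open>x\<close>.\<close>
  define d where "d = min e2 (min e e1) - v"
  have "0 < d" using v e2 by (simp add: d_def)
  moreover have "\<exists>n. \<sigma> < real n * \<delta> \<and> real n * \<delta> < e \<and> (\<forall>i<n. f (real i * \<delta>) \<le> y) \<and> y < f (real n * \<delta>) \<and> f (real n * \<delta>) \<le> x"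
    if d: "0 < \<delta>" "\<delta> < d" for \<delta>
  proof -
    define n where "n = nat \<lceil>v / \<delta>\<rceil>"
    have vd: "0 \<le> v / \<delta>" using d v s0 by simp
    have rn: "real n = of_int \<lceil>v / \<delta>\<rceil>" using vd by (simp add: n_def)
    have "v / \<delta> \<le> real n" "real n < v / \<delta> + 1" unfolding rn by linarith+
    then have n: "v \<le> real n * \<delta>" "real n * \<delta> < v + \<delta>" using d by (simp_all add: field_simps)
    have ex: "y < f (real n * \<delta>)" using n d e2(2) by (simp add: d_def)
    \<comment> \<open>The grid point in the stretch need not be the first one above
      \<open>y\<close>; the first one lies between \<sigma> and it, hence still in the window where
      the path is below \<open>x\<close>.\<close>
    define k where "k = (LEAST k. y < f (real k * \<delta>))"
    have k: "y < f (real k * \<delta>)" unfolding k_def by (rule LeastI[of _ n]) (rule ex)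
    have kn: "k \<le> n" unfolding k_def by (rule Least_le) (rule ex)
    have kmin: "\<forall>i<k. f (real i * \<delta>) \<le> y" using not_less_Least[of _ "\<lambda>k. y < f (real k * \<delta>)"] by (force simp: k_def)
    have "\<sigma> < real k * \<delta>"
    proof (rule ccontr)
      assume "\<not> \<sigma> < real k * \<delta>"
      then have "f (real k * \<delta>) \<le> y" using \<sigma> d by (auto simp: first_passage_def)
      then show False using k by simp
    qed
    moreover have "real k * \<delta> \<le> real n * \<delta>" using kn d by simp
    moreover have "real n * \<delta> < min e e1" using n d unfolding d_def by linarith
    ultimately show ?thesis using k kmin e1(2)[of "real k * \<delta>"] by (intro exI[of _ k]) auto
  qed
  ultimately show ?thesis using that by blast
qed

text \<open>On a fine grid the first grid value above \<open>y\<close> is also below \<open>x\<close>, because regular paths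
  creep over the level \<open>y\<close>.\<close>

lemma grid_crossing_eventually:
  assumes f: "regular_path f" and "0 \<le> y" "y < x" "0 < t" "0 < (m::nat)"
  shows "\<forall>\<^sub>F l in sequentially.
    (\<exists>n\<in>{l<..m * l}. (\<forall>i<n. f (real i * (t / real (m * l))) \<le> y) \<and>
        y < f (real n * (t / real (m * l))) \<and> f (real n * (t / real (m * l))) \<le> x)
    \<longleftrightarrow> (\<exists>s. 0 \<le> s \<and> s < t \<and> y < f s) \<and> \<not> (\<exists>s. 0 \<le> s \<and> s < t / m \<and> y < f s)"
    (is "\<forall>\<^sub>F l in sequentially. ?R l \<longleftrightarrow> ?C")
proof (cases "\<exists>s. 0 \<le> s \<and> s < t \<and> y < f s")
  case False
  then have le: "f v \<le> y" if "0 \<le> v" "v < t" for v using that by force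
  then have le': "f v \<le> y" if "0 \<le> v" "v \<le> t" for v
    using that regular_path_le_at_end[OF f \<open>0 < t\<close> le] by (cases "v = t") auto
  have nR: "\<not> ?R l" if l: "0 < l" for l
  proof
    assume "?R l"
    then obtain n where n: "n \<le> m * l" "y < f (real n * (t / real (m * l)))" by auto
    have "real n * (t / real (m * l)) \<le> real (m * l) * (t / real (m * l))"
      using n \<open>0 < t\<close> by (intro mult_right_mono) (auto simp del: of_nat_mult)
    then have "real n * (t / real (m * l)) \<le> t" using l \<open>0 < m\<close> by simp
    then show False using le'[of "real n * (t / real (m * l))"] n \<open>0 < t\<close> by auto
  qed
  have "\<forall>\<^sub>F l in sequentially. 0 < (l::nat)" by (rule eventually_gt_at_top)
  then show ?thesis
  proof eventually_elim
    case (elim l)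
    show ?case using nR[OF elim] False by blast
  qed
next
  case True
  then obtain \<sigma> where \<sigma>: "first_passage f y \<sigma>" using first_passage_exists[OF f \<open>0 \<le> y\<close>] by metis
  have iff: "(\<exists>s. 0 \<le> s \<and> s < t' \<and> y < f s) \<longleftrightarrow> \<sigma> < t'" for t'
    by (rule first_passage_exceeds_iff[OF \<sigma>])
  have st: "\<sigma> < t" using True iff by blast
  have lim: "(\<lambda>l. t / real (m * l)) \<longlonglongrightarrow> 0"
  proof -
    have "(\<lambda>l. (t / real m) * inverse (real l)) \<longlonglongrightarrow> (t / real m) * 0"
      by (intro tendsto_intros lim_inverse_n)
    then show ?thesis by (simp add: field_simps)
  qed
  have small: "\<forall>\<^sub>F l in sequentially. t / real (m * l) < d \<and> 0 < l" if "0 < d" for d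
    using order_tendstoD(2)[OF lim that] eventually_gt_at_top[of 0] by (rule eventually_conj)
  \<comment> \<open>Index \<open>l\<close> is the time \<open>t / m\<close> and index
    \<open>m * l\<close> the time \<open>t\<close>. If \<sigma> is before \<open>t / m\<close>, a
    fine grid already exceeds \<open>y\<close> at an index below \<open>l\<close>; otherwise its
    first exceedance comes after index \<open>l\<close>.\<close>
  show ?thesis
  proof (cases "\<sigma> < t / m")
    case True
    then obtain d where d: "0 < d" "\<And>\<delta>. 0 < \<delta> \<Longrightarrow> \<delta> < d \<Longrightarrow>
      \<exists>n. \<sigma> < real n * \<delta> \<and> real n * \<delta> < t / m \<and> (\<forall>i<n. f (real i * \<delta>) \<le> y) \<and> y < f (real n * \<delta>) \<and> f (real n * \<delta>) \<le> x"
      using first_passage_on_grid[OF f \<sigma> \<open>y < x\<close> True] by blast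
    have nR: "\<not> ?R l" if l: "t / real (m * l) < d" "0 < l" for l
    proof
      assume "?R l"
      then obtain n where n: "l < n" "\<And>i. i < n \<Longrightarrow> f (real i * (t / real (m * l))) \<le> y" by auto
      have "0 < t / real (m * l)" using l \<open>0 < t\<close> \<open>0 < m\<close> by simp
      from d(2)[OF this l(1)] obtain k where k: "real k * (t / real (m * l)) < t / m" "y < f (real k * (t / real (m * l)))"
        by blast
      have "real k < real l" using k(1) l \<open>0 < t\<close> \<open>0 < m\<close> by (simp add: field_simps)
      then show False using n(1) n(2)[of k] k(2) by force
    qed
    have nC: "\<not> ?C" using True unfolding iff by simp
    show ?thesis using small[OF d(1)]
    proof eventually_elim
      case (elim l)
      show ?case using nR[of l] elim nC by blast
    qed
  next
    case False
    obtain d where d: "0 < d" "\<And>\<delta>. 0 < \<delta> \<Longrightarrow> \<delta> < d \<Longrightarrow>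
      \<exists>n. \<sigma> < real n * \<delta> \<and> real n * \<delta> < t \<and> (\<forall>i<n. f (real i * \<delta>) \<le> y) \<and> y < f (real n * \<delta>) \<and> f (real n * \<delta>) \<le> x"
      using first_passage_on_grid[OF f \<sigma> \<open>y < x\<close> st] by blast
    have R: "?R l" if l: "t / real (m * l) < d" "0 < l" for l
    proof -
      have "0 < t / real (m * l)" using l \<open>0 < t\<close> \<open>0 < m\<close> by simp
      from d(2)[OF this l(1)] obtain n where n: "\<sigma> < real n * (t / real (m * l))" "real n * (t / real (m * l)) < t"
        "(\<forall>i<n. f (real i * (t / real (m * l))) \<le> y) \<and> y < f (real n * (t / real (m * l))) \<and> f (real n * (t / real (m * l))) \<le> x" by blast
      have "t / m < real n * (t / real (m * l))" using n(1) False by simp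
      then have "real l < real n" using l \<open>0 < t\<close> \<open>0 < m\<close> by (simp add: field_simps)
      moreover have "real n < real (m * l)" using n(2) l \<open>0 < t\<close> \<open>0 < m\<close> by (simp add: field_simps)
      ultimately have "n \<in> {l<..m * l}" by (simp del: of_nat_mult)
      then show ?thesis using n(3) by blast
    qed
    have C: "?C" using False st unfolding iff by simp
    show ?thesis using small[OF d(1)]
    proof eventually_elim
      case (elim l)
      show ?case using R[of l] elim C by blast
    qed
  qed
qed

section \<open>Limits of probabilities when membership stabilises\<close>

context prob_space
begin

lemma prob_tendsto_eventually_eq:
  assumes E: "\<And>n. E n \<in> events" "F \<in> events"
    and agree: "AE \<omega> in M. \<forall>\<^sub>F n in sequentially. \<omega> \<in> E n \<longleftrightarrow> \<omega> \<in> F"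
  shows "(\<lambda>n. prob (E n)) \<longlonglongrightarrow> prob F"
proof -
  have "(\<lambda>n. integral\<^sup>L M (indicator (E n))) \<longlonglongrightarrow> integral\<^sup>L M (indicator F :: _ \<Rightarrow> real)"
  proof (rule integral_dominated_convergence[where w="\<lambda>_. 1"])
    show "AE \<omega> in M. (\<lambda>n. indicator (E n) \<omega> :: real) \<longlonglongrightarrow> indicator F \<omega>"
      using agree
    proof eventually_elim
      case (elim \<omega>)
      then show ?case by (intro tendsto_eventually) (auto elim!: eventually_mono simp: indicator_def)
    qed
  qed (use E in \<open>auto simp: indicator_def\<close>)
  then show ?thesis using E by simp
qed

text \<open>Intersecting \<open>E n\<close> with \<open>F\<close> turns the one known inclusion into
  an eventual equality. The two one-sided versions serve where paths touching a level exactly cannot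
  be decided.\<close>

lemma prob_le_limit:
  assumes E: "\<And>n. E n \<in> events" "F \<in> events" and L: "(\<lambda>n. prob (E n)) \<longlonglongrightarrow> L"
    and agree: "AE \<omega> in M. \<omega> \<in> F \<longrightarrow> (\<forall>\<^sub>F n in sequentially. \<omega> \<in> E n)"
  shows "prob F \<le> L"
proof (rule LIMSEQ_le[OF _ L])
  show "(\<lambda>n. prob (E n \<inter> F)) \<longlonglongrightarrow> prob F"
    using E agree by (intro prob_tendsto_eventually_eq) (auto elim!: eventually_mono)
  show "\<exists>N. \<forall>n\<ge>N. prob (E n \<inter> F) \<le> prob (E n)" using E by (auto intro!: finite_measure_mono)
qed

lemma limit_le_prob:
  assumes E: "\<And>n. E n \<in> events" "F \<in> events" and L: "(\<lambda>n. prob (E n)) \<longlonglongrightarrow> L"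
    and agree: "AE \<omega> in M. \<omega> \<notin> F \<longrightarrow> (\<forall>\<^sub>F n in sequentially. \<omega> \<notin> E n)"
  shows "L \<le> prob F"
proof (rule LIMSEQ_le[OF L])
  show "(\<lambda>n. prob (E n \<union> F)) \<longlonglongrightarrow> prob F"
    using E agree by (intro prob_tendsto_eventually_eq) (auto elim!: eventually_mono)
  show "\<exists>N. \<forall>n\<ge>N. prob (E n) \<le> prob (E n \<union> F)" using E by (auto intro!: finite_measure_mono)
qed

end

text \<open>Regularity is demanded of every outcome, so that passage events are events of
  \<open>M\<close> itself and the path lemmas apply without exceptional sets.\<close>

locale regular_levy = levy_increments +
  assumes regular: "regular_path (\<lambda>t. X t \<omega>)"
begin

lemma right_cont: "0 \<le> t \<Longrightarrow> ((\<lambda>s. X s \<omega>) \<longlongrightarrow> X t \<omega>) (at_right t)"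
  using regular[of \<omega>] by (simp add: regular_path_def)

text \<open>Rational times make this a countable union of one-coordinate conditions, hence
  measurable in the product space; for regular paths it agrees with \<open>exceed\<close>. The drift
  \<open>d\<close> will absorb the change of slope of the barrier.\<close>

definition exceed_paths :: "real \<Rightarrow> ereal \<Rightarrow> real \<Rightarrow> (real \<Rightarrow> real) set" where
  "exceed_paths d r z = {w \<in> space paths. \<exists>q\<in>\<rat>. 0 \<le> q \<and> ereal q < r \<and> z < w q + d * q}"

definition exceed :: "real \<Rightarrow> ereal \<Rightarrow> real \<Rightarrow> 'a set" where
  "exceed d r z = {\<omega> \<in> space M. \<exists>s. 0 \<le> s \<and> ereal s < r \<and> z < X s \<omega> + d * s}"

definition passing :: "real \<Rightarrow> real \<Rightarrow> 'a set" where
  "passing t a = {\<omega> \<in> space M. \<exists>s. 0 \<le> s \<and> s < t \<and> a < X s \<omega>}"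

definition passage_prob :: "real \<Rightarrow> real \<Rightarrow> real" where
  "passage_prob t a = prob (passing t a)"

lemma exceed_zero_drift: "exceed 0 (ereal t) a = passing t a"
  by (simp add: exceed_def passing_def)

lemma exceed_paths_measurable [measurable]: "exceed_paths d r z \<in> sets paths"
proof -
  have "exceed_paths d r z = (\<Union>q\<in>{q\<in>\<rat>. 0 \<le> q \<and> ereal q < r}. {w \<in> space paths. z < w q + d * q})"
    by (auto simp: exceed_paths_def)
  also have "\<dots> \<in> sets paths"
  proof (rule sets.countable_UN'')
    show "countable {q\<in>\<rat>. 0 \<le> q \<and> ereal q < r}"
      by (rule countable_subset[OF _ countable_rat]) auto
    fix q :: real assume q: "q \<in> {q\<in>\<rat>. 0 \<le> q \<and> ereal q < r}"
    have [measurable]: "(\<lambda>w. w q) \<in> measurable paths borel"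
      using q by (intro measurable_component_singleton) auto
    show "{w \<in> space paths. z < w q + d * q} \<in> sets paths" by measurable
  qed
  finally show ?thesis .
qed

lemma shifted_in_exceed_paths_iff:
  assumes t: "0 \<le> t"
  shows "shifted t \<omega> \<in> exceed_paths d r z \<longleftrightarrow> (\<exists>s. 0 \<le> s \<and> ereal s < r \<and> z < X (t + s) \<omega> - X t \<omega> + d * s)"
proof -
  have "((\<lambda>s. X (t + s) \<omega> - X t \<omega> + d * s) \<longlongrightarrow> X (t + s) \<omega> - X t \<omega> + d * s) (at_right s)" if "0 \<le> s" for s
  proof -
    have "filterlim (\<lambda>s. t + s) (at_right (t + s)) (at_right s)"
      unfolding filterlim_at by (auto intro!: tendsto_intros simp: eventually_at_right_field exI[of _ "s+1"])
    then have "((\<lambda>s. X (t + s) \<omega>) \<longlongrightarrow> X (t + s) \<omega>) (at_right s)"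
      using right_cont[of "t + s" \<omega>] t that by (rule_tac filterlim_compose) auto
    then show ?thesis by (intro tendsto_intros)
  qed
  from right_continuous_exceeds_iff_Rats[OF this, of r z]
  have "(\<exists>s. 0 \<le> s \<and> ereal s < r \<and> z < X (t + s) \<omega> - X t \<omega> + d * s) \<longleftrightarrow>
     (\<exists>s\<in>\<rat>. 0 \<le> s \<and> ereal s < r \<and> z < X (t + s) \<omega> - X t \<omega> + d * s)" by simp
  also have "\<dots> \<longleftrightarrow> shifted t \<omega> \<in> exceed_paths d r z"
    by (auto simp: exceed_paths_def shifted_def space_PiM)
  finally show ?thesis by simp
qed

lemma shifted_zero: "shifted 0 = path"
  by (simp add: fun_eq_iff shifted_def path_def start)

lemma exceed_eq_vimage: "exceed d r z = path -` exceed_paths d r z \<inter> space M"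
  using shifted_in_exceed_paths_iff[of 0 _ d r z] by (auto simp: shifted_zero exceed_def start)

lemma exceed_event [measurable]: "exceed d r z \<in> events"
  unfolding exceed_eq_vimage by measurable

lemma passing_event [measurable]: "passing t a \<in> events"
  using exceed_event[of 0 "ereal t" a] by (simp add: exceed_zero_drift)

lemma passage_prob_bounds [simp]: "0 \<le> passage_prob t a" "passage_prob t a \<le> 1"
  by (simp_all add: passage_prob_def)

lemma passing_mono: "s \<le> t \<Longrightarrow> a \<le> b \<Longrightarrow> passing s b \<subseteq> passing t a"
  by (force simp: passing_def)

lemma passage_prob_mono: "s \<le> t \<Longrightarrow> a \<le> b \<Longrightarrow> passage_prob s b \<le> passage_prob t a"
  unfolding passage_prob_def by (intro finite_measure_mono passing_mono passing_event)

lemma passage_prob_nonpos_time: "t \<le> 0 \<Longrightarrow> passage_prob t a = 0"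
proof -
  assume "t \<le> 0"
  then have "passing t a = {}" by (auto simp: passing_def)
  then show ?thesis by (simp add: passage_prob_def)
qed

lemma passage_prob_measurable [measurable]:
  "(\<lambda>a. passage_prob t a) \<in> borel_measurable borel" "(\<lambda>t. passage_prob t a) \<in> borel_measurable borel"
proof -
  have "mono (\<lambda>a. - passage_prob t a)" by (intro monoI) (simp add: passage_prob_mono)
  then have "(\<lambda>a. - (- passage_prob t a)) \<in> borel_measurable borel" by (intro borel_measurable_uminus borel_measurable_mono)
  then show "(\<lambda>a. passage_prob t a) \<in> borel_measurable borel" by simp
  show "(\<lambda>t. passage_prob t a) \<in> borel_measurable borel" by (intro borel_measurable_mono monoI passage_prob_mono) auto
qed

text \<open>Strict exceedance survives a small increase of the level. Levels approaching from below
  would instead also count paths whose supremum is exactly \<open>a\<close>.\<close>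

lemma passage_prob_tendsto_level:
  assumes "\<And>n. a \<le> b n" "b \<longlonglongrightarrow> a"
  shows "(\<lambda>n. passage_prob t (b n)) \<longlonglongrightarrow> passage_prob t a"
  unfolding passage_prob_def
proof (intro prob_tendsto_eventually_eq passing_event AE_I2)
  fix \<omega> assume "\<omega> \<in> space M"
  show "\<forall>\<^sub>F n in sequentially. (\<omega> \<in> passing t (b n)) = (\<omega> \<in> passing t a)"
  proof (cases "\<omega> \<in> passing t a")
    case True
    then obtain s where s: "0 \<le> s" "s < t" "a < X s \<omega>" by (auto simp: passing_def)
    have "\<forall>\<^sub>F n in sequentially. b n < X s \<omega>" using order_tendstoD(2)[OF assms(2) s(3)] .
    then show ?thesis using s True \<open>\<omega> \<in> space M\<close> by (auto elim!: eventually_mono simp: passing_def)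
  next
    case False
    then show ?thesis using passing_mono[OF order_refl assms(1)] by (intro always_eventually) blast
  qed
qed

lemma passage_prob_tendsto_time:
  assumes "\<And>n. u n \<le> t" "u \<longlonglongrightarrow> t"
  shows "(\<lambda>n. passage_prob (u n) a) \<longlonglongrightarrow> passage_prob t a"
  unfolding passage_prob_def
proof (intro prob_tendsto_eventually_eq passing_event AE_I2)
  fix \<omega> assume "\<omega> \<in> space M"
  show "\<forall>\<^sub>F n in sequentially. (\<omega> \<in> passing (u n) a) = (\<omega> \<in> passing t a)"
  proof (cases "\<omega> \<in> passing t a")
    case True
    then obtain s where s: "0 \<le> s" "s < t" "a < X s \<omega>" by (auto simp: passing_def)
    have "\<forall>\<^sub>F n in sequentially. s < u n" using order_tendstoD(1)[OF assms(2) s(2)] .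
    then show ?thesis using s True \<open>\<omega> \<in> space M\<close> by (auto elim!: eventually_mono simp: passing_def)
  next
    case False
    then show ?thesis using passing_mono[OF assms(1) order_refl] by (intro always_eventually) blast
  qed
qed

lemma passage_prob_tendsto_0:
  assumes "u \<longlonglongrightarrow> 0" "0 < a"
  shows "(\<lambda>n. passage_prob (u n) a) \<longlonglongrightarrow> 0"
proof -
  have "(\<lambda>n. prob (passing (u n) a)) \<longlonglongrightarrow> prob {}"
  proof (intro prob_tendsto_eventually_eq passing_event AE_I2)
    fix \<omega> assume "\<omega> \<in> space M"
    have "X 0 \<omega> < a" using assms(2) start by simp
    then obtain e where e: "0 < e" "\<And>v. 0 \<le> v \<Longrightarrow> v < e \<Longrightarrow> X v \<omega> < a"
      using right_continuous_stays_below[OF right_cont[of 0]] by auto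
    have "\<forall>\<^sub>F n in sequentially. u n < e" using order_tendstoD(2)[OF assms(1) e(1)] .
    then show "\<forall>\<^sub>F n in sequentially. (\<omega> \<in> passing (u n) a) = (\<omega> \<in> {})"
      by eventually_elim (use e(2) in \<open>force simp: passing_def\<close>)
  qed auto
  then show ?thesis by (simp add: passage_prob_def)
qed

text \<open>There are no fixed times of discontinuity: the jump at \<open>t\<close> is the limit of
  increments over \<open>[t - h, t]\<close>, which have the law of \<open>X h\<close>, and this law
  tends to the point mass at 0 by right-continuity at the start.\<close>

lemma AE_left_continuous:
  assumes t: "0 < t"
  shows "AE \<omega> in M. ((\<lambda>s. X s \<omega>) \<longlongrightarrow> X t \<omega>) (at_left t)"
proof -
  define h where "h n = t / real (Suc n)" for n
  have h: "0 < h n" "h n \<le> t" for n using t by (auto simp: h_def field_simps)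
  have hn: "h n \<noteq> 0" for n using h(1)[of n] by simp
  have h0: "h \<longlonglongrightarrow> 0" unfolding h_def using LIMSEQ_Suc[OF lim_const_over_n[of t]] by simp
  define L where "L \<omega> = Lim (at_left t) (\<lambda>s. X s \<omega>)" for \<omega>
  have Llim: "((\<lambda>s. X s \<omega>) \<longlongrightarrow> L \<omega>) (at_left t)" for \<omega>
  proof -
    obtain l where "((\<lambda>s. X s \<omega>) \<longlongrightarrow> l) (at_left t)" using regular[of \<omega>] t unfolding regular_path_def by blast
    moreover from this have "L \<omega> = l" unfolding L_def by (intro tendsto_Lim) simp_all
    ultimately show ?thesis by simp
  qed
  have "filterlim (\<lambda>n. t - h n) (at_left t) sequentially"
    unfolding filterlim_at using h tendsto_diff[OF tendsto_const h0, of t] by (auto simp: hn)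
  then have L: "(\<lambda>n. X (t - h n) \<omega>) \<longlonglongrightarrow> L \<omega>" for \<omega>
    by (rule filterlim_compose[OF Llim])
  have "filterlim h (at_right 0) sequentially" unfolding filterlim_at using h h0 by (auto simp: hn)
  then have R: "(\<lambda>n. X (h n) \<omega>) \<longlonglongrightarrow> 0" for \<omega>
    using filterlim_compose[OF right_cont[of 0 \<omega>]] start by auto
  have [measurable]: "X (h n) \<in> borel_measurable M" "X (t - h n) \<in> borel_measurable M" "X t \<in> borel_measurable M" for n
    using h[of n] t by (auto intro!: rv)
  have Lm [measurable]: "L \<in> borel_measurable M"
    by (rule borel_measurable_LIMSEQ_real[OF L]) simp
  \<comment> \<open>A bounded distance from 0: dominated convergence applies to it, and its
    expectation vanishes only if the jump is almost surely 0.\<close>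
  let ?c = "\<lambda>x::real. min 1 \<bar>x\<bar>"
  have eq: "(\<integral>\<omega>. ?c (X t \<omega> - X (t - h n) \<omega>) \<partial>M) = (\<integral>\<omega>. ?c (X (h n) \<omega>) \<partial>M)" for n
  proof -
    have "(\<integral>\<omega>. ?c (X t \<omega> - X (t - h n) \<omega>) \<partial>M) = (\<integral>x. ?c x \<partial>distr M borel (\<lambda>\<omega>. X t \<omega> - X (t - h n) \<omega>))"
      by (subst integral_distr) auto
    also have "distr M borel (\<lambda>\<omega>. X t \<omega> - X (t - h n) \<omega>) = distr M borel (X (h n))"
      using stationary_increments[of "t - h n" t] h[of n] by simp
    also have "(\<integral>x. ?c x \<partial>distr M borel (X (h n))) = (\<integral>\<omega>. ?c (X (h n) \<omega>) \<partial>M)"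
      by (subst integral_distr) auto
    finally show ?thesis .
  qed
  have "(\<lambda>n. ?c (X (h n) \<omega>)) \<longlonglongrightarrow> ?c 0" for \<omega> by (intro tendsto_intros R)
  then have "(\<lambda>n. \<integral>\<omega>. ?c (X (h n) \<omega>) \<partial>M) \<longlonglongrightarrow> (\<integral>\<omega>. ?c 0 \<partial>M)"
    by (intro integral_dominated_convergence[where w="\<lambda>_. 1"] AE_I2) auto
  moreover have "(\<lambda>n. \<integral>\<omega>. ?c (X t \<omega> - X (t - h n) \<omega>) \<partial>M) \<longlonglongrightarrow> (\<integral>\<omega>. ?c (X t \<omega> - L \<omega>) \<partial>M)"
    by (rule integral_dominated_convergence[where w="\<lambda>_. 1"])
      (auto intro!: tendsto_intros L)
  ultimately have "(\<integral>\<omega>. ?c (X t \<omega> - L \<omega>) \<partial>M) = 0"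
    unfolding eq using LIMSEQ_unique by fastforce
  moreover have "integrable M (\<lambda>\<omega>. ?c (X t \<omega> - L \<omega>))"
    by (rule integrable_const_bound[where B=1]) auto
  ultimately have "AE \<omega> in M. ?c (X t \<omega> - L \<omega>) = 0"
    by (subst (asm) integral_nonneg_eq_0_iff_AE) auto
  then show ?thesis
  proof eventually_elim
    case (elim \<omega>)
    then have "X t \<omega> = L \<omega>" by (auto simp: min_def split: if_splits)
    then show ?case using Llim by simp
  qed
qed

end

section \<open>Kendall's identity\<close>

definition psum :: "(nat \<Rightarrow> real) \<Rightarrow> nat \<Rightarrow> real" where
  "psum z j = (\<Sum>i<j. z i)"

text \<open>The change of the maximum when a window of \<open>n\<close> positions moves one step.
  This form telescopes under rotation; by \<open>record_gap_pos\<close> it is the height of a new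
  record at \<open>n\<close> whenever the final position is positive.\<close>

definition record_gap :: "nat \<Rightarrow> (nat \<Rightarrow> real) \<Rightarrow> real" where
  "record_gap n z = Max (psum z ` {1..n}) - Max (psum z ` {0..<n})"

lemma Max_image_add:
  fixes f :: "nat \<Rightarrow> real"
  assumes "finite A" "A \<noteq> {}"
  shows "Max ((\<lambda>i. f i + c) ` A) = Max (f ` A) + c"
proof -
  have "Max ((\<lambda>y. y + c) ` f ` A) = Max (f ` A) + c"
    using assms by (intro mono_Max_commute[symmetric] monoI) auto
  then show ?thesis by (simp add: image_image)
qed

text \<open>Extend the increments periodically. The rotation by \<open>j\<close> is then the window
  starting at \<open>j\<close>, recentred at its first position, so its gap is the difference of two
  consecutive window maxima. These telescope over one period, and a full period raises the window
  maximum by the total sum.\<close>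

lemma sum_record_gap_rotations:
  assumes n: "0 < n"
  shows "(\<Sum>j<n. record_gap n (\<lambda>i. z ((i + j) mod n))) = psum z n"
proof -
  define s where "s = psum (\<lambda>i. z (i mod n))"
  define L where "L j = Max (s ` {j..<j+n})" for j
  have shift: "psum (\<lambda>i. z ((i + j) mod n)) i = s (i + j) + - s j" for i j
    unfolding s_def psum_def by (induction i) simp_all
  have gap: "record_gap n (\<lambda>i. z ((i + j) mod n)) = L (Suc j) - L j" for j
  proof -
    have im: "(\<lambda>i. s (i + j) + - s j) ` A = (\<lambda>k. s k + - s j) ` (\<lambda>i. i + j) ` A" for A
      by (simp add: image_image)
    have "(\<lambda>i. i + j) ` {1..n} = {Suc j..<Suc j + n}" "(\<lambda>i. i + j) ` {0..<n} = {j..<j + n}"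
      by (auto simp: image_add_atLeastAtMost' atLeastLessThanSuc_atLeastAtMost add.commute)
    then have "record_gap n (\<lambda>i. z ((i + j) mod n)) =
        Max ((\<lambda>k. s k + - s j) ` {Suc j..<Suc j + n}) - Max ((\<lambda>k. s k + - s j) ` {j..<j + n})"
      unfolding record_gap_def shift im by simp
    also have "\<dots> = L (Suc j) - L j"
      unfolding L_def using n by (subst (1 2) Max_image_add) auto
    finally show ?thesis .
  qed
  have per: "s (i + n) = s i + s n" for i
  proof (induction i)
    case (Suc i)
    have "s (Suc i + n) = s (i + n) + z (i mod n)" by (simp add: s_def psum_def)
    then show ?case using Suc by (simp add: s_def psum_def)
  qed (simp add: s_def psum_def)
  have "L n = Max ((\<lambda>i. s i + s n) ` {0..<n})"
  proof -
    have "s ` {n..<n + n} = (\<lambda>i. s (i + n)) ` {0..<n}"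
      using image_image[of s "\<lambda>i. i + n" "{0..<n}"] by simp
    then show ?thesis unfolding L_def per by simp
  qed
  also have "\<dots> = L 0 + s n" unfolding L_def using n by (subst Max_image_add) auto
  finally have "L n - L 0 = s n" by simp
  then show ?thesis
    unfolding gap sum_lessThan_telescope by (simp add: s_def psum_def)
qed

text \<open>The two windows differ in position 0, which has value 0, and in position
  \<open>n\<close>. A positive value at \<open>n\<close> exceeds the former, so the maxima can
  differ only if \<open>n\<close> is a record.\<close>

lemma record_gap_pos:
  assumes n: "0 < n" and pos: "0 < psum z n"
  shows "record_gap n z = max 0 (psum z n - Max (psum z ` {0..<n}))"
proof (cases "n = 1")
  case True
  then show ?thesis using pos by (simp add: record_gap_def psum_def)
next
  case False
  define A where "A = Max (psum z ` {1..<n})"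
  have ne: "{1..<n} \<noteq> {}" using n False by auto
  have "{1..n} = insert n {1..<n}" using n by auto
  then have "Max (psum z ` {1..n}) = max (psum z n) A"
    unfolding A_def using ne by (simp add: Max_insert)
  moreover have "{0..<n} = insert 0 {1..<n}" using n by auto
  then have "Max (psum z ` {0..<n}) = max 0 A"
    unfolding A_def using ne by (simp add: Max_insert psum_def)
  ultimately show ?thesis using pos by (simp add: record_gap_def max_def)
qed

lemma psum_measurable: "j \<le> n \<Longrightarrow> (\<lambda>z. psum z j) \<in> borel_measurable (\<Pi>\<^sub>M i\<in>{..<n}. (borel::real measure))"
  unfolding psum_def by (intro borel_measurable_sum measurable_component_singleton) auto

lemma psum_cong: "(\<And>i. i < j \<Longrightarrow> z i = w i) \<Longrightarrow> psum z j = psum w j"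
  by (simp add: psum_def)

lemma inj_on_rotation: "inj_on (\<lambda>i. (i + j) mod n) {..<n::nat}"
proof (rule inj_onI)
  have le: "a = b" if "a \<le> b" "b < n" "(a + j) mod n = (b + j) mod n" for a b
  proof -
    have "n dvd (b + j) - (a + j)" using that mod_eq_dvd_iff_nat[of "a + j" "b + j" n] by simp
    then have "n dvd b - a" by simp
    then show ?thesis using that by (auto dest: dvd_imp_le)
  qed
  fix a b assume "a \<in> {..<n}" "b \<in> {..<n}" "(a + j) mod n = (b + j) mod n"
  then show "a = b" using le[of a b] le[of b a] by (cases "a \<le> b") auto
qed

context prob_space
begin

lemma distr_rotation:
  fixes j :: nat
  assumes n: "0 < n" and indep: "indep_vars (\<lambda>_. borel) Z {..<n}"
    and law: "\<And>i. i < n \<Longrightarrow> distr M borel (Z i) = \<nu>"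
  shows "distr M (\<Pi>\<^sub>M i\<in>{..<n}. borel) (\<lambda>\<omega>. \<lambda>i\<in>{..<n}. Z ((i + j) mod n) \<omega>) = (\<Pi>\<^sub>M i\<in>{..<n}. \<nu>)"
proof -
  have rv: "Z i \<in> borel_measurable M" if "i < n" for i
    using indep that by (auto simp: indep_vars_def)
  note inj = inj_on_rotation[of j n]
  let ?\<pi> = "\<lambda>i. (i + j) mod n"
  \<comment> \<open>Re-indexing by the rotation is obtained by grouping the family into singleton
    blocks and then reading off their only coordinate.\<close>
  have "indep_vars (\<lambda>j. PiM {?\<pi> j} (\<lambda>_. borel)) (\<lambda>j \<omega>. restrict (\<lambda>i. Z i \<omega>) {?\<pi> j}) {..<n}"
  proof (rule indep_vars_restrict[OF indep])
    show "disjoint_family_on (\<lambda>j. {?\<pi> j}) {..<n}"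
      unfolding disjoint_family_on_def using inj_on_eq_iff[OF inj] by blast
    show "{?\<pi> i} \<subseteq> {..<n}" for i using n by simp
  qed
  then have "indep_vars (\<lambda>_. borel) (\<lambda>j \<omega>. (\<lambda>w. w (?\<pi> j)) (restrict (\<lambda>i. Z i \<omega>) {?\<pi> j})) {..<n}"
    by (rule indep_vars_compose2) (auto intro!: measurable_component_singleton)
  then have ind: "indep_vars (\<lambda>_. borel) (\<lambda>i. Z (?\<pi> i)) {..<n}"
    by (simp add: fun_eq_iff)
  have "distr M (\<Pi>\<^sub>M i\<in>{..<n}. borel) (\<lambda>\<omega>. \<lambda>i\<in>{..<n}. Z (?\<pi> i) \<omega>) = (\<Pi>\<^sub>M i\<in>{..<n}. distr M borel (Z (?\<pi> i)))"
    using ind rv n by (subst (asm) indep_vars_iff_distr_eq_PiM') auto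
  also have "\<dots> = (\<Pi>\<^sub>M i\<in>{..<n}. \<nu>)"
    using n by (intro PiM_cong refl law) auto
  finally show ?thesis .
qed

text \<open>Averaging over the cyclic rotations of the increments turns the last record gap into the
  final position of the walk (the ballot-type argument behind Kendall's identity).\<close>

lemma expectation_record_gap:
  assumes n: "0 < n" and indep: "indep_vars (\<lambda>_. borel) Z {..<n}"
    and law: "\<And>i. i < n \<Longrightarrow> distr M borel (Z i) = \<nu>"
  shows "real n * (\<integral>\<omega>. record_gap n (\<lambda>i. Z i \<omega>) * indicator {0<..x} (psum (\<lambda>i. Z i \<omega>) n) \<partial>M)
       = (\<integral>\<omega>. psum (\<lambda>i. Z i \<omega>) n * indicator {0<..x} (psum (\<lambda>i. Z i \<omega>) n) \<partial>M)"
proof -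
  let ?P = "\<Pi>\<^sub>M i\<in>{..<n}. (borel :: real measure)"
  define F where "F z = record_gap n z * indicator {0<..x} (psum z n)" for z
  have rv: "Z i \<in> borel_measurable M" if "i < n" for i
    using indep that by (auto simp: indep_vars_def)
  have gm: "record_gap n \<in> borel_measurable ?P"
  proof -
    have "(\<lambda>z. Max ((\<lambda>i. psum z i) ` A)) \<in> borel_measurable ?P" if "finite A" "A \<subseteq> {..n}" for A
      using that by (intro borel_measurable_Max psum_measurable) auto
    note Max_meas = this
    show ?thesis unfolding record_gap_def[abs_def] by (intro borel_measurable_diff Max_meas) auto
  qed
  have [measurable]: "(\<lambda>z. psum z n) \<in> borel_measurable ?P" by (rule psum_measurable) simp
  have F [measurable]: "F \<in> borel_measurable ?P"
    unfolding F_def using gm by measurable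
  have F_cong: "F z = F w" if "\<And>i. i < n \<Longrightarrow> z i = w i" for z w
  proof -
    have "psum z j = psum w j" if "j \<le> n" for j
      using that \<open>\<And>i. i < n \<Longrightarrow> z i = w i\<close> by (intro psum_cong) auto
    then have "psum z ` {1..n} = psum w ` {1..n}" "psum z ` {0..<n} = psum w ` {0..<n}" "psum z n = psum w n"
      by (auto intro!: image_cong)
    then show ?thesis by (simp add: F_def record_gap_def)
  qed
  \<comment> \<open>Position 0 keeps the earlier maximum nonnegative, so the gap is at most the
    final position, which the indicator caps by \<open>x\<close>. This bound gives integrability for
    arbitrary increment laws.\<close>
  have F_bounds: "0 \<le> F z" "F z \<le> max 0 x" for z
  proof -
    have "0 \<le> Max (psum z ` {0..<n})"
    proof -
      have "psum z 0 \<le> Max (psum z ` {0..<n})" using n by (intro Max_ge) auto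
      then show ?thesis by (simp add: psum_def)
    qed
    then show "0 \<le> F z" "F z \<le> max 0 x"
      unfolding F_def using record_gap_pos[OF n, of z] by (auto simp: indicator_def)
  qed
  define W where "W j \<omega> = (\<lambda>i\<in>{..<n}. Z ((i + j) mod n) \<omega>)" for j \<omega>
  have W [measurable]: "W j \<in> measurable M ?P" for j
    unfolding W_def using n by (intro measurable_restrict rv) auto
  have FW: "F (W j \<omega>) = F (\<lambda>i. Z ((i + j) mod n) \<omega>)" for j \<omega>
    by (rule F_cong) (simp add: W_def)
  have int: "integrable M (\<lambda>\<omega>. F (W j \<omega>))" for j
    using F_bounds by (intro integrable_const_bound[where B="max 0 x"]) auto
  have same: "(\<integral>\<omega>. F (W j \<omega>) \<partial>M) = (\<integral>z. F z \<partial>(\<Pi>\<^sub>M i\<in>{..<n}. \<nu>))" for j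
  proof -
    have "W j = (\<lambda>\<omega>. \<lambda>i\<in>{..<n}. Z ((i + j) mod n) \<omega>)" by (simp add: fun_eq_iff W_def)
    then show ?thesis using integral_distr[OF W F, of j] distr_rotation[OF n indep law, of j] by simp
  qed
  have sumF: "(\<Sum>j<n. F (W j \<omega>)) = psum (\<lambda>i. Z i \<omega>) n * indicator {0<..x} (psum (\<lambda>i. Z i \<omega>) n)" for \<omega>
  proof -
    \<comment> \<open>Rotation leaves the final position unchanged, so the indicator factors out of
      the sum over rotations.\<close>
    have rot: "psum (\<lambda>i. Z ((i + j) mod n) \<omega>) n = psum (\<lambda>i. Z i \<omega>) n" for j
    proof -
      have "bij_betw (\<lambda>i. (i + j) mod n) {..<n} {..<n}"
      proof (rule bij_betw_imageI)
        show inj: "inj_on (\<lambda>i. (i + j) mod n) {..<n}" by (rule inj_on_rotation)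
        show "(\<lambda>i. (i + j) mod n) ` {..<n} = {..<n}"
          using n by (intro card_subset_eq) (auto simp: card_image[OF inj])
      qed
      from sum.reindex_bij_betw[OF this, of "\<lambda>i. Z i \<omega>"] show ?thesis by (simp add: psum_def)
    qed
    have "(\<Sum>j<n. F (W j \<omega>)) = (\<Sum>j<n. record_gap n (\<lambda>i. Z ((i + j) mod n) \<omega>)) * indicator {0<..x} (psum (\<lambda>i. Z i \<omega>) n)"
      by (simp only: FW) (simp only: F_def rot sum_distrib_right)
    then show ?thesis using sum_record_gap_rotations[OF n, of "\<lambda>i. Z i \<omega>"] by simp
  qed
  have "(\<integral>\<omega>. psum (\<lambda>i. Z i \<omega>) n * indicator {0<..x} (psum (\<lambda>i. Z i \<omega>) n) \<partial>M) = (\<Sum>j<n. \<integral>\<omega>. F (W j \<omega>) \<partial>M)"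
    unfolding sumF[symmetric] using int by (rule Bochner_Integration.integral_sum)
  also have "\<dots> = real n * (\<integral>\<omega>. F (W 0 \<omega>) \<partial>M)" unfolding same by simp
  also have "(\<lambda>\<omega>. F (W 0 \<omega>)) = (\<lambda>\<omega>. F (\<lambda>i. Z i \<omega>))"
    by (intro ext F_cong) (simp add: W_def)
  finally show ?thesis by (simp add: F_def)
qed

end

section \<open>The process sampled on a grid\<close>

context regular_levy
begin

definition grid_record :: "real \<Rightarrow> real \<Rightarrow> nat \<Rightarrow> real \<Rightarrow> 'a set" where
  "grid_record \<delta> x n y = {\<omega> \<in> space M. (\<forall>i<n. X (real i * \<delta>) \<omega> \<le> y) \<and> y < X (real n * \<delta>) \<omega> \<and> X (real n * \<delta>) \<omega> \<le> x}"

text \<open>For one outcome the levels first exceeded at step \<open>n\<close> fill the interval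
  between the old and the new maximum, whose length is the record gap. Exchanging the integrals over
  levels and outcomes reduces the claim to \<open>expectation_record_gap\<close>.\<close>

lemma expectation_grid_record:
  assumes \<delta>: "0 < \<delta>" and n: "0 < n"
  shows "(\<integral>\<^sup>+y. emeasure M (grid_record \<delta> x n y) * indicator {0..<x} y \<partial>lborel)
     = ennreal ((\<integral>\<omega>. X (real n * \<delta>) \<omega> * indicator {0<..x} (X (real n * \<delta>) \<omega>) \<partial>M) / real n)"
proof -
  define S where "S i \<omega> = X (real i * \<delta>) \<omega>" for i \<omega>
  have Sm [measurable]: "S i \<in> borel_measurable M" for i
    unfolding S_def using \<delta> by (intro rv) simp
  define Z where "Z i \<omega> = S (Suc i) \<omega> - S i \<omega>" for i \<omega>
  have ind: "indep_vars (\<lambda>_. borel) Z {..<n}"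
    unfolding Z_def S_def using \<delta> by (intro indep_increments) (auto intro!: mult_right_mono)
  have law: "distr M borel (Z i) = distr M borel (X \<delta>)" for i
    unfolding Z_def S_def using \<delta> stationary_increments[of "real i * \<delta>" "real (Suc i) * \<delta>"]
    by (simp add: algebra_simps)
  have pS: "psum (\<lambda>i. Z i \<omega>) j = S j \<omega>" for j \<omega>
    using sum_lessThan_telescope[of "\<lambda>i. S i \<omega>" j] start[of \<omega>] by (simp add: psum_def Z_def S_def)
  define D where "D \<omega> = max 0 (S n \<omega> - Max ((\<lambda>i. S i \<omega>) ` {0..<n})) * indicator {0<..x} (S n \<omega>)" for \<omega>
  have D_eq: "record_gap n (\<lambda>i. Z i \<omega>) * indicator {0<..x} (psum (\<lambda>i. Z i \<omega>) n) = D \<omega>" for \<omega>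
    using record_gap_pos[OF n, of "\<lambda>i. Z i \<omega>"] by (auto simp: D_def pS indicator_def)
  \<comment> \<open>Since the walk starts at 0, the levels first exceeded at step \<open>n\<close>
    are nonnegative, so the cut at level 0 loses nothing.\<close>
  have M0: "0 \<le> Max ((\<lambda>i. S i \<omega>) ` {0..<n})" for \<omega>
  proof -
    have "S 0 \<omega> \<le> Max ((\<lambda>i. S i \<omega>) ` {0..<n})" using n by (intro Max_ge) auto
    then show ?thesis by (simp add: S_def start)
  qed
  have [measurable]: "(\<lambda>\<omega>. Max ((\<lambda>i. S i \<omega>) ` {0..<n})) \<in> borel_measurable M"
    by (intro borel_measurable_Max) auto
  have D_meas [measurable]: "D \<in> borel_measurable M" unfolding D_def by measurable
  have D_int: "integrable M D"
  proof (rule integrable_const_bound[where B="max 0 x"])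
    show "AE \<omega> in M. norm (D \<omega>) \<le> max 0 x"
    proof (rule AE_I2)
      fix \<omega> show "norm (D \<omega>) \<le> max 0 x" using M0[of \<omega>] by (auto simp: D_def indicator_def)
    qed
  qed simp
  let ?E = "\<lambda>y. {\<omega> \<in> space M. (\<forall>i<n. S i \<omega> \<le> y) \<and> y < S n \<omega> \<and> S n \<omega> \<le> x}"
  have inner: "(\<integral>\<^sup>+y. indicator (?E y) \<omega> * indicator {0..<x} y \<partial>lborel) = ennreal (D \<omega>)" if "\<omega> \<in> space M" for \<omega>
  proof -
    have "(\<forall>i<n. S i \<omega> \<le> y) \<longleftrightarrow> Max ((\<lambda>i. S i \<omega>) ` {0..<n}) \<le> y" for y using n by (subst Max_le_iff) auto
    then have "indicator (?E y) \<omega> * indicator {0..<x} y =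
       (indicator (if S n \<omega> \<le> x then {Max ((\<lambda>i. S i \<omega>) ` {0..<n})..<S n \<omega>} else {}) y :: ennreal)" for y
      using M0[of \<omega>] that by (auto simp: indicator_def)
    then have "(\<integral>\<^sup>+y. indicator (?E y) \<omega> * indicator {0..<x} y \<partial>lborel) =
       emeasure lborel (if S n \<omega> \<le> x then {Max ((\<lambda>i. S i \<omega>) ` {0..<n})..<S n \<omega>} else {})"
      by simp
    also have "\<dots> = ennreal (D \<omega>)"
      using M0[of \<omega>] by (auto simp: D_def max_def indicator_def)
    finally show ?thesis .
  qed
  interpret P: pair_sigma_finite M lborel by unfold_locales
  have "(\<lambda>(\<omega>, y). indicator (?E y) \<omega> * indicator {0..<x} y :: ennreal) \<in> borel_measurable (M \<Otimes>\<^sub>M lborel)"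
  proof -
    have "(\<lambda>(\<omega>, y). indicator (?E y) \<omega> * indicator {0..<x} y :: ennreal) =
      (\<lambda>p. indicator {p \<in> space (M \<Otimes>\<^sub>M lborel). (\<forall>i\<in>{..<n}. S i (fst p) \<le> snd p) \<and> snd p < S n (fst p) \<and> S n (fst p) \<le> x} p * indicator {0..<x} (snd p))"
      by (auto simp: fun_eq_iff indicator_def space_pair_measure)
    also have "\<dots> \<in> borel_measurable (M \<Otimes>\<^sub>M lborel)" by measurable
    finally show ?thesis .
  qed
  from P.Fubini'[OF this]
  have "(\<integral>\<^sup>+y. \<integral>\<^sup>+\<omega>. indicator (?E y) \<omega> * indicator {0..<x} y \<partial>M \<partial>lborel) = (\<integral>\<^sup>+\<omega>. ennreal (D \<omega>) \<partial>M)"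
    by (simp add: inner cong: nn_integral_cong)
  also have "\<dots> = ennreal (\<integral>\<omega>. D \<omega> \<partial>M)"
    by (rule nn_integral_eq_integral[OF D_int]) (auto simp: D_def)
  also have "(\<integral>\<omega>. D \<omega> \<partial>M) = (\<integral>\<omega>. S n \<omega> * indicator {0<..x} (S n \<omega>) \<partial>M) / real n"
    using expectation_record_gap[OF n ind law, of x, unfolded D_eq] n by (simp add: pS field_simps)
  finally have "(\<integral>\<^sup>+y. \<integral>\<^sup>+\<omega>. indicator (?E y) \<omega> * indicator {0..<x} y \<partial>M \<partial>lborel) = ennreal ((\<integral>\<omega>. S n \<omega> * indicator {0<..x} (S n \<omega>) \<partial>M) / real n)" .
  moreover have E_ev: "?E y \<in> events" for y
  proof -
    have "?E y = {\<omega> \<in> space M. (\<forall>i\<in>{..<n}. S i \<omega> \<le> y) \<and> y < S n \<omega> \<and> S n \<omega> \<le> x}" by auto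
    also have "\<dots> \<in> events" by measurable
    finally show ?thesis .
  qed
  moreover have "(\<integral>\<^sup>+\<omega>. indicator (?E y) \<omega> * indicator {0..<x} y \<partial>M) = emeasure M (?E y) * indicator {0..<x} y" for y
    using E_ev[of y] by (subst nn_integral_multc) auto
  ultimately have "(\<integral>\<^sup>+y. emeasure M (?E y) * indicator {0..<x} y \<partial>lborel) =
      ennreal ((\<integral>\<omega>. S n \<omega> * indicator {0<..x} (S n \<omega>) \<partial>M) / real n)" by (simp only:)
  then show ?thesis by (simp only: grid_record_def S_def)
qed

end

text \<open>Cut to \<open>(0, R)\<close>, both functions are densities of finite measures with the
  same distribution function; finiteness makes the densities comparable almost everywhere.\<close>

lemma AE_eq_if_integrals_eq:
  fixes F1 F2 :: "real \<Rightarrow> ennreal"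
  assumes [measurable]: "F1 \<in> borel_measurable borel" "F2 \<in> borel_measurable borel"
    and eq: "\<And>x. 0 < x \<Longrightarrow> x \<le> R \<Longrightarrow>
      (\<integral>\<^sup>+s. F1 s * indicator {0<..<x} s \<partial>lborel) = (\<integral>\<^sup>+s. F2 s * indicator {0<..<x} s \<partial>lborel)"
    and fin: "(\<integral>\<^sup>+s. F1 s * indicator {0<..<R} s \<partial>lborel) < \<infinity>"
  shows "AE s in lborel. 0 < s \<and> s < R \<longrightarrow> F1 s = F2 s"
proof (cases "0 < R")
  case True
  define N where "N F = density lborel (\<lambda>s. F s * indicator {0<..<R} s)" for F :: "real \<Rightarrow> ennreal"
  have emN: "emeasure (N F) {..x} = (if 0 < min x R then \<integral>\<^sup>+s. F s * indicator {0<..<min x R} s \<partial>lborel else 0)"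
    if [measurable]: "F \<in> borel_measurable borel" for F x
  proof -
    have "emeasure (N F) {..x} = (\<integral>\<^sup>+s. F s * indicator {0<..<R} s * indicator {..x} s \<partial>lborel)"
      unfolding N_def by (subst emeasure_density) auto
    also have "\<dots> = (\<integral>\<^sup>+s. F s * indicator {0<..<min x R} s \<partial>lborel)"
      using AE_lborel_singleton[of x]
      by (intro nn_integral_cong_AE) (auto elim!: eventually_mono simp: indicator_def)
    also have "\<dots> = (if 0 < min x R then \<integral>\<^sup>+s. F s * indicator {0<..<min x R} s \<partial>lborel else 0)"
    proof (cases "0 < min x R")
      case False
      then have empty: "{0<..<min x R} = {}" by auto
      show ?thesis unfolding empty using False by simp
    qed simp
    finally show ?thesis .
  qed
  have "emeasure (N F1) UNIV = (\<integral>\<^sup>+s. F1 s * indicator {0<..<R} s \<partial>lborel)"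
    "emeasure (N F2) UNIV = (\<integral>\<^sup>+s. F2 s * indicator {0<..<R} s \<partial>lborel)"
    unfolding N_def by (subst emeasure_density; simp)+
  then have fin1: "emeasure (N F1) UNIV \<noteq> \<infinity>" "emeasure (N F2) UNIV \<noteq> \<infinity>"
    using fin eq[OF True] by auto
  have "finite_borel_measure (N F1)" "finite_borel_measure (N F2)"
    using fin1 by (auto intro!: finite_borel_measure.intro finite_measureI finite_borel_measure_axioms.intro simp: N_def)
  moreover have "cdf (N F1) = cdf (N F2)"
    unfolding cdf_def fun_eq_iff measure_def using eq by (simp add: emN)
  ultimately have "N F1 = N F2" by (rule cdf_unique')
  then have "AE s in lborel. F1 s * indicator {0<..<R} s = F2 s * indicator {0<..<R} s"
    unfolding N_def using fin by (subst (asm) finite_density_unique) auto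
  then show ?thesis by eventually_elim (auto simp: indicator_def)
qed auto

context regular_levy
begin

lemma grid_record_event:
  assumes "0 < \<delta>"
  shows "grid_record \<delta> x n y \<in> events"
proof -
  have [measurable]: "X (real i * \<delta>) \<in> borel_measurable M" for i using assms by (intro rv) simp
  have "grid_record \<delta> x n y = {\<omega> \<in> space M. (\<forall>i\<in>{..<n}. X (real i * \<delta>) \<omega> \<le> y) \<and> y < X (real n * \<delta>) \<omega> \<and> X (real n * \<delta>) \<omega> \<le> x}"
    by (auto simp: grid_record_def)
  also have "\<dots> \<in> events" by measurable
  finally show ?thesis .
qed

lemma grid_record_measurable:
  assumes "0 < \<delta>"
  shows "(\<lambda>y. emeasure M (grid_record \<delta> x n y)) \<in> borel_measurable lborel"
proof -
  have [measurable]: "X (real i * \<delta>) \<in> borel_measurable M" for i using assms by (intro rv) simp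
  define Q where "Q = {p \<in> space (lborel \<Otimes>\<^sub>M M). (\<forall>i\<in>{..<n}. X (real i * \<delta>) (snd p) \<le> fst p) \<and> fst p < X (real n * \<delta>) (snd p) \<and> X (real n * \<delta>) (snd p) \<le> x}"
  have "Q \<in> sets (lborel \<Otimes>\<^sub>M M)" unfolding Q_def by measurable
  then have "(\<lambda>y. emeasure M (Pair y -` Q)) \<in> borel_measurable lborel" by (rule measurable_emeasure_Pair)
  moreover have "Pair y -` Q = grid_record \<delta> x n y" for y
    by (auto simp: Q_def grid_record_def space_pair_measure)
  ultimately show ?thesis by simp
qed

text \<open>Written as a union over the step of first exceedance because the expectation is known
  step by step; the mesh makes both \<open>t / m\<close> and \<open>t\<close> grid points.\<close>

definition grid_crossing :: "real \<Rightarrow> nat \<Rightarrow> real \<Rightarrow> nat \<Rightarrow> real \<Rightarrow> 'a set" where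
  "grid_crossing t m x l y = (\<Union>n\<in>{l<..m * l}. grid_record (t / real (m * l)) x n y)"

lemma emeasure_grid_crossing:
  assumes "0 < t" "0 < m" "0 < l"
  shows "emeasure M (grid_crossing t m x l y) =
    (\<Sum>n\<in>{l<..m * l}. emeasure M (grid_record (t / real (m * l)) x n y))"
proof -
  have d: "0 < t / real (m * l)" using assms by simp
  show ?thesis
    unfolding grid_crossing_def
  proof (rule sum_emeasure[symmetric])
    show "disjoint_family_on (\<lambda>n. grid_record (t / real (m * l)) x n y) {l<..m * l}"
      unfolding disjoint_family_on_def
    proof (intro ballI impI)
      fix a b :: nat assume "a \<noteq> b"
      then consider "a < b" | "b < a" by linarith
      then show "grid_record (t / real (m * l)) x a y \<inter> grid_record (t / real (m * l)) x b y = {}"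
        by cases (auto simp: grid_record_def not_le[symmetric] simp del: of_nat_mult)
    qed
  qed (intro finite_greaterThanAtMost image_subsetI grid_record_event[OF d])+
qed

lemma grid_crossing_event:
  assumes "0 < t" "0 < m" "0 < l"
  shows "grid_crossing t m x l y \<in> events"
proof -
  have d: "0 < t / real (m * l)" using assms by simp
  show ?thesis
    unfolding grid_crossing_def by (rule sets.finite_UN[OF finite_greaterThanAtMost grid_record_event[OF d]])
qed

lemma grid_crossing_tendsto:
  assumes "0 \<le> y" "y < x" "0 < t" "0 < m"
  shows "(\<lambda>k. prob (grid_crossing t m x (Suc k) y)) \<longlonglongrightarrow> passage_prob t y - passage_prob (t / m) y"
proof -
  have "(\<lambda>k. prob (grid_crossing t m x (Suc k) y)) \<longlonglongrightarrow> prob (passing t y - passing (t / m) y)"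
  proof (intro prob_tendsto_eventually_eq AE_I2)
    fix \<omega> assume w: "\<omega> \<in> space M"
    have "\<forall>\<^sub>F l in sequentially. \<omega> \<in> grid_crossing t m x l y \<longleftrightarrow> \<omega> \<in> passing t y - passing (t / m) y"
      using grid_crossing_eventually[OF regular assms, of \<omega>]
      by (rule eventually_mono)
        (use w in \<open>simp only: grid_crossing_def grid_record_def passing_def UN_iff mem_Collect_eq Diff_iff simp_thms\<close>)
    then show "\<forall>\<^sub>F k in sequentially. \<omega> \<in> grid_crossing t m x (Suc k) y \<longleftrightarrow> \<omega> \<in> passing t y - passing (t / m) y"
      by (rule eventually_compose_filterlim) (rule filterlim_Suc)
  qed (use assms in \<open>auto intro!: grid_crossing_event\<close>)
  moreover have "prob (passing t y - passing (t / m) y) = passage_prob t y - passage_prob (t / m) y"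
  proof -
    have "t / m \<le> t" using assms by (simp add: field_simps)
    then show ?thesis unfolding passage_prob_def by (intro finite_measure_Diff passing_event passing_mono) auto
  qed
  ultimately show ?thesis by simp
qed

end

text \<open>\<open>q\<close> is nonnegative and jointly measurable on the whole plane, although it
  is a density only at positive times; the integrals over times then stay free of side
  conditions.\<close>

locale regular_levy_density = regular_levy +
  fixes q :: "real \<Rightarrow> real \<Rightarrow> real"
  assumes q_measurable [measurable]: "(\<lambda>(x, t). q x t) \<in> borel_measurable (borel \<Otimes>\<^sub>M borel)"
    and q_nonneg: "\<And>x t. 0 \<le> q x t"
    and density: "\<And>t. 0 < t \<Longrightarrow> distributed M lborel (X t) (\<lambda>x. ennreal (q x t))"
begin

lemma AE_neq:
  assumes "0 < t"
  shows "AE \<omega> in M. X t \<omega> \<noteq> a"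
proof -
  have "emeasure M (X t -` {a} \<inter> space M) = (\<integral>\<^sup>+x. ennreal (q x t) * indicator {a} x \<partial>lborel)"
    using density[OF assms] by (intro distributed_emeasure) auto
  also have "AE x in lborel. ennreal (q x t) * indicator {a} x = 0"
    using AE_lborel_singleton[of a] by eventually_elim simp
  then have "(\<integral>\<^sup>+x. ennreal (q x t) * indicator {a} x \<partial>lborel) = (\<integral>\<^sup>+x. 0 \<partial>(lborel :: real measure))"
    by (rule nn_integral_cong_AE)
  finally have "emeasure M (X t -` {a} \<inter> space M) = 0" by simp
  moreover have "X t -` {a} \<inter> space M \<in> events" using rv[of t] assms by (auto intro: measurable_sets)
  ultimately show ?thesis by (intro AE_I[of _ _ "X t -` {a} \<inter> space M"]) auto
qed

text \<open>Divided by \<open>t\<close>, this is the time density of the level-integrated Kendall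
  identity; the truncation keeps it finite even if \<open>X t\<close> has no mean.\<close>

definition truncated_mean :: "real \<Rightarrow> real \<Rightarrow> real" where
  "truncated_mean x t = (\<integral>\<omega>. X t \<omega> * indicator {0<..x} (X t \<omega>) \<partial>M)"

lemma truncated_mean_bounds:
  assumes "0 \<le> t" "0 \<le> x"
  shows "0 \<le> truncated_mean x t" "truncated_mean x t \<le> x"
proof -
  show "0 \<le> truncated_mean x t" unfolding truncated_mean_def by (intro integral_nonneg_AE) (auto simp: indicator_def)
  have [measurable]: "X t \<in> borel_measurable M" using assms by (intro rv)
  have "truncated_mean x t \<le> (\<integral>\<omega>. x \<partial>M)" unfolding truncated_mean_def
    using assms by (intro integral_mono integrable_const_bound[where B=x]) (auto simp: indicator_def)
  then show "truncated_mean x t \<le> x" by (simp add: prob_space)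
qed

lemma ennreal_truncated_mean:
  assumes t: "0 < t" and x: "0 \<le> x"
  shows "ennreal (truncated_mean x t) = (\<integral>\<^sup>+z. ennreal (z * q z t) * indicator {0<..x} z \<partial>lborel)"
proof -
  have [measurable]: "X t \<in> borel_measurable M" using t by (intro rv) simp
  have "ennreal (truncated_mean x t) = (\<integral>\<^sup>+\<omega>. ennreal (X t \<omega> * indicator {0<..x} (X t \<omega>)) \<partial>M)"
    unfolding truncated_mean_def using x
    by (intro nn_integral_eq_integral[symmetric] integrable_const_bound[where B=x]) (auto simp: indicator_def)
  also have "\<dots> = (\<integral>\<^sup>+z. ennreal (q z t) * ennreal (z * indicator {0<..x} z) \<partial>lborel)"
    by (rule distributed_nn_integral[OF density[OF t], symmetric]) simp
  also have "\<dots> = (\<integral>\<^sup>+z. ennreal (z * q z t) * indicator {0<..x} z \<partial>lborel)"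
    by (intro nn_integral_cong) (auto simp: indicator_def ennreal_mult[symmetric] q_nonneg mult.commute)
  finally show ?thesis .
qed

lemma truncated_mean_measurable:
  assumes x: "0 \<le> x"
  shows "(\<lambda>t. ennreal (truncated_mean x t) * indicator {0<..} t) \<in> borel_measurable borel"
proof -
  have "(\<lambda>t. ennreal (truncated_mean x t) * indicator {0<..} t) =
     (\<lambda>t. (\<integral>\<^sup>+z. ennreal (z * q z t) * indicator {0<..x} z \<partial>lborel) * indicator {0<..} t)"
    using x by (auto simp: fun_eq_iff indicator_def ennreal_truncated_mean)
  also have "\<dots> \<in> borel_measurable borel" by measurable
  finally show ?thesis .
qed

lemma truncated_mean_quotient_measurable:
  assumes x: "0 \<le> x" and a: "0 \<le> a"
  shows "(\<lambda>s. ennreal (truncated_mean x s / s) * indicator {a<..t} s) \<in> borel_measurable lborel"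
proof -
  have [measurable]: "(\<lambda>s. ennreal (truncated_mean x s) * indicator {0<..} s) \<in> borel_measurable borel" by (rule truncated_mean_measurable[OF x])
  have "(\<lambda>s. ennreal (truncated_mean x s / s) * indicator {a<..t} s) =
      (\<lambda>s. (ennreal (truncated_mean x s) * indicator {0<..} s) * ennreal (1 / s) * indicator {a<..t} s)"
    using a truncated_mean_bounds(1)[OF _ x] by (auto simp: fun_eq_iff indicator_def ennreal_mult[symmetric])
  also have "\<dots> \<in> borel_measurable lborel" by measurable
  finally show ?thesis .
qed

text \<open>Limits from the right suffice because grid times are obtained by rounding up. The
  indicator is discontinuous at 0 and \<open>x\<close>, two values that \<open>X t\<close> avoids
  almost surely.\<close>

lemma truncated_mean_tendsto:
  assumes t: "0 < t" and u: "\<And>n. t \<le> u n" "u \<longlonglongrightarrow> t" and x: "0 \<le> x"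
  shows "(\<lambda>n. truncated_mean x (u n)) \<longlonglongrightarrow> truncated_mean x t"
  unfolding truncated_mean_def
proof (rule integral_dominated_convergence[where w="\<lambda>_. x"])
  have [measurable]: "X t \<in> borel_measurable M" "X (u n) \<in> borel_measurable M" for n
    using t u(1)[of n] by (auto intro!: rv)
  show "(\<lambda>\<omega>. X t \<omega> * indicator {0<..x} (X t \<omega>)) \<in> borel_measurable M"
    "(\<lambda>\<omega>. X (u n) \<omega> * indicator {0<..x} (X (u n) \<omega>)) \<in> borel_measurable M" for n by measurable
  show "AE \<omega> in M. (\<lambda>n. X (u n) \<omega> * indicator {0<..x} (X (u n) \<omega>)) \<longlonglongrightarrow> X t \<omega> * indicator {0<..x} (X t \<omega>)"
    using AE_neq[OF t, of 0] AE_neq[OF t, of x]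
  proof eventually_elim
    case (elim \<omega>)
    have conv: "(\<lambda>n. X (u n) \<omega>) \<longlonglongrightarrow> X t \<omega>"
    proof -
      have "((\<lambda>s. X s \<omega>) \<longlongrightarrow> X t \<omega>) (at t within {t..})"
        using right_cont[of t \<omega>] t by (simp add: at_within_Ici_at_right)
      then show ?thesis
      proof -
        have "continuous (at t within {t..}) (\<lambda>s. X s \<omega>)"
          using right_cont[of t \<omega>] t by (simp add: at_within_Ici_at_right continuous_within)
        then show ?thesis
          using u by (auto simp: continuous_within_sequentially comp_def)
      qed
    qed
    have "\<forall>\<^sub>F n in sequentially. indicator {0<..x} (X (u n) \<omega>) = (indicator {0<..x} (X t \<omega>) :: real)"
    proof -
      consider "X t \<omega> < 0" | "0 < X t \<omega>" "X t \<omega> < x" | "x < X t \<omega>" using elim by linarith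
      then show ?thesis
      proof cases
        case 1
        then show ?thesis using order_tendstoD(2)[OF conv 1] by (auto elim!: eventually_mono)
      next
        case 2
        then show ?thesis using eventually_conj[OF order_tendstoD(1)[OF conv 2(1)] order_tendstoD(2)[OF conv 2(2)]]
          by (auto elim!: eventually_mono)
      next
        case 3
        then show ?thesis using order_tendstoD(1)[OF conv 3] by (auto elim!: eventually_mono)
      qed
    qed
    then have "(\<lambda>n. indicator {0<..x} (X (u n) \<omega>) :: real) \<longlonglongrightarrow> indicator {0<..x} (X t \<omega>)"
      by (rule tendsto_eventually)
    then show ?case by (intro tendsto_mult conv)
  qed
  show "AE \<omega> in M. norm (X (u n) \<omega> * indicator {0<..x} (X (u n) \<omega>)) \<le> x" for n
    using x by (auto simp: indicator_def)
qed simp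

end

section \<open>Sums over grid times as integrals of step functions\<close>

lemma sum_grid_cells:
  fixes c :: "real \<Rightarrow> ennreal"
  assumes \<delta>: "0 < \<delta>"
  shows "(\<Sum>n\<in>{l<..k}. c (real n * \<delta>) * indicator {real n * \<delta> - \<delta><..real n * \<delta>} s)
    = c (of_int \<lceil>s / \<delta>\<rceil> * \<delta>) * indicator {real l * \<delta><..real k * \<delta>} s"
proof -
  have cell: "s \<in> {real n * \<delta> - \<delta><..real n * \<delta>} \<longleftrightarrow> \<lceil>s / \<delta>\<rceil> = int n" for n
    using \<delta> by (simp add: ceiling_eq_iff field_simps)
  show ?thesis
  proof (cases "s \<in> {real l * \<delta><..real k * \<delta>}")
    case True
    then have s: "real l < s / \<delta>" "s / \<delta> \<le> real k" using \<delta> by (auto simp: field_simps)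
    define n0 where "n0 = nat \<lceil>s / \<delta>\<rceil>"
    have n0: "\<lceil>s / \<delta>\<rceil> = int n0" using s by (simp add: n0_def)
    have "n0 \<in> {l<..k}"
    proof -
      have "of_int \<lceil>s / \<delta>\<rceil> = real n0" by (simp add: n0)
      then have "real l < real n0" using s(1) by linarith
      moreover have "\<lceil>s / \<delta>\<rceil> \<le> int k" using s(2) by (simp add: ceiling_le_iff)
      ultimately show ?thesis using n0 by auto
    qed
    then have "(\<Sum>n\<in>{l<..k}. c (real n * \<delta>) * indicator {real n * \<delta> - \<delta><..real n * \<delta>} s) =
      (\<Sum>n\<in>{l<..k}. if n = n0 then c (real n0 * \<delta>) else 0)"
      using cell by (intro sum.cong refl) (auto simp: indicator_def n0)
    also have "\<dots> = c (real n0 * \<delta>)" using \<open>n0 \<in> {l<..k}\<close> by simp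
    finally show ?thesis using True n0 by simp
  next
    case False
    have "s \<notin> {real n * \<delta> - \<delta><..real n * \<delta>}" if "n \<in> {l<..k}" for n
    proof
      assume s: "s \<in> {real n * \<delta> - \<delta><..real n * \<delta>}"
      have "real l * \<delta> \<le> (real n - 1) * \<delta>" "real n * \<delta> \<le> real k * \<delta>"
        using that \<delta> by (auto intro!: mult_right_mono)
      then show False using s False by (auto simp: algebra_simps)
    qed
    then have "(\<Sum>n\<in>{l<..k}. c (real n * \<delta>) * indicator {real n * \<delta> - \<delta><..real n * \<delta>} s) = 0"
      by (intro sum.neutral) auto
    then show ?thesis using False by simp
  qed
qed

lemma ceiling_grid_bounds:
  fixes s \<delta> :: real
  assumes "0 < \<delta>"
  shows "s \<le> of_int \<lceil>s / \<delta>\<rceil> * \<delta>" "of_int \<lceil>s / \<delta>\<rceil> * \<delta> < s + \<delta>"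
proof -
  have "s / \<delta> * \<delta> \<le> of_int \<lceil>s / \<delta>\<rceil> * \<delta>" using assms by (intro mult_right_mono) auto
  then show "s \<le> of_int \<lceil>s / \<delta>\<rceil> * \<delta>" using assms by simp
  have "of_int \<lceil>s / \<delta>\<rceil> < s / \<delta> + 1" by linarith
  then show "of_int \<lceil>s / \<delta>\<rceil> * \<delta> < s + \<delta>" using assms by (simp add: field_simps)
qed

lemma ceiling_grid_tendsto:
  fixes s :: real
  assumes "\<And>n. 0 < \<delta> n" "\<delta> \<longlonglongrightarrow> 0"
  shows "(\<lambda>n. of_int \<lceil>s / \<delta> n\<rceil> * \<delta> n) \<longlonglongrightarrow> s"
proof (rule tendsto_sandwich[OF _ _ tendsto_const[of s]])
  show "(\<lambda>n. s + \<delta> n) \<longlonglongrightarrow> s" using tendsto_add[OF tendsto_const assms(2), of s] by simp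
qed (use ceiling_grid_bounds[OF assms(1)] in \<open>auto intro!: always_eventually less_imp_le\<close>)

lemma nn_integral_grid_cells:
  fixes c :: "real \<Rightarrow> ennreal"
  assumes \<delta>: "0 < \<delta>"
  shows "(\<Sum>n\<in>{l<..k}. c (real n * \<delta>) * ennreal \<delta>) =
    (\<integral>\<^sup>+s. c (of_int \<lceil>s / \<delta>\<rceil> * \<delta>) * indicator {real l * \<delta><..real k * \<delta>} s \<partial>lborel)"
    "(\<lambda>s. c (of_int \<lceil>s / \<delta>\<rceil> * \<delta>) * indicator {real l * \<delta><..real k * \<delta>} s) \<in> borel_measurable borel"
proof -
  have "(\<integral>\<^sup>+s. (\<Sum>n\<in>{l<..k}. c (real n * \<delta>) * indicator {real n * \<delta> - \<delta><..real n * \<delta>} s) \<partial>lborel) =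
     (\<Sum>n\<in>{l<..k}. c (real n * \<delta>) * ennreal \<delta>)"
    using \<delta> by (subst nn_integral_sum) (auto simp: nn_integral_cmult)
  then show "(\<Sum>n\<in>{l<..k}. c (real n * \<delta>) * ennreal \<delta>) =
    (\<integral>\<^sup>+s. c (of_int \<lceil>s / \<delta>\<rceil> * \<delta>) * indicator {real l * \<delta><..real k * \<delta>} s \<partial>lborel)"
    unfolding sum_grid_cells[OF \<delta>] by simp
  have "(\<lambda>s. \<Sum>n\<in>{l<..k}. c (real n * \<delta>) * indicator {real n * \<delta> - \<delta><..real n * \<delta>} s) \<in> borel_measurable borel"
    by measurable
  then show "(\<lambda>s. c (of_int \<lceil>s / \<delta>\<rceil> * \<delta>) * indicator {real l * \<delta><..real k * \<delta>} s) \<in> borel_measurable borel"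
    unfolding sum_grid_cells[OF \<delta>] .
qed

section \<open>From the grid to continuous time\<close>

context regular_levy_density
begin

lemma grid_crossing_measurable:
  assumes "0 < t" "0 < m" "0 < l"
  shows "(\<lambda>y. emeasure M (grid_crossing t m x l y)) \<in> borel_measurable lborel"
proof -
  have "0 < t / real (m * l)" using assms by simp
  then show ?thesis
    unfolding emeasure_grid_crossing[OF assms] by (intro borel_measurable_sum grid_record_measurable)
qed

text \<open>On each grid the two sides, in discretised form, are equal exactly. As the mesh shrinks,
  crossings on the grid converge to passages of the path, and the sum over steps to an integral over
  time whose integrand is dominated by \<open>x / (t / m)\<close>.\<close>

lemma kendall_away_from_zero:
  assumes t: "0 < t" and m: "0 < (m::nat)" and x: "0 \<le> x"
  shows "(\<integral>\<^sup>+y. ennreal (passage_prob t y - passage_prob (t / m) y) * indicator {0..<x} y \<partial>lborel) =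
    (\<integral>\<^sup>+s. ennreal (truncated_mean x s / s) * indicator {t / m<..t} s \<partial>lborel)"
proof -
  define d where "d k = t / real (m * Suc k)" for k
  have d: "0 < d k" for k using t m unfolding d_def by (intro divide_pos_pos) (auto simp del: of_nat_mult of_nat_Suc)
  have dlim: "d \<longlonglongrightarrow> 0"
  proof -
    have "(\<lambda>k. (t / real m) * inverse (real (Suc k))) \<longlonglongrightarrow> (t / real m) * 0"
      by (intro tendsto_intros LIMSEQ_inverse_real_of_nat)
    moreover have "d = (\<lambda>k. (t / real m) * inverse (real (Suc k)))"
      by (simp only: d_def fun_eq_iff divide_inverse of_nat_mult inverse_mult_distrib mult.assoc simp_thms)
    ultimately show ?thesis by simp
  qed
  define c where "c z = ennreal (truncated_mean x z / z)" for z
  have ends: "real (Suc k) * d k = t / m" "real (m * Suc k) * d k = t" for k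
  proof -
    have nz: "real (m * Suc k) \<noteq> 0" "real m \<noteq> 0" "real (Suc k) \<noteq> 0"
      using m by (simp_all only: of_nat_eq_0_iff) auto
    show "real (m * Suc k) * d k = t"
      by (simp only: d_def times_divide_eq_right nonzero_mult_div_cancel_left[OF nz(1)])
    show "real (Suc k) * d k = t / m"
      using nz by (simp add: d_def divide_simps) (simp add: algebra_simps)
  qed
  define \<phi> where "\<phi> k s = c (of_int \<lceil>s / d k\<rceil> * d k) * indicator {t / m<..t} s" for k s
  have \<phi>_meas [measurable]: "\<phi> k \<in> borel_measurable borel" for k
    using nn_integral_grid_cells(2)[OF d, of c k "Suc k" "m * Suc k"]
    unfolding ends \<phi>_def[abs_def] .
  have eq: "(\<integral>\<^sup>+y. emeasure M (grid_crossing t m x (Suc k) y) * indicator {0..<x} y \<partial>lborel) = (\<integral>\<^sup>+s. \<phi> k s \<partial>lborel)" for k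
  proof -
    let ?E = "grid_record (d k) x"
    have Em: "(\<lambda>y. emeasure M (?E n y)) \<in> borel_measurable lborel" for n
      by (rule grid_record_measurable[OF d])
    have "(\<integral>\<^sup>+y. emeasure M (grid_crossing t m x (Suc k) y) * indicator {0..<x} y \<partial>lborel) =
       (\<integral>\<^sup>+y. (\<Sum>n\<in>{Suc k<..m * Suc k}. emeasure M (?E n y) * indicator {0..<x} y) \<partial>lborel)"
      using emeasure_grid_crossing[OF t m, of "Suc k" x] by (simp only: d_def sum_distrib_right zero_less_Suc)
    also have "\<dots> = (\<Sum>n\<in>{Suc k<..m * Suc k}. \<integral>\<^sup>+y. emeasure M (?E n y) * indicator {0..<x} y \<partial>lborel)"
      by (rule nn_integral_sum) (intro borel_measurable_times_ennreal Em borel_measurable_indicator, simp)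
    also have "\<dots> = (\<Sum>n\<in>{Suc k<..m * Suc k}. c (real n * d k) * ennreal (d k))"
    proof (rule sum.cong[OF refl])
      fix n assume n: "n \<in> {Suc k<..m * Suc k}"
      then have n0: "0 < n" by simp
      have "(\<integral>\<^sup>+y. emeasure M (?E n y) * indicator {0..<x} y \<partial>lborel) = ennreal (truncated_mean x (real n * d k) / real n)"
        using expectation_grid_record[OF d n0, of k x] by (simp add: truncated_mean_def)
      \<comment> \<open>The rotation factor \<open>1 / n\<close> is mesh divided by time: this is
        where a Riemann sum with the weight \<open>1 / s\<close> appears.\<close>
      also have "truncated_mean x (real n * d k) / real n = truncated_mean x (real n * d k) / (real n * d k) * d k"
        using d[of k] n0 by simp
      also have "ennreal \<dots> = c (real n * d k) * ennreal (d k)"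
        unfolding c_def using d[of k] x by (intro ennreal_mult divide_nonneg_nonneg truncated_mean_bounds) auto
      finally show "(\<integral>\<^sup>+y. emeasure M (?E n y) * indicator {0..<x} y \<partial>lborel) = c (real n * d k) * ennreal (d k)" .
    qed
    also have "\<dots> = (\<integral>\<^sup>+s. \<phi> k s \<partial>lborel)"
      unfolding nn_integral_grid_cells(1)[OF d] ends \<phi>_def ..
    finally show ?thesis .
  qed
  have L: "(\<lambda>k. \<integral>\<^sup>+y. emeasure M (grid_crossing t m x (Suc k) y) * indicator {0..<x} y \<partial>lborel) \<longlonglongrightarrow>
     (\<integral>\<^sup>+y. ennreal (passage_prob t y - passage_prob (t / m) y) * indicator {0..<x} y \<partial>lborel)"
  proof (rule nn_integral_dominated_convergence[where w="indicator {0..<x}"])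
    show "(\<lambda>y. emeasure M (grid_crossing t m x (Suc k) y) * indicator {0..<x} y) \<in> borel_measurable lborel" for k
      by (intro borel_measurable_times_ennreal grid_crossing_measurable t m zero_less_Suc borel_measurable_indicator) simp
    show "AE y in lborel. (\<lambda>k. emeasure M (grid_crossing t m x (Suc k) y) * indicator {0..<x} y) \<longlonglongrightarrow>
       ennreal (passage_prob t y - passage_prob (t / m) y) * indicator {0..<x} y"
    proof (rule AE_I2)
      fix y
      show "(\<lambda>k. emeasure M (grid_crossing t m x (Suc k) y) * indicator {0..<x} y) \<longlonglongrightarrow>
       ennreal (passage_prob t y - passage_prob (t / m) y) * indicator {0..<x} y"
      proof (cases "y \<in> {0..<x}")
        case True
        then have "(\<lambda>k. prob (grid_crossing t m x (Suc k) y)) \<longlonglongrightarrow> passage_prob t y - passage_prob (t / m) y"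
          using t m by (intro grid_crossing_tendsto) auto
        then have "(\<lambda>k. emeasure M (grid_crossing t m x (Suc k) y)) \<longlonglongrightarrow> ennreal (passage_prob t y - passage_prob (t / m) y)"
          unfolding emeasure_eq_measure by (rule tendsto_ennrealI)
        then show ?thesis using True by simp
      qed simp
    qed
    show "AE y in lborel. emeasure M (grid_crossing t m x (Suc k) y) * indicator {0..<x} y \<le> indicator {0..<x} y" for k
      using emeasure_le_1 by (auto simp: indicator_def)
    show "(\<integral>\<^sup>+y. indicator {0..<x} y \<partial>lborel) < \<infinity>" using x by simp
  qed simp_all
  have R: "(\<lambda>k. \<integral>\<^sup>+s. \<phi> k s \<partial>lborel) \<longlonglongrightarrow> (\<integral>\<^sup>+s. ennreal (truncated_mean x s / s) * indicator {t / m<..t} s \<partial>lborel)"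
  proof (rule nn_integral_dominated_convergence[where w="\<lambda>s. ennreal (x / (t / m)) * indicator {t / m<..t} s"])
    have tm: "0 < t / m" using t m by simp
    show "(\<lambda>s. ennreal (truncated_mean x s / s) * indicator {t / m<..t} s) \<in> borel_measurable lborel"
      by (rule truncated_mean_quotient_measurable[OF x less_imp_le[OF tm]])
    show "AE s in lborel. (\<lambda>k. \<phi> k s) \<longlonglongrightarrow> ennreal (truncated_mean x s / s) * indicator {t / m<..t} s"
    proof (rule AE_I2)
      fix s show "(\<lambda>k. \<phi> k s) \<longlonglongrightarrow> ennreal (truncated_mean x s / s) * indicator {t / m<..t} s"
      proof (cases "s \<in> {t / m<..t}")
        case True
        then have s: "0 < s" using tm by auto
        define u where "u k = of_int \<lceil>s / d k\<rceil> * d k" for k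
        have u: "s \<le> u k" "u \<longlonglongrightarrow> s" for k
          unfolding u_def using ceiling_grid_bounds(1)[OF d] ceiling_grid_tendsto[OF d dlim] by auto
        have "(\<lambda>k. truncated_mean x (u k) / u k) \<longlonglongrightarrow> truncated_mean x s / s"
          using s by (intro tendsto_divide truncated_mean_tendsto u x) auto
        then have "(\<lambda>k. ennreal (truncated_mean x (u k) / u k)) \<longlonglongrightarrow> ennreal (truncated_mean x s / s)" by (rule tendsto_ennrealI)
        then show ?thesis using True by (simp add: \<phi>_def c_def u_def)
      qed (simp add: \<phi>_def)
    qed
    show "AE s in lborel. \<phi> k s \<le> ennreal (x / (t / m)) * indicator {t / m<..t} s" for k
    proof (rule AE_I2)
      fix s show "\<phi> k s \<le> ennreal (x / (t / m)) * indicator {t / m<..t} s"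
      proof (cases "s \<in> {t / m<..t}")
        case True
        define u where "u = of_int \<lceil>s / d k\<rceil> * d k"
        have u: "t / m \<le> u" using ceiling_grid_bounds(1)[OF d, of s k] True by (simp add: u_def)
        then have "truncated_mean x u / u \<le> x / (t / m)"
          using tm x by (intro frac_le truncated_mean_bounds) auto
        then show ?thesis using True by (simp add: \<phi>_def c_def u_def[symmetric] ennreal_leI)
      qed (simp add: \<phi>_def)
    qed
    show "(\<integral>\<^sup>+s. ennreal (x / (t / m)) * indicator {t / m<..t} s \<partial>lborel) < \<infinity>"
    proof -
      have "t / m \<le> t" using t m by (simp add: field_simps)
      then show ?thesis by (simp add: nn_integral_cmult ennreal_mult_less_top emeasure_lborel_Ioc)
    qed
  qed simp_all
  show ?thesis using LIMSEQ_unique[OF L[unfolded eq] R] by simp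
qed

text \<open>Let \<open>m\<close> grow: passage before \<open>t / m\<close> over a positive level
  becomes improbable, while the time integrals increase to the full one.\<close>

lemma kendall_integrated:
  assumes t: "0 < t" and x: "0 \<le> x"
  shows "(\<integral>\<^sup>+y. ennreal (passage_prob t y) * indicator {0..<x} y \<partial>lborel) =
    (\<integral>\<^sup>+s. ennreal (truncated_mean x s / s) * indicator {0<..t} s \<partial>lborel)"
proof -
  have tn: "(\<lambda>k. t / real (Suc k)) \<longlonglongrightarrow> 0" using LIMSEQ_Suc[OF lim_const_over_n[of t]] by simp
  note [measurable] = truncated_mean_quotient_measurable[OF x]
  have L: "(\<lambda>k. \<integral>\<^sup>+y. ennreal (passage_prob t y - passage_prob (t / Suc k) y) * indicator {0..<x} y \<partial>lborel) \<longlonglongrightarrow>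
     (\<integral>\<^sup>+y. ennreal (passage_prob t y) * indicator {0..<x} y \<partial>lborel)"
  proof (rule nn_integral_dominated_convergence[where w="indicator {0..<x}"])
    show "AE y in lborel. (\<lambda>k. ennreal (passage_prob t y - passage_prob (t / Suc k) y) * indicator {0..<x} y) \<longlonglongrightarrow>
       ennreal (passage_prob t y) * indicator {0..<x} y"
      using AE_lborel_singleton[of 0]
    proof eventually_elim
      case (elim y)
      show ?case
      proof (cases "y \<in> {0..<x}")
        case True
        then have "(\<lambda>k. passage_prob t y - passage_prob (t / Suc k) y) \<longlonglongrightarrow> passage_prob t y - 0"
          using elim by (intro tendsto_diff tendsto_const passage_prob_tendsto_0 tn) auto
        then show ?thesis using True by (auto intro: tendsto_ennrealI)
      qed simp
    qed
    show "AE y in lborel. ennreal (passage_prob t y - passage_prob (t / Suc k) y) * indicator {0..<x} y \<le> indicator {0..<x} y" for k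
    proof (rule AE_I2)
      fix y
      have "passage_prob t y - passage_prob (t / Suc k) y \<le> 1" using passage_prob_bounds(2)[of t y] passage_prob_bounds(1)[of "t / Suc k" y] by linarith
      then have "ennreal (passage_prob t y - passage_prob (t / Suc k) y) \<le> 1" using ennreal_leI by fastforce
      then show "ennreal (passage_prob t y - passage_prob (t / Suc k) y) * indicator {0..<x} y \<le> indicator {0..<x} y"
        by (auto simp: indicator_def)
    qed
    show "(\<integral>\<^sup>+y. indicator {0..<x} y \<partial>lborel) < \<infinity>" using x by simp
  qed simp_all
  have R: "(\<lambda>k. \<integral>\<^sup>+s. ennreal (truncated_mean x s / s) * indicator {t / Suc k<..t} s \<partial>lborel) \<longlonglongrightarrow>
     (\<integral>\<^sup>+s. ennreal (truncated_mean x s / s) * indicator {0<..t} s \<partial>lborel)"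
  proof (rule nn_integral_LIMSEQ)
    show "incseq (\<lambda>k s. ennreal (truncated_mean x s / s) * indicator {t / Suc k<..t} s)"
    proof (intro incseq_SucI le_funI mult_left_mono)
      fix k s
      have "t / real (Suc (Suc k)) \<le> t / real (Suc k)" using t by (intro divide_left_mono) auto
      then show "(indicator {t / real (Suc k)<..t} s :: ennreal) \<le> indicator {t / real (Suc (Suc k))<..t} s"
        by (auto simp: indicator_def simp del: of_nat_Suc)
    qed simp
    show "(\<lambda>s. ennreal (truncated_mean x s / s) * indicator {t / Suc k<..t} s) \<in> borel_measurable lborel" for k
      using t by simp
    fix s
    have "\<forall>\<^sub>F k in sequentially. indicator {t / Suc k<..t} s = (indicator {0<..t} s :: ennreal)"
    proof (cases "0 < s")
      case True
      from order_tendstoD(2)[OF tn True] show ?thesis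
        by eventually_elim (use True in \<open>auto simp: indicator_def simp del: of_nat_Suc\<close>)
    next
      case False
      have "\<not> t / real (Suc k) < s" for k using t False by (auto simp: not_less intro: order_trans[of _ 0])
      then show ?thesis using False by (auto simp: indicator_def simp del: of_nat_Suc)
    qed
    then show "(\<lambda>k. ennreal (truncated_mean x s / s) * indicator {t / Suc k<..t} s) \<longlonglongrightarrow> ennreal (truncated_mean x s / s) * indicator {0<..t} s"
      by (intro tendsto_eventually) (auto elim!: eventually_mono simp del: of_nat_Suc)
  qed
  show ?thesis
    using LIMSEQ_unique[OF L[unfolded kendall_away_from_zero[OF t zero_less_Suc x]] R] by simp
qed

text \<open>Kendall's candidate for the density in \<open>s\<close> of the first passage time over
  \<open>y\<close>.\<close>

definition kendall_density :: "real \<Rightarrow> real \<Rightarrow> ennreal" where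
  "kendall_density y s = (if 0 < y \<and> 0 < s then ennreal (y * q y s / s) else 0)"

lemma kendall_density_measurable [measurable]: "(\<lambda>(y, s). kendall_density y s) \<in> borel_measurable (borel \<Otimes>\<^sub>M borel)"
  unfolding kendall_density_def by measurable

text \<open>Comparing integrals over levels yields, for each \<open>t\<close>, a null set of
  exceptional levels. Rational times leave one null set for all of them, and both sides are
  left-continuous in \<open>t\<close>.\<close>

lemma kendall_AE: "AE y in lborel. 0 < y \<longrightarrow> (\<forall>t>0. ennreal (passage_prob t y) = (\<integral>\<^sup>+s. kendall_density y s * indicator {0<..<t} s \<partial>lborel))"
proof -
  have fixed_t: "AE y in lborel. 0 < y \<longrightarrow> ennreal (passage_prob t y) = (\<integral>\<^sup>+s. kendall_density y s * indicator {0<..<t} s \<partial>lborel)"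
    if t: "0 < t" for t
  proof -
    define F where "F y = (\<integral>\<^sup>+s. kendall_density y s * indicator {0<..<t} s \<partial>lborel)" for y
    have Fm [measurable]: "F \<in> borel_measurable borel" unfolding F_def by measurable
    have eq: "(\<integral>\<^sup>+y. ennreal (passage_prob t y) * indicator {0<..<x} y \<partial>lborel) = (\<integral>\<^sup>+y. F y * indicator {0<..<x} y \<partial>lborel)"
      if x: "0 < x" for x
    proof -
      have "(\<integral>\<^sup>+y. ennreal (passage_prob t y) * indicator {0<..<x} y \<partial>lborel) = (\<integral>\<^sup>+y. ennreal (passage_prob t y) * indicator {0..<x} y \<partial>lborel)"
        using AE_lborel_singleton[of 0] by (intro nn_integral_cong_AE) (auto elim!: eventually_mono simp: indicator_def)
      also have "\<dots> = (\<integral>\<^sup>+s. ennreal (truncated_mean x s / s) * indicator {0<..t} s \<partial>lborel)"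
        using x by (intro kendall_integrated t) simp
      also have "\<dots> = (\<integral>\<^sup>+s. (\<integral>\<^sup>+z. kendall_density z s * indicator {0<..x} z * indicator {0<..<t} s \<partial>lborel) \<partial>lborel)"
      proof (rule nn_integral_cong_AE)
        show "AE s in lborel. ennreal (truncated_mean x s / s) * indicator {0<..t} s = (\<integral>\<^sup>+z. kendall_density z s * indicator {0<..x} z * indicator {0<..<t} s \<partial>lborel)"
          using AE_lborel_singleton[of t]
        proof eventually_elim
          case (elim s)
          show ?case
          proof (cases "0 < s \<and> s < t")
            case True
            have "ennreal (truncated_mean x s / s) = ennreal (truncated_mean x s) * ennreal (1 / s)"
              using True x truncated_mean_bounds(1)[of s x] by (simp add: ennreal_mult[symmetric])
            also have "\<dots> = (\<integral>\<^sup>+z. ennreal (z * q z s) * indicator {0<..x} z * ennreal (1 / s) \<partial>lborel)"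
              using True x by (subst ennreal_truncated_mean) (auto simp: nn_integral_multc)
            also have "\<dots> = (\<integral>\<^sup>+z. kendall_density z s * indicator {0<..x} z * indicator {0<..<t} s \<partial>lborel)"
              using True by (intro nn_integral_cong) (auto simp: kendall_density_def indicator_def ennreal_mult[symmetric] q_nonneg)
            finally show ?thesis using True by simp
          next
            case False
            then show ?thesis using elim by (auto simp: indicator_def)
          qed
        qed
      qed
      also have "\<dots> = (\<integral>\<^sup>+z. (\<integral>\<^sup>+s. kendall_density z s * indicator {0<..x} z * indicator {0<..<t} s \<partial>lborel) \<partial>lborel)"
        by (rule lborel_pair.Fubini') measurable
      also have "\<dots> = (\<integral>\<^sup>+z. F z * indicator {0<..x} z \<partial>lborel)"
      proof (rule nn_integral_cong)
        fix z
        have "(\<integral>\<^sup>+s. kendall_density z s * indicator {0<..x} z * indicator {0<..<t} s \<partial>lborel) = (\<integral>\<^sup>+s. kendall_density z s * indicator {0<..<t} s * indicator {0<..x} z \<partial>lborel)"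
          by (intro nn_integral_cong) (simp add: mult_ac)
        also have "\<dots> = F z * indicator {0<..x} z" unfolding F_def by (rule nn_integral_multc) measurable
        finally show "(\<integral>\<^sup>+s. kendall_density z s * indicator {0<..x} z * indicator {0<..<t} s \<partial>lborel) = F z * indicator {0<..x} z" .
      qed
      also have "\<dots> = (\<integral>\<^sup>+z. F z * indicator {0<..<x} z \<partial>lborel)"
        using AE_lborel_singleton[of x] by (intro nn_integral_cong_AE) (auto elim!: eventually_mono simp: indicator_def)
      finally show ?thesis .
    qed
    have "AE y in lborel. 0 < y \<and> y < real n \<longrightarrow> ennreal (passage_prob t y) = F y" for n
    proof (rule AE_eq_if_integrals_eq)
      have "(\<integral>\<^sup>+y. ennreal (passage_prob t y) * indicator {0<..<real n} y \<partial>lborel) \<le> (\<integral>\<^sup>+y. indicator {0<..<real n} y \<partial>lborel)"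
        using passage_prob_bounds by (intro nn_integral_mono) (auto simp: indicator_def)
      then show "(\<integral>\<^sup>+y. ennreal (passage_prob t y) * indicator {0<..<real n} y \<partial>lborel) < \<infinity>"
        by (simp add: le_less_trans)
    qed (use eq in auto)
    then have "AE y in lborel. \<forall>n. 0 < y \<and> y < real n \<longrightarrow> ennreal (passage_prob t y) = F y"
      by (subst AE_all_countable) (rule allI)
    then show ?thesis
      by eventually_elim (use reals_Archimedean2 in \<open>auto simp: F_def\<close>)
  qed
  have "AE y in lborel. \<forall>t\<in>\<rat>. 0 < t \<longrightarrow> 0 < y \<longrightarrow> ennreal (passage_prob t y) = (\<integral>\<^sup>+s. kendall_density y s * indicator {0<..<t} s \<partial>lborel)"
    using fixed_t by (subst AE_ball_countable) (auto simp: countable_rat)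
  then show ?thesis
  proof eventually_elim
    case (elim y)
    show ?case
    proof (intro impI allI)
      fix t :: real assume y: "0 < y" and t: "0 < t"
      have "\<exists>r\<in>\<rat>. max 0 (t - 1 / Suc n) < r \<and> r < t" for n :: nat
        using t by (intro Rats_dense_in_real) auto
      then obtain r where r: "r n \<in> \<rat>" "max 0 (t - 1 / Suc n) < r n" "r n < t" for n :: nat by metis
      have rlim: "r \<longlonglongrightarrow> t"
      proof (rule tendsto_sandwich[OF _ _ _ tendsto_const[of t]])
        show "(\<lambda>n. t - 1 / Suc n) \<longlonglongrightarrow> t"
          using tendsto_diff[OF tendsto_const LIMSEQ_Suc[OF lim_const_over_n[of 1]], of t] by simp
      qed (use r in \<open>auto intro!: always_eventually less_imp_le\<close>)
      have m: "(\<lambda>s. kendall_density y s) \<in> borel_measurable borel" by measurable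
      have "(\<lambda>n. \<integral>\<^sup>+s. kendall_density y s * indicator {0<..<r n} s \<partial>lborel) \<longlonglongrightarrow> (\<integral>\<^sup>+s. kendall_density y s * indicator {0<..<t} s \<partial>lborel)"
      proof (rule nn_integral_dominated_convergence[where w="\<lambda>s. kendall_density y s * indicator {0<..<t} s"])
        show "AE s in lborel. (\<lambda>n. kendall_density y s * indicator {0<..<r n} s) \<longlonglongrightarrow> kendall_density y s * indicator {0<..<t} s"
        proof (rule AE_I2)
          fix s
          have "\<forall>\<^sub>F n in sequentially. indicator {0<..<r n} s = (indicator {0<..<t} s :: ennreal)"
          proof (cases "s < t")
            case True
            from order_tendstoD(1)[OF rlim True] show ?thesis
              by eventually_elim (use True in \<open>auto simp: indicator_def\<close>)
          next
            case False
            then have "\<not> s < r n" for n using r(3)[of n] by simp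
            then show ?thesis using False by (auto simp: indicator_def)
          qed
          then show "(\<lambda>n. kendall_density y s * indicator {0<..<r n} s) \<longlonglongrightarrow> kendall_density y s * indicator {0<..<t} s"
            by (intro tendsto_eventually) (auto elim!: eventually_mono)
        qed
        show "AE s in lborel. kendall_density y s * indicator {0<..<r n} s \<le> kendall_density y s * indicator {0<..<t} s" for n
          using r(3)[of n] by (intro AE_I2 mult_left_mono) (auto simp: indicator_def)
        \<comment> \<open>The dominating function must be integrable before the identity is known at
          \<open>t\<close>; a later rational time, where it is already known, provides the
          bound.\<close>
        obtain t' where t': "t' \<in> \<rat>" "t < t'" using Rats_dense_in_real[of t "t + 1"] by auto
        have "(\<integral>\<^sup>+s. kendall_density y s * indicator {0<..<t} s \<partial>lborel) \<le> (\<integral>\<^sup>+s. kendall_density y s * indicator {0<..<t'} s \<partial>lborel)"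
          using t' by (intro nn_integral_mono mult_left_mono) (auto simp: indicator_def)
        also have "\<dots> = ennreal (passage_prob t' y)" using elim t' t y by simp
        finally show "(\<integral>\<^sup>+s. kendall_density y s * indicator {0<..<t} s \<partial>lborel) < \<infinity>" by (simp add: le_less_trans)
      qed (use m in simp_all)
      moreover have "(\<integral>\<^sup>+s. kendall_density y s * indicator {0<..<r n} s \<partial>lborel) = ennreal (passage_prob (r n) y)" for n
        using elim r(1,2)[of n] y by simp
      moreover have "(\<lambda>n. ennreal (passage_prob (r n) y)) \<longlonglongrightarrow> ennreal (passage_prob t y)"
        using r(3) by (intro tendsto_ennrealI passage_prob_tendsto_time rlim) (simp add: less_imp_le)
      ultimately have "(\<lambda>n. ennreal (passage_prob (r n) y)) \<longlonglongrightarrow> (\<integral>\<^sup>+s. kendall_density y s * indicator {0<..<t} s \<partial>lborel)"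
        "(\<lambda>n. ennreal (passage_prob (r n) y)) \<longlonglongrightarrow> ennreal (passage_prob t y)" by simp_all
      then show "ennreal (passage_prob t y) = (\<integral>\<^sup>+s. kendall_density y s * indicator {0<..<t} s \<partial>lborel)"
        using LIMSEQ_unique by blast
    qed
  qed
qed

end

section \<open>Strong Markov property at first passage\<close>

lemma right_tendsto_sequentially:
  fixes f :: "real \<Rightarrow> real"
  assumes "(f \<longlongrightarrow> f t) (at_right t)" "\<And>n. t \<le> u n" "u \<longlonglongrightarrow> t"
  shows "(\<lambda>n. f (u n)) \<longlonglongrightarrow> f t"
proof -
  have "continuous (at t within {t..}) f"
    using assms(1) by (simp add: at_within_Ici_at_right continuous_within)
  then show ?thesis using assms(2,3) by (auto simp: continuous_within_sequentially comp_def)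
qed

lemma left_tendsto_sequentially:
  fixes f :: "real \<Rightarrow> real"
  assumes "(f \<longlongrightarrow> f t) (at_left t)" "\<And>n. u n \<le> t" "u \<longlonglongrightarrow> t"
  shows "(\<lambda>n. f (u n)) \<longlonglongrightarrow> f t"
proof -
  have "continuous (at t within {..t}) f"
    using assms(1) by (simp add: at_within_Iic_at_left continuous_within)
  then show ?thesis using assms(2,3) by (auto simp: continuous_within_sequentially comp_def)
qed

context regular_levy
begin

definition past_passing :: "real \<Rightarrow> real \<Rightarrow> real \<Rightarrow> (real \<Rightarrow> real) set" where
  "past_passing t s a = {w \<in> space (\<Pi>\<^sub>M s\<in>{0..t}. (borel::real measure)). \<exists>q\<in>\<rat>. 0 \<le> q \<and> q < s \<and> a < w q}"

lemma past_passing_measurable: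
  assumes "s \<le> t"
  shows "past_passing t s a \<in> sets (\<Pi>\<^sub>M s\<in>{0..t}. borel)"
proof -
  let ?P = "\<Pi>\<^sub>M s\<in>{0..t}. (borel::real measure)"
  have "past_passing t s a = (\<Union>q\<in>{q\<in>\<rat>. 0 \<le> q \<and> q < s}. {w \<in> space ?P. a < w q})"
    by (auto simp: past_passing_def)
  also have "\<dots> \<in> sets ?P"
  proof (rule sets.countable_UN'')
    show "countable {q\<in>\<rat>. 0 \<le> q \<and> q < s}"
      by (rule countable_subset[OF _ countable_rat]) auto
    fix q :: real assume q: "q \<in> {q\<in>\<rat>. 0 \<le> q \<and> q < s}"
    have [measurable]: "(\<lambda>w. w q) \<in> measurable ?P borel"
      using q assms by (intro measurable_component_singleton) auto
    show "{w \<in> space ?P. a < w q} \<in> sets ?P" by measurable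
  qed
  finally show ?thesis .
qed

lemma passing_eq_past:
  assumes "s \<le> t"
  shows "passing s a = past t -` past_passing t s a \<inter> space M"
proof -
  have "past t \<omega> \<in> past_passing t s a \<longleftrightarrow> (\<exists>q\<in>\<rat>. 0 \<le> q \<and> q < s \<and> a < X q \<omega>)" for \<omega>
  proof -
    have sp: "past t \<omega> \<in> space (\<Pi>\<^sub>M s\<in>{0..t}. (borel::real measure))" by (simp add: past_def space_PiM)
    have "past t \<omega> q = X q \<omega>" if "0 \<le> q" "q < s" for q using that assms by (simp add: past_def)
    then show ?thesis unfolding past_passing_def using sp by auto
  qed
  then show ?thesis
    using right_continuous_exceeds_iff_Rats[OF right_cont, of "ereal s" a] by (auto simp: passing_def)
qed

text \<open>The Markov property at a deterministic time, to be applied at the right end of each cell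
  of the discretised passage time.\<close>

lemma prob_past_shifted:
  assumes t: "0 \<le> t" and P: "P \<in> sets (\<Pi>\<^sub>M s\<in>{0..t}. borel)" and C: "C \<in> sets paths"
  shows "prob ((past t -` P \<inter> space M) \<inter> (shifted t -` C \<inter> space M)) =
     prob (past t -` P \<inter> space M) * prob (path -` C \<inter> space M)"
proof -
  have "(past t -` P \<inter> space M) \<inter> (shifted t -` C \<inter> space M) = (\<lambda>x. (past t x, shifted t x)) -` (P \<times> C) \<inter> space M"
    by auto
  moreover have "prob (shifted t -` C \<inter> space M) = prob (path -` C \<inter> space M)"
  proof -
    have "measure (distr M paths (shifted t)) C = measure (distr M paths path) C"
      using distr_shifted[OF t] by simp
    then show ?thesis by (simp add: measure_distr shifted_measurable[OF t] C)
  qed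
  ultimately show ?thesis using indep_varD[OF indep_past_shifted[OF t] P C] by simp
qed

text \<open>The first passage time over level \<open>a\<close> is discretised to the next point \<open>\<theta>\<close> of a grid of
  mesh \<open>t / Suc k\<close>; \<open>post_passage\<close> is the event that the passage occurs before \<open>t\<close> and that
  the path after \<open>\<theta>\<close> lies in \<open>C (t - \<theta>)\<close>.\<close>

definition passage_cell :: "real \<Rightarrow> real \<Rightarrow> nat \<Rightarrow> 'a set" where
  "passage_cell a \<delta> n = passing (real n * \<delta>) a - passing (real n * \<delta> - \<delta>) a"

definition post_passage :: "(real \<Rightarrow> (real \<Rightarrow> real) set) \<Rightarrow> real \<Rightarrow> real \<Rightarrow> nat \<Rightarrow> 'a set" where
  "post_passage C a t k = (\<Union>n\<in>{0<..Suc k}. passage_cell a (t / Suc k) n \<inter>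
      (shifted (real n * (t / Suc k)) -` C (t - real n * (t / Suc k)) \<inter> space M))"

lemma grid_le:
  assumes "0 < t" "n \<in> {0<..Suc k}"
  shows "0 \<le> real n * (t / Suc k)" "real n * (t / Suc k) \<le> t"
proof -
  show "0 \<le> real n * (t / Suc k)" using assms by simp
  have "real n * (t / Suc k) \<le> real (Suc k) * (t / Suc k)" using assms by (intro mult_right_mono) auto
  then show "real n * (t / Suc k) \<le> t" by simp
qed

lemma post_passage_event:
  assumes t: "0 < t" and C: "\<And>r. 0 \<le> r \<Longrightarrow> C r \<in> sets paths"
  shows "post_passage C a t k \<in> events"
  unfolding post_passage_def passage_cell_def
proof (rule sets.finite_UN, simp, rule sets.Int)
  fix n assume n: "n \<in> {0<..Suc k}"
  show "shifted (real n * (t / Suc k)) -` C (t - real n * (t / Suc k)) \<inter> space M \<in> events"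
    using grid_le[OF t n] by (intro measurable_sets[OF shifted_measurable] C) auto
qed (intro sets.Diff passing_event)

text \<open>Whether the passage falls into a cell is decided by the past of its right end, so the
  fixed-time Markov property factorises each summand into the mass of \<open>f\<close> on the cell
  and the probability of a set of restarted paths. The sum is \<open>f\<close> integrated against a
  step function. Rounding the passage time up makes the remaining times increase to
  \<open>t - s\<close>, whence the premise on limits from the left.\<close>

lemma post_passage_limit:
  fixes f :: "real \<Rightarrow> ennreal"
  assumes t: "0 < t" and f [measurable]: "f \<in> borel_measurable borel"
    and Gf: "\<And>s. 0 \<le> s \<Longrightarrow> s \<le> t \<Longrightarrow> ennreal (passage_prob s a) = (\<integral>\<^sup>+r. f r * indicator {0<..<s} r \<partial>lborel)"
    and C: "\<And>r. 0 \<le> r \<Longrightarrow> C r \<in> sets paths"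
    and left_cont: "\<And>r u. 0 < r \<Longrightarrow> (\<And>n::nat. 0 \<le> u n) \<Longrightarrow> (\<And>n. u n \<le> r) \<Longrightarrow> u \<longlonglongrightarrow> r \<Longrightarrow>
        (\<lambda>n. prob (path -` C (u n) \<inter> space M)) \<longlonglongrightarrow> prob (path -` C r \<inter> space M)"
    and meas [measurable]: "(\<lambda>r. prob (path -` C r \<inter> space M)) \<in> borel_measurable borel"
  obtains L where "0 \<le> L" "(\<lambda>k. prob (post_passage C a t k)) \<longlonglongrightarrow> L"
    "ennreal L = (\<integral>\<^sup>+s. f s * ennreal (prob (path -` C (t - s) \<inter> space M)) * indicator {0<..<t} s \<partial>lborel)"
proof -
  define qC where "qC r = prob (path -` C r \<inter> space M)" for r
  have [measurable]: "qC \<in> borel_measurable borel" unfolding qC_def by (rule meas)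
  define d where "d k = t / real (Suc k)" for k
  have d: "0 < d k" for k using t by (simp add: d_def)
  have dlim: "d \<longlonglongrightarrow> 0" unfolding d_def using LIMSEQ_Suc[OF lim_const_over_n[of t]] by simp
  have dend: "real 0 * d k = 0" "real (Suc k) * d k = t" for k by (simp_all add: d_def)
  define c where "c z = ennreal (qC (t - z))" for z
  have cell: "emeasure M (passage_cell a (d k) n) = (\<integral>\<^sup>+s. f s * indicator {real n * d k - d k<..real n * d k} s \<partial>lborel)"
    if n: "n \<in> {0<..Suc k}" for n k
  proof -
    let ?u = "real n * d k - d k" and ?v = "real n * d k"
    have v: "0 \<le> ?v" "?v \<le> t" using grid_le[OF t n] by (simp_all add: d_def)
    have "d k * 1 \<le> d k * real n" using n d[of k] by (intro mult_left_mono) auto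
    then have u: "0 \<le> ?u" "?u \<le> ?v" using d[of k] by (simp_all add: mult.commute)
    have "emeasure M (passage_cell a (d k) n) = emeasure M (passing ?v a) - emeasure M (passing ?u a)"
      unfolding passage_cell_def using u by (intro emeasure_Diff passing_event passing_mono) auto
    also have "\<dots> = ennreal (passage_prob ?v a) - ennreal (passage_prob ?u a)" by (simp add: emeasure_eq_measure passage_prob_def)
    also have "ennreal (passage_prob ?v a) = ennreal (passage_prob ?u a) + (\<integral>\<^sup>+s. f s * indicator {?u<..?v} s \<partial>lborel)"
    proof -
      have "ennreal (passage_prob ?v a) = (\<integral>\<^sup>+s. f s * indicator {0<..<?v} s \<partial>lborel)" using v by (rule Gf)
      also have "\<dots> = (\<integral>\<^sup>+s. f s * indicator {0<..<?u} s + f s * indicator {?u<..?v} s \<partial>lborel)"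
        using AE_lborel_singleton[of ?u] AE_lborel_singleton[of ?v]
      proof (intro nn_integral_cong_AE, eventually_elim)
        case (elim s)
        then show ?case using u by (auto simp: indicator_def)
      qed
      also have "\<dots> = (\<integral>\<^sup>+s. f s * indicator {0<..<?u} s \<partial>lborel) + (\<integral>\<^sup>+s. f s * indicator {?u<..?v} s \<partial>lborel)"
        by (rule nn_integral_add) measurable
      also have "(\<integral>\<^sup>+s. f s * indicator {0<..<?u} s \<partial>lborel) = ennreal (passage_prob ?u a)" using u v by (intro Gf[symmetric]) auto
      finally show ?thesis .
    qed
    finally show ?thesis by (simp add: ennreal_add_diff_cancel_left)
  qed
  have eq: "emeasure M (post_passage C a t k) = (\<integral>\<^sup>+s. f s * (c (of_int \<lceil>s / d k\<rceil> * d k) * indicator {0<..t} s) \<partial>lborel)" for k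
  proof -
    let ?S = "\<lambda>n. shifted (real n * d k) -` C (t - real n * d k) \<inter> space M"
    have grid: "0 \<le> real n * d k" "0 \<le> t - real n * d k" if "n \<in> {0<..Suc k}" for n
      using grid_le[OF t that] by (simp_all add: d_def)
    have S_ev: "?S n \<in> events" if "n \<in> {0<..Suc k}" for n
      using grid[OF that] by (intro measurable_sets[OF shifted_measurable] C)
    have "emeasure M (post_passage C a t k) = (\<Sum>n\<in>{0<..Suc k}. emeasure M (passage_cell a (d k) n \<inter> ?S n))"
      unfolding post_passage_def d_def[symmetric]
    proof (rule sum_emeasure[symmetric])
      show "(\<lambda>n. passage_cell a (d k) n \<inter> ?S n) ` {0<..Suc k} \<subseteq> events"
        by (rule image_subsetI, rule sets.Int) (simp_all add: passage_cell_def S_ev)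
      show "disjoint_family_on (\<lambda>n. passage_cell a (d k) n \<inter> ?S n) {0<..Suc k}"
        unfolding disjoint_family_on_def
      proof (intro ballI impI)
        have *: "passage_cell a (d k) m \<inter> passage_cell a (d k) n = {}" if "m < n" for m n
        proof -
          have "real m * d k \<le> (real n - 1) * d k" using that d[of k] by (intro mult_right_mono) auto
          then have "passing (real m * d k) a \<subseteq> passing (real n * d k - d k) a"
            by (intro passing_mono) (auto simp: algebra_simps)
          then show ?thesis unfolding passage_cell_def by blast
        qed
        fix m n :: nat assume "m \<noteq> n"
        then show "(passage_cell a (d k) m \<inter> ?S m) \<inter> (passage_cell a (d k) n \<inter> ?S n) = {}"
          using *[of m n] *[of n m] by (cases "m < n") auto
      qed
    qed simp
    also have "\<dots> = (\<Sum>n\<in>{0<..Suc k}. \<integral>\<^sup>+s. f s * (c (real n * d k) * indicator {real n * d k - d k<..real n * d k} s) \<partial>lborel)"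
    proof (rule sum.cong[OF refl])
      fix n assume n: "n \<in> {0<..Suc k}"
      let ?v = "real n * d k"
      let ?P = "past_passing ?v ?v a - past_passing ?v (?v - d k) a"
      have P: "?P \<in> sets (\<Pi>\<^sub>M s\<in>{0..?v}. borel)"
        using d[of k] by (intro sets.Diff past_passing_measurable) auto
      have pc: "passage_cell a (d k) n = past ?v -` ?P \<inter> space M"
        unfolding passage_cell_def using passing_eq_past[of ?v ?v a] passing_eq_past[of "?v - d k" ?v a] d[of k] by auto
      have "emeasure M (passage_cell a (d k) n \<inter> ?S n) = ennreal (prob (passage_cell a (d k) n)) * c ?v"
        unfolding emeasure_eq_measure pc prob_past_shifted[OF grid(1)[OF n] P C[OF grid(2)[OF n]]]
        by (simp add: ennreal_mult c_def qC_def)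
      also have "ennreal (prob (passage_cell a (d k) n)) = (\<integral>\<^sup>+s. f s * indicator {?v - d k<..?v} s \<partial>lborel)"
        using cell[OF n] by (simp add: emeasure_eq_measure)
      also have "\<dots> * c ?v = (\<integral>\<^sup>+s. f s * indicator {?v - d k<..?v} s * c ?v \<partial>lborel)"
        by (rule nn_integral_multc[symmetric]) measurable
      finally show "emeasure M (passage_cell a (d k) n \<inter> ?S n) = (\<integral>\<^sup>+s. f s * (c ?v * indicator {?v - d k<..?v} s) \<partial>lborel)"
        by (simp add: mult_ac)
    qed
    also have "\<dots> = (\<integral>\<^sup>+s. (\<Sum>n\<in>{0<..Suc k}. f s * (c (real n * d k) * indicator {real n * d k - d k<..real n * d k} s)) \<partial>lborel)"
      by (rule nn_integral_sum[symmetric]) measurable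
    also have "\<dots> = (\<integral>\<^sup>+s. f s * (c (of_int \<lceil>s / d k\<rceil> * d k) * indicator {0<..t} s) \<partial>lborel)"
      unfolding sum_distrib_left[symmetric] sum_grid_cells[OF d] dend ..
    finally show ?thesis .
  qed
  let ?I = "\<integral>\<^sup>+s. f s * ennreal (qC (t - s)) * indicator {0<..<t} s \<partial>lborel"
  have fin: "(\<integral>\<^sup>+s. f s * indicator {0<..<t} s \<partial>lborel) < \<infinity>" using Gf[of t] t by (metis ennreal_less_top infinity_ennreal_def less_imp_le order_refl)
  have qC1: "ennreal (qC r) \<le> 1" for r unfolding qC_def using prob_le_1 by (metis ennreal_leI ennreal_1)
  have lim: "(\<lambda>k. emeasure M (post_passage C a t k)) \<longlonglongrightarrow> ?I"
    unfolding eq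
  proof (rule nn_integral_dominated_convergence[where w="\<lambda>s. f s * indicator {0<..<t} s"])
    show "(\<lambda>s. f s * (c (of_int \<lceil>s / d k\<rceil> * d k) * indicator {0<..t} s)) \<in> borel_measurable lborel" for k
      unfolding c_def by measurable
    show "(\<lambda>s. f s * ennreal (qC (t - s)) * indicator {0<..<t} s) \<in> borel_measurable lborel" by measurable
    show "(\<lambda>s. f s * indicator {0<..<t} s) \<in> borel_measurable lborel" by measurable
    show "AE s in lborel. f s * (c (of_int \<lceil>s / d k\<rceil> * d k) * indicator {0<..t} s) \<le> f s * indicator {0<..<t} s" for k
      using AE_lborel_singleton[of t]
    proof eventually_elim
      case (elim s)
      have "c z * indicator {0<..t} s \<le> indicator {0<..<t} s" for z
        using elim qC1[of "t - z"] by (auto simp: c_def indicator_def)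
      then show ?case by (rule mult_left_mono) simp
    qed
    \<comment> \<open>Multiplication in \<open>ennreal\<close> is discontinuous at infinity, so the
      pointwise limit is taken where \<open>f\<close> is finite.\<close>
    have "AE s in lborel. 0 < s \<and> s < t \<longrightarrow> f s \<noteq> \<infinity>"
    proof -
      have "AE s in lborel. f s * indicator {0<..<t} s \<noteq> \<infinity>"
        using fin by (intro nn_integral_PInf_AE) auto
      then show ?thesis by eventually_elim (auto simp: indicator_def)
    qed
    then show "AE s in lborel. (\<lambda>k. f s * (c (of_int \<lceil>s / d k\<rceil> * d k) * indicator {0<..t} s)) \<longlonglongrightarrow> f s * ennreal (qC (t - s)) * indicator {0<..<t} s"
      using AE_lborel_singleton[of t]
    proof eventually_elim
      case (elim s)
      show ?case
      proof (cases "0 < s \<and> s < t")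
        case True
        define z where "z k = of_int \<lceil>s / d k\<rceil> * d k" for k
        have z: "s \<le> z k" "z \<longlonglongrightarrow> s" for k
          unfolding z_def using ceiling_grid_bounds(1)[OF d] ceiling_grid_tendsto[OF d dlim] by auto
        have zt: "z k \<le> t" for k
        proof -
          have "s / d k \<le> of_int (int (Suc k))" using True d[of k] dend(2)[of k] by (simp add: field_simps)
          then have "\<lceil>s / d k\<rceil> \<le> int (Suc k)" by (simp add: ceiling_le_iff del: of_nat_Suc)
          then have "of_int \<lceil>s / d k\<rceil> \<le> real (Suc k)" by linarith
          then have "z k \<le> real (Suc k) * d k" unfolding z_def using d[of k] by (intro mult_right_mono) auto
          then show ?thesis using dend by simp
        qed
        have "(\<lambda>k. qC (t - z k)) \<longlonglongrightarrow> qC (t - s)"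
          unfolding qC_def using True z zt by (intro left_cont tendsto_diff tendsto_const) auto
        then have "(\<lambda>k. c (z k)) \<longlonglongrightarrow> ennreal (qC (t - s))" unfolding c_def by (rule tendsto_ennrealI)
        then have "(\<lambda>k. f s * c (z k)) \<longlonglongrightarrow> f s * ennreal (qC (t - s))"
          using elim True by (intro ennreal_tendsto_cmult) (auto simp: less_top)
        then show ?thesis using True by (simp add: z_def)
      next
        case False
        then show ?thesis using elim by (auto simp: indicator_def)
      qed
    qed
  qed (use fin in simp_all)
  have "?I \<le> (\<integral>\<^sup>+s. f s * indicator {0<..<t} s \<partial>lborel)"
  proof (intro nn_integral_mono)
    fix s show "f s * ennreal (qC (t - s)) * indicator {0<..<t} s \<le> f s * indicator {0<..<t} s"
      using mult_left_mono[OF qC1, of "f s" "t - s"] by (auto simp: indicator_def)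
  qed
  then have "?I < \<infinity>" using fin by (rule le_less_trans)
  then obtain L where L: "0 \<le> L" "?I = ennreal L" by (cases ?I) auto
  have "(\<lambda>k. prob (post_passage C a t k)) \<longlonglongrightarrow> L"
    using lim unfolding emeasure_eq_measure L(2) by (subst (asm) tendsto_ennreal_iff) (auto simp: L)
  then show ?thesis using L that by (simp add: qC_def)
qed

text \<open>A passage before \<open>t\<close> lies in exactly one cell, and the restart time is the
  right end of that cell; the union over cells thus collapses to one condition on the path after
  it.\<close>

lemma post_passage_iff:
  assumes t: "0 < t" and w: "\<omega> \<in> space M" and \<sigma>: "first_passage (\<lambda>s. X s \<omega>) a \<sigma>" "\<sigma> < t"
  obtains \<theta> where "\<And>k. \<sigma> < \<theta> k" "\<And>k. \<theta> k \<le> t" "\<theta> \<longlonglongrightarrow> \<sigma>"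
    "\<And>k. \<omega> \<in> post_passage C a t k \<longleftrightarrow> shifted (\<theta> k) \<omega> \<in> C (t - \<theta> k)"
proof -
  define d where "d k = t / real (Suc k)" for k
  have d: "0 < d k" for k using t by (simp add: d_def)
  have dlim: "d \<longlonglongrightarrow> 0" unfolding d_def using LIMSEQ_Suc[OF lim_const_over_n[of t]] by simp
  have dend: "real (Suc k) * d k = t" for k by (simp add: d_def)
  have s0: "0 \<le> \<sigma>" using \<sigma>(1) by (simp add: first_passage_def)
  have passed: "\<omega> \<in> passing s a \<longleftrightarrow> \<sigma> < s" for s using first_passage_exceeds_iff[OF \<sigma>(1)] w by (simp add: passing_def)
  \<comment> \<open>Floor plus one and not the ceiling: \<open>passing s a\<close> means that
    \<sigma> is strictly before \<open>s\<close>, so a passage exactly at a grid point belongs to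
    the next cell.\<close>
  define n where "n k = Suc (nat \<lfloor>\<sigma> / d k\<rfloor>)" for k
  have nr: "real (n k) = of_int \<lfloor>\<sigma> / d k\<rfloor> + 1" for k using s0 d[of k] by (simp add: n_def)
  have lo: "\<sigma> < real (n k) * d k" for k
  proof -
    have "\<sigma> / d k < real (n k)" unfolding nr by linarith
    then show ?thesis using d[of k] by (simp add: field_simps)
  qed
  have hi: "real (n k) * d k - d k \<le> \<sigma>" for k
  proof -
    have "real (n k) - 1 \<le> \<sigma> / d k" unfolding nr by linarith
    then show ?thesis using d[of k] by (simp add: field_simps)
  qed
  have mem: "\<omega> \<in> passage_cell a (d k) m \<longleftrightarrow> m = n k" for k m
  proof
    assume "\<omega> \<in> passage_cell a (d k) m"
    then have m: "\<sigma> < real m * d k" "real m * d k - d k \<le> \<sigma>" by (auto simp: passage_cell_def passed)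
    have "(real (n k) - 1) * d k < real m * d k" "(real m - 1) * d k < real (n k) * d k"
      using m lo[of k] hi[of k] by (simp_all add: algebra_simps)
    then have "real (n k) - 1 < real m" "real m - 1 < real (n k)" using d[of k] by simp_all
    then show "m = n k" by linarith
  qed (use lo hi in \<open>auto simp: passage_cell_def passed not_less\<close>)
  have nS: "n k \<in> {0<..Suc k}" for k
  proof -
    have "(real (n k) - 1) * d k < real (Suc k) * d k" using hi[of k] \<sigma>(2) unfolding dend by (simp add: left_diff_distrib)
    then have "real (n k) - 1 < real (Suc k)" using d[of k] by (simp del: of_nat_Suc)
    then show ?thesis by (simp add: n_def)
  qed
  show ?thesis
  proof (rule that[of "\<lambda>k. real (n k) * d k"])
    show "\<sigma> < real (n k) * d k" for k by (rule lo)
    show "real (n k) * d k \<le> t" for k using grid_le(2)[OF t nS] by (simp add: d_def)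
    show "(\<lambda>k. real (n k) * d k) \<longlonglongrightarrow> \<sigma>"
    proof (rule tendsto_sandwich[OF _ _ tendsto_const[of \<sigma>]])
      show "(\<lambda>k. \<sigma> + d k) \<longlonglongrightarrow> \<sigma>" using tendsto_add[OF tendsto_const dlim, of \<sigma>] by simp
    next
      show "\<forall>\<^sub>F k in sequentially. real (n k) * d k \<le> \<sigma> + d k" using hi by (auto simp: algebra_simps intro!: always_eventually)
    qed (use lo in \<open>auto intro!: always_eventually less_imp_le\<close>)
    show "\<omega> \<in> post_passage C a t k \<longleftrightarrow> shifted (real (n k) * d k) \<omega> \<in> C (t - real (n k) * d k)" for k
      unfolding post_passage_def d_def[symmetric] using nS[of k] w by (auto simp: mem)
  qed
qed

lemma post_passage_subset_passing:
  assumes "0 < t"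
  shows "post_passage C a t k \<subseteq> passing t a"
proof
  fix \<omega> assume "\<omega> \<in> post_passage C a t k"
  then obtain n where n: "n \<in> {0<..Suc k}" "\<omega> \<in> passing (real n * (t / Suc k)) a"
    by (auto simp: post_passage_def passage_cell_def)
  then show "\<omega> \<in> passing t a" using passing_mono[OF grid_le(2)[OF assms n(1)] order_refl] by blast
qed

lemma passing_first_passage:
  assumes "\<omega> \<in> passing t a" "0 \<le> a"
  obtains \<sigma> where "first_passage (\<lambda>s. X s \<omega>) a \<sigma>" "\<sigma> < t"
proof -
  obtain s where s: "0 \<le> s" "s < t" "a < X s \<omega>" using assms by (auto simp: passing_def)
  obtain \<sigma> where \<sigma>: "first_passage (\<lambda>s. X s \<omega>) a \<sigma>" using first_passage_exists[OF regular assms(2) s(1,3)] by blast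
  moreover have "\<sigma> < t" using first_passage_exceeds_iff[OF \<sigma>, of t] s by blast
  ultimately show ?thesis by (rule that)
qed

text \<open>The path sits at \<open>a\<close> at the passage, so the remaining climb is
  \<open>b\<close>. The discretised restart happens slightly later, at a height close to
  \<open>a\<close>. A strict exceedance of \<open>a + b\<close> survives this error, which gives one
  inequality; for the other the climb is enlarged to some \<open>b'\<close> above \<open>b\<close>,
  whose margin absorbs the error, and \<open>b'\<close> is then lowered to \<open>b\<close>.\<close>

lemma passage_prob_convolution:
  fixes f :: "real \<Rightarrow> ennreal"
  assumes t: "0 < t" and f [measurable]: "f \<in> borel_measurable borel" and a: "0 \<le> a" and b: "0 \<le> b"
    and Gf: "\<And>s. 0 \<le> s \<Longrightarrow> s \<le> t \<Longrightarrow> ennreal (passage_prob s a) = (\<integral>\<^sup>+r. f r * indicator {0<..<s} r \<partial>lborel)"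
  shows "ennreal (passage_prob t (a + b)) = (\<integral>\<^sup>+s. f s * ennreal (passage_prob (t - s) b) * indicator {0<..<t} s \<partial>lborel)"
proof -
  define I where "I b = (\<integral>\<^sup>+s. f s * ennreal (passage_prob (t - s) b) * indicator {0<..<t} s \<partial>lborel)" for b
  define C where "C b r = exceed_paths 0 (ereal r) b" for b r
  have CG: "prob (path -` C b r \<inter> space M) = passage_prob r b" for b r
    unfolding C_def exceed_eq_vimage[symmetric] exceed_zero_drift passage_prob_def ..
  have lim: "\<exists>L. 0 \<le> L \<and> (\<lambda>k. prob (post_passage (C b) a t k)) \<longlonglongrightarrow> L \<and> ennreal L = I b" for b
  proof -
    obtain L where "0 \<le> L" "(\<lambda>k. prob (post_passage (C b) a t k)) \<longlonglongrightarrow> L"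
      "ennreal L = (\<integral>\<^sup>+s. f s * ennreal (prob (path -` C b (t - s) \<inter> space M)) * indicator {0<..<t} s \<partial>lborel)"
    proof (rule post_passage_limit[OF t f Gf, of "C b"])
      show "C b r \<in> sets paths" for r unfolding C_def by simp
      show "(\<lambda>r. prob (path -` C b r \<inter> space M)) \<in> borel_measurable borel" unfolding CG by simp
      show "(\<lambda>n. prob (path -` C b (u n) \<inter> space M)) \<longlonglongrightarrow> prob (path -` C b r \<inter> space M)"
        if "\<And>n. u n \<le> r" "u \<longlonglongrightarrow> r" for r and u :: "nat \<Rightarrow> real"
        unfolding CG using that by (rule passage_prob_tendsto_time)
    qed blast+
    then show ?thesis unfolding CG I_def by blast
  qed
  have mem: "shifted v \<omega> \<in> C b (t - v) \<longleftrightarrow> (\<exists>s. v \<le> s \<and> s < t \<and> X v \<omega> + b < X s \<omega>)" if "0 \<le> v" for v \<omega> b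
  proof -
    have "shifted v \<omega> \<in> C b (t - v) \<longleftrightarrow> (\<exists>s. 0 \<le> s \<and> s < t - v \<and> b < X (v + s) \<omega> - X v \<omega>)"
      unfolding C_def shifted_in_exceed_paths_iff[OF that] by simp
    also have "\<dots> \<longleftrightarrow> (\<exists>s. v \<le> s \<and> s < t \<and> X v \<omega> + b < X s \<omega>)"
    proof safe
      fix s assume "0 \<le> s" "s < t - v" "b < X (v + s) \<omega> - X v \<omega>"
      then show "\<exists>s. v \<le> s \<and> s < t \<and> X v \<omega> + b < X s \<omega>" by (intro exI[of _ "v + s"]) auto
    next
      fix s assume "v \<le> s" "s < t" "X v \<omega> + b < X s \<omega>"
      then show "\<exists>s. 0 \<le> s \<and> s < t - v \<and> b < X (v + s) \<omega> - X v \<omega>" by (intro exI[of _ "s - v"]) auto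
    qed
    finally show ?thesis .
  qed
  have Cm: "C b r \<in> sets paths" for b r unfolding C_def by simp
  have lower: "ennreal (passage_prob t (a + b)) \<le> I b" if b: "0 \<le> b" for b
  proof -
    obtain L where L: "0 \<le> L" "(\<lambda>k. prob (post_passage (C b) a t k)) \<longlonglongrightarrow> L" "ennreal L = I b" using lim by blast
    have "prob (passing t (a + b)) \<le> L"
    proof (rule prob_le_limit[OF post_passage_event[OF t Cm] passing_event L(2)], intro AE_I2 impI)
      fix \<omega> assume w: "\<omega> \<in> space M" "\<omega> \<in> passing t (a + b)"
      then obtain v where v: "0 \<le> v" "v < t" "a + b < X v \<omega>" by (auto simp: passing_def)
      have "\<omega> \<in> passing t a" using w passing_mono[of t t a "a + b"] b by auto
      then obtain \<sigma> where \<sigma>: "first_passage (\<lambda>s. X s \<omega>) a \<sigma>" "\<sigma> < t" using passing_first_passage a by blast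
      have s0: "0 \<le> \<sigma>" using \<sigma>(1) by (simp add: first_passage_def)
      have sv: "\<sigma> < v"
      proof (rule ccontr)
        assume "\<not> \<sigma> < v"
        then have "X v \<omega> \<le> a" using \<sigma>(1) v by (auto simp: first_passage_def)
        then show False using v b by simp
      qed
      obtain \<theta> where \<theta>: "\<And>k. \<sigma> < \<theta> k" "\<And>k. \<theta> k \<le> t" "\<theta> \<longlonglongrightarrow> \<sigma>"
         "\<And>k. \<omega> \<in> post_passage (C b) a t k \<longleftrightarrow> shifted (\<theta> k) \<omega> \<in> C b (t - \<theta> k)"
        using post_passage_iff[OF t w(1) \<sigma>, of "C b"] by blast
      have "(\<lambda>k. X (\<theta> k) \<omega>) \<longlonglongrightarrow> X \<sigma> \<omega>"
        by (rule right_tendsto_sequentially[of "\<lambda>s. X s \<omega>", OF right_cont[OF s0] less_imp_le[OF \<theta>(1)] \<theta>(3)])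
      moreover have "X \<sigma> \<omega> = a" by (rule first_passage_value[OF regular \<sigma>(1)])
      ultimately have "\<forall>\<^sub>F k in sequentially. X (\<theta> k) \<omega> < X v \<omega> - b" using v by (intro order_tendstoD) auto
      moreover have "\<forall>\<^sub>F k in sequentially. \<theta> k < v" using order_tendstoD(2)[OF \<theta>(3) sv] .
      ultimately show "\<forall>\<^sub>F k in sequentially. \<omega> \<in> post_passage (C b) a t k"
      proof eventually_elim
        case (elim k)
        have th0: "0 \<le> \<theta> k" using \<theta>(1)[of k] s0 by simp
        show ?case unfolding \<theta>(4) mem[OF th0] using elim v by (intro exI[of _ v]) auto
      qed
    qed
    then show ?thesis unfolding L(3)[symmetric] by (simp add: passage_prob_def ennreal_leI)
  qed
  have upper: "I b' \<le> ennreal (passage_prob t (a + b))" if b': "b < b'" for b'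
  proof -
    obtain L where L: "0 \<le> L" "(\<lambda>k. prob (post_passage (C b') a t k)) \<longlonglongrightarrow> L" "ennreal L = I b'" using lim by blast
    have "L \<le> prob (passing t (a + b))"
    proof (rule limit_le_prob[OF post_passage_event[OF t Cm] passing_event L(2)], intro AE_I2 impI)
      fix \<omega> assume w: "\<omega> \<in> space M" "\<omega> \<notin> passing t (a + b)"
      show "\<forall>\<^sub>F k in sequentially. \<omega> \<notin> post_passage (C b') a t k"
      proof (cases "\<omega> \<in> passing t a")
        case False
        then show ?thesis using post_passage_subset_passing[OF t] by (intro always_eventually) blast
      next
        case True
        then obtain \<sigma> where \<sigma>: "first_passage (\<lambda>s. X s \<omega>) a \<sigma>" "\<sigma> < t" using passing_first_passage a by blast
        have s0: "0 \<le> \<sigma>" using \<sigma>(1) by (simp add: first_passage_def)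
        obtain \<theta> where \<theta>: "\<And>k. \<sigma> < \<theta> k" "\<And>k. \<theta> k \<le> t" "\<theta> \<longlonglongrightarrow> \<sigma>"
           "\<And>k. \<omega> \<in> post_passage (C b') a t k \<longleftrightarrow> shifted (\<theta> k) \<omega> \<in> C b' (t - \<theta> k)"
          using post_passage_iff[OF t w(1) \<sigma>, of "C b'"] by blast
        have "(\<lambda>k. X (\<theta> k) \<omega>) \<longlonglongrightarrow> X \<sigma> \<omega>"
          by (rule right_tendsto_sequentially[of "\<lambda>s. X s \<omega>", OF right_cont[OF s0] less_imp_le[OF \<theta>(1)] \<theta>(3)])
        moreover have "X \<sigma> \<omega> = a" by (rule first_passage_value[OF regular \<sigma>(1)])
        ultimately have "\<forall>\<^sub>F k in sequentially. a - (b' - b) < X (\<theta> k) \<omega>" using b' by (intro order_tendstoD) auto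
        then show ?thesis
        proof eventually_elim
          case (elim k)
          have th0: "0 \<le> \<theta> k" using \<theta>(1)[of k] s0 by simp
          show ?case unfolding \<theta>(4) mem[OF th0]
          proof
            assume "\<exists>s\<ge>\<theta> k. s < t \<and> X (\<theta> k) \<omega> + b' < X s \<omega>"
            then obtain s where s: "\<theta> k \<le> s" "s < t" "X (\<theta> k) \<omega> + b' < X s \<omega>" by blast
            then have "\<omega> \<in> passing t (a + b)" using elim th0 w(1) by (auto simp: passing_def intro!: exI[of _ s])
            then show False using w by simp
          qed
        qed
      qed
    qed
    then show ?thesis unfolding L(3)[symmetric] by (simp add: passage_prob_def ennreal_leI)
  qed
  define bn where "bn n = b + 1 / real (Suc n)" for n
  have bn: "b < bn n" for n by (simp add: bn_def)
  have bn_lim: "bn \<longlonglongrightarrow> b"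
    unfolding bn_def using tendsto_add[OF tendsto_const LIMSEQ_Suc[OF lim_const_over_n[of 1]], of b] by simp
  have Gm [measurable]: "(\<lambda>s. passage_prob (t - s) b) \<in> borel_measurable borel" for b
    by (rule measurable_compose[OF _ passage_prob_measurable(2)]) measurable
  have G1: "ennreal (passage_prob s b) \<le> 1" for s b using passage_prob_bounds(2) by (metis ennreal_leI ennreal_1)
  have fin: "(\<integral>\<^sup>+s. f s * indicator {0<..<t} s \<partial>lborel) < \<infinity>"
    using Gf[of t] t by (metis ennreal_less_top infinity_ennreal_def less_imp_le order_refl)
  have "(\<lambda>n. I (bn n)) \<longlonglongrightarrow> I b"
    unfolding I_def
  proof (rule nn_integral_dominated_convergence[where w="\<lambda>s. f s * indicator {0<..<t} s"])
    show "AE s in lborel. f s * ennreal (passage_prob (t - s) (bn n)) * indicator {0<..<t} s \<le> f s * indicator {0<..<t} s" for n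
    proof (rule AE_I2)
      fix s show "f s * ennreal (passage_prob (t - s) (bn n)) * indicator {0<..<t} s \<le> f s * indicator {0<..<t} s"
        using mult_left_mono[OF G1, of "f s" "t - s" "bn n"] by (auto simp: indicator_def)
    qed
    have "AE s in lborel. f s * indicator {0<..<t} s \<noteq> \<infinity>" using fin by (intro nn_integral_PInf_AE) auto
    then show "AE s in lborel. (\<lambda>n. f s * ennreal (passage_prob (t - s) (bn n)) * indicator {0<..<t} s) \<longlonglongrightarrow> f s * ennreal (passage_prob (t - s) b) * indicator {0<..<t} s"
    proof eventually_elim
      case (elim s)
      show ?case
      proof (cases "s \<in> {0<..<t}")
        case True
        have "(\<lambda>n. ennreal (passage_prob (t - s) (bn n))) \<longlonglongrightarrow> ennreal (passage_prob (t - s) b)"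
          using bn by (intro tendsto_ennrealI passage_prob_tendsto_level bn_lim) (simp add: less_imp_le)
        then have "(\<lambda>n. f s * ennreal (passage_prob (t - s) (bn n))) \<longlonglongrightarrow> f s * ennreal (passage_prob (t - s) b)"
          using elim True by (intro ennreal_tendsto_cmult) (auto simp: less_top)
        then show ?thesis using True by simp
      qed simp
    qed
  qed (use fin in simp_all)
  then have "I b \<le> ennreal (passage_prob t (a + b))"
    by (rule LIMSEQ_le_const2) (use upper bn in blast)
  then show ?thesis using lower[OF b] unfolding I_def by (rule antisym[rotated])
qed

end

section \<open>Position at a fixed time after the passage\<close>

context regular_levy_density
begin

text \<open>Supplies the limit premise of \<open>post_passage_limit\<close>. The times increase to
  \<open>r\<close>, so the ingredients are the absence of a fixed jump at \<open>r\<close> and of an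
  atom of \<open>X r\<close> at \<open>y\<close>.\<close>

lemma prob_le_tendsto:
  assumes r: "0 < r" and u: "\<And>n. 0 \<le> u n" "\<And>n. u n \<le> r" "u \<longlonglongrightarrow> r"
  shows "(\<lambda>n. prob {\<omega> \<in> space M. X (u n) \<omega> \<le> y}) \<longlonglongrightarrow> prob {\<omega> \<in> space M. X r \<omega> \<le> y}"
proof (rule prob_tendsto_eventually_eq)
  show "{\<omega> \<in> space M. X (u n) \<omega> \<le> y} \<in> events" for n using rv[OF u(1)[of n]] by measurable
  have [measurable]: "X r \<in> borel_measurable M" using r by (intro rv) simp
  show "{\<omega> \<in> space M. X r \<omega> \<le> y} \<in> events" by measurable
  show "AE \<omega> in M. \<forall>\<^sub>F n in sequentially. \<omega> \<in> {\<omega> \<in> space M. X (u n) \<omega> \<le> y} \<longleftrightarrow> \<omega> \<in> {\<omega> \<in> space M. X r \<omega> \<le> y}"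
    using AE_left_continuous[OF r] AE_neq[OF r, of y]
  proof eventually_elim
    case (elim \<omega>)
    have conv: "(\<lambda>n. X (u n) \<omega>) \<longlonglongrightarrow> X r \<omega>" by (rule left_tendsto_sequentially[of "\<lambda>s. X s \<omega>", OF elim(1) u(2,3)])
    consider "X r \<omega> < y" | "y < X r \<omega>" using elim(2) by linarith
    then show ?case
    proof cases
      case 1
      from order_tendstoD(2)[OF conv 1] show ?thesis by eventually_elim (use 1 in auto)
    next
      case 2
      from order_tendstoD(1)[OF conv 2] show ?thesis by eventually_elim (use 2 in auto)
    qed
  qed
qed

text \<open>Restarted at height \<open>a\<close>, the bound \<open>a + y\<close> on the position
  becomes a bound \<open>y\<close> on the increment over the remaining time. Convergence is
  two-sided here because \<open>X t\<close> almost surely avoids the boundary value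
  \<open>a + y\<close>.\<close>

lemma passage_position:
  fixes f :: "real \<Rightarrow> ennreal"
  assumes t: "0 < t" and f [measurable]: "f \<in> borel_measurable borel" and a: "0 \<le> a"
    and Gf: "\<And>s. 0 \<le> s \<Longrightarrow> s \<le> t \<Longrightarrow> ennreal (passage_prob s a) = (\<integral>\<^sup>+r. f r * indicator {0<..<s} r \<partial>lborel)"
  shows "emeasure M (passing t a \<inter> {\<omega> \<in> space M. X t \<omega> \<le> a + y}) =
    (\<integral>\<^sup>+s. f s * (\<integral>\<^sup>+z. ennreal (q z (t - s)) * indicator {..y} z \<partial>lborel) * indicator {0<..<t} s \<partial>lborel)"
proof -
  \<comment> \<open>The maximum with 0 keeps the coordinate in the index set of \<open>paths\<close>
    for negative \<open>r\<close>, so every \<open>C r\<close> is measurable.\<close>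
  define C where "C r = {w \<in> space paths. w (max 0 r) \<le> y}" for r
  have Cm: "C r \<in> sets paths" for r
  proof -
    have [measurable]: "(\<lambda>w. w (max 0 r)) \<in> measurable paths borel" by (intro measurable_component_singleton) auto
    show ?thesis unfolding C_def by measurable
  qed
  have CX: "path -` C r \<inter> space M = {\<omega> \<in> space M. X (max 0 r) \<omega> \<le> y}" for r
    by (auto simp: C_def path_def space_PiM)
  have dens: "ennreal (prob {\<omega> \<in> space M. X r \<omega> \<le> y}) = (\<integral>\<^sup>+z. ennreal (q z r) * indicator {..y} z \<partial>lborel)" if "0 < r" for r
  proof -
    have "emeasure M (X r -` {..y} \<inter> space M) = (\<integral>\<^sup>+z. ennreal (q z r) * indicator {..y} z \<partial>lborel)"
      using density[OF that] by (intro distributed_emeasure) auto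
    moreover have "X r -` {..y} \<inter> space M = {\<omega> \<in> space M. X r \<omega> \<le> y}" by auto
    ultimately show ?thesis by (simp add: emeasure_eq_measure)
  qed
  have meas: "(\<lambda>r. prob (path -` C r \<inter> space M)) \<in> borel_measurable borel"
  proof -
    have "(\<lambda>r. prob (path -` C r \<inter> space M)) = (\<lambda>r. if 0 < r then enn2real (\<integral>\<^sup>+z. ennreal (q z r) * indicator {..y} z \<partial>lborel)
        else prob {\<omega> \<in> space M. X 0 \<omega> \<le> y})"
      by (auto simp: fun_eq_iff CX dens[symmetric] max_def)
    also have "\<dots> \<in> borel_measurable borel" by measurable
    finally show ?thesis .
  qed
  obtain L where L: "0 \<le> L" "(\<lambda>k. prob (post_passage C a t k)) \<longlonglongrightarrow> L"
    "ennreal L = (\<integral>\<^sup>+s. f s * ennreal (prob (path -` C (t - s) \<inter> space M)) * indicator {0<..<t} s \<partial>lborel)"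
  proof (rule post_passage_limit[OF t f Gf Cm _ meas])
    fix r :: real and u :: "nat \<Rightarrow> real" assume "0 < r" "\<And>n::nat. 0 \<le> u n" "\<And>n. u n \<le> r" "u \<longlonglongrightarrow> r"
    then show "(\<lambda>n. prob (path -` C (u n) \<inter> space M)) \<longlonglongrightarrow> prob (path -` C r \<inter> space M)"
      unfolding CX using prob_le_tendsto[of r u y] by simp
  qed blast+
  have [measurable]: "X t \<in> borel_measurable M" using t by (intro rv) simp
  have "(\<lambda>k. prob (post_passage C a t k)) \<longlonglongrightarrow> prob (passing t a \<inter> {\<omega> \<in> space M. X t \<omega> \<le> a + y})"
  proof (rule prob_tendsto_eventually_eq)
    show "AE \<omega> in M. \<forall>\<^sub>F k in sequentially. \<omega> \<in> post_passage C a t k \<longleftrightarrow> \<omega> \<in> passing t a \<inter> {\<omega> \<in> space M. X t \<omega> \<le> a + y}"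
      using AE_neq[OF t, of "a + y"] AE_space
    proof eventually_elim
      case (elim \<omega>)
      show ?case
      proof (cases "\<omega> \<in> passing t a")
        case False
        then show ?thesis using post_passage_subset_passing[OF t] by (intro always_eventually) blast
      next
        case True
        then obtain \<sigma> where \<sigma>: "first_passage (\<lambda>s. X s \<omega>) a \<sigma>" "\<sigma> < t" using passing_first_passage a by blast
        have s0: "0 \<le> \<sigma>" using \<sigma>(1) by (simp add: first_passage_def)
        obtain \<theta> where \<theta>: "\<And>k. \<sigma> < \<theta> k" "\<And>k. \<theta> k \<le> t" "\<theta> \<longlonglongrightarrow> \<sigma>"
           "\<And>k. \<omega> \<in> post_passage C a t k \<longleftrightarrow> shifted (\<theta> k) \<omega> \<in> C (t - \<theta> k)"
          using post_passage_iff[OF t elim(2) \<sigma>, of C] by blast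
        have mem: "shifted (\<theta> k) \<omega> \<in> C (t - \<theta> k) \<longleftrightarrow> X t \<omega> - X (\<theta> k) \<omega> \<le> y" for k
          using \<theta>(2)[of k] by (auto simp: C_def shifted_def space_PiM)
        have "(\<lambda>k. X (\<theta> k) \<omega>) \<longlonglongrightarrow> X \<sigma> \<omega>"
          by (rule right_tendsto_sequentially[of "\<lambda>s. X s \<omega>", OF right_cont[OF s0] less_imp_le[OF \<theta>(1)] \<theta>(3)])
        moreover have "X \<sigma> \<omega> = a" by (rule first_passage_value[OF regular \<sigma>(1)])
        ultimately have conv: "(\<lambda>k. X t \<omega> - X (\<theta> k) \<omega>) \<longlonglongrightarrow> X t \<omega> - a" by (auto intro!: tendsto_intros)
        consider "X t \<omega> - a < y" | "y < X t \<omega> - a" using elim(1) by linarith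
        then show ?thesis
        proof cases
          case 1
          from order_tendstoD(2)[OF conv 1] show ?thesis
            by eventually_elim (use 1 True elim(2) in \<open>auto simp: \<theta>(4) mem\<close>)
        next
          case 2
          from order_tendstoD(1)[OF conv 2] show ?thesis
            by eventually_elim (use 2 True elim(2) in \<open>auto simp: \<theta>(4) mem\<close>)
        qed
      qed
    qed
  qed (use post_passage_event[OF t Cm] in auto)
  then have "prob (passing t a \<inter> {\<omega> \<in> space M. X t \<omega> \<le> a + y}) = L" using L(2) LIMSEQ_unique by blast
  then have "emeasure M (passing t a \<inter> {\<omega> \<in> space M. X t \<omega> \<le> a + y}) =
     (\<integral>\<^sup>+s. f s * ennreal (prob (path -` C (t - s) \<inter> space M)) * indicator {0<..<t} s \<partial>lborel)"
    by (simp add: emeasure_eq_measure L(3))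
  also have "\<dots> = (\<integral>\<^sup>+s. f s * (\<integral>\<^sup>+z. ennreal (q z (t - s)) * indicator {..y} z \<partial>lborel) * indicator {0<..<t} s \<partial>lborel)"
    by (intro nn_integral_cong) (auto simp: CX dens indicator_def)
  finally show ?thesis .
qed

end

section \<open>Kendall's identity at a fixed level\<close>

lemma indicator_greaterThanLessThan_measurable [measurable (raw)]:
  fixes f h :: "'a \<Rightarrow> real"
  assumes [measurable]: "f \<in> borel_measurable N" "h \<in> borel_measurable N"
  shows "(\<lambda>x. indicator {0<..<f x} (h x) :: ennreal) \<in> borel_measurable N"
proof -
  have "(\<lambda>x. indicator {0<..<f x} (h x) :: ennreal) = (\<lambda>x. if 0 < h x \<and> h x < f x then 1 else 0)"
    by (auto simp: indicator_def)
  also have "\<dots> \<in> borel_measurable N" by measurable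
  finally show ?thesis .
qed

lemma AE_exists_in_interval:
  fixes a b :: real
  assumes "AE y in lborel. P y" "a < b"
  obtains y where "a < y" "y < b" "P y"
proof -
  have "\<exists>y. a < y \<and> y < b \<and> P y"
  proof (rule ccontr)
    assume "\<not> ?thesis"
    then have "AE y in lborel. y \<notin> {a<..<b}" using assms(1) by (auto elim!: eventually_mono)
    then have "emeasure lborel {a<..<b} = 0" by (subst (asm) AE_iff_measurable[of "{a<..<b}"]) auto
    then show False using assms(2) by simp
  qed
  then show ?thesis using that by blast
qed

context regular_levy
begin

lemma passage_prob_joint_measurable [measurable]: "(\<lambda>(t, b). passage_prob t b) \<in> borel_measurable (borel \<Otimes>\<^sub>M borel)"
proof -
  let ?B = "borel \<Otimes>\<^sub>M borel :: (real \<times> real) measure"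
  define Q where "Q = (\<Union>r\<in>{r\<in>\<rat>. 0 \<le> r}. {p \<in> space (?B \<Otimes>\<^sub>M M). r < fst (fst p) \<and> snd (fst p) < X r (snd p)})"
  have "Q \<in> sets (?B \<Otimes>\<^sub>M M)"
    unfolding Q_def
  proof (rule sets.countable_UN'')
    show "countable {r\<in>\<rat>. (0::real) \<le> r}" by (rule countable_subset[OF _ countable_rat]) auto
    fix r :: real assume "r \<in> {r\<in>\<rat>. 0 \<le> r}"
    then have [measurable]: "X r \<in> borel_measurable M" by (intro rv) auto
    show "{p \<in> space (?B \<Otimes>\<^sub>M M). r < fst (fst p) \<and> snd (fst p) < X r (snd p)} \<in> sets (?B \<Otimes>\<^sub>M M)" by measurable
  qed
  then have "(\<lambda>p. emeasure M (Pair p -` Q)) \<in> borel_measurable ?B" by (rule measurable_emeasure_Pair)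
  moreover have "Pair p -` Q = passing (fst p) (snd p)" for p
    using right_continuous_exceeds_iff_Rats[OF right_cont, of "ereal (fst p)" "snd p"]
    by (auto simp: Q_def passing_def space_pair_measure)
  ultimately have "(\<lambda>p. enn2real (emeasure M (passing (fst p) (snd p)))) \<in> borel_measurable ?B" by simp
  then show ?thesis by (simp add: passage_prob_def measure_def split_beta')
qed

end

section \<open>Difference quotients of the identity in the level\<close>

context regular_levy_density
begin

text \<open>For \<open>0 \<le> a\<close> and \<open>0 < e\<close> this is the average of
  \<open>kendall_density y s\<close> over the levels \<open>y\<close> in \<open>(a, a + e]\<close>.
  It is expressed through \<open>truncated_mean\<close>, hence through the law of \<open>X s\<close>
  and not through the chosen version of its density.\<close>

definition level_quotient :: "real \<Rightarrow> real \<Rightarrow> real \<Rightarrow> ennreal" where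
  "level_quotient a e s = ennreal ((truncated_mean (a + e) s - truncated_mean a s) / (e * s)) * indicator {0<..} s"

lemma truncated_mean_diff:
  assumes "0 \<le> s" "0 \<le> a" "0 \<le> e"
  shows "truncated_mean (a + e) s - truncated_mean a s = (\<integral>\<omega>. X s \<omega> * indicator {a<..a + e} (X s \<omega>) \<partial>M)"
proof -
  have [measurable]: "X s \<in> borel_measurable M" using assms by (intro rv)
  have i: "integrable M (\<lambda>\<omega>. X s \<omega> * indicator {b<..x} (X s \<omega>))" if "0 \<le> b" "0 \<le> x" for b x
    using that by (intro integrable_const_bound[where B=x]) (auto simp: indicator_def)
  have "truncated_mean (a + e) s - truncated_mean a s = (\<integral>\<omega>. X s \<omega> * indicator {0<..a + e} (X s \<omega>) - X s \<omega> * indicator {0<..a} (X s \<omega>) \<partial>M)"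
    unfolding truncated_mean_def using assms by (intro Bochner_Integration.integral_diff[symmetric] i) auto
  also have "\<dots> = (\<integral>\<omega>. X s \<omega> * indicator {a<..a + e} (X s \<omega>) \<partial>M)"
    using assms by (intro Bochner_Integration.integral_cong) (auto simp: indicator_def)
  finally show ?thesis .
qed

lemma truncated_mean_diff_bounds:
  assumes "0 \<le> s" "0 \<le> a" "0 \<le> e"
  shows "a * prob {\<omega> \<in> space M. X s \<omega> \<in> {a<..a + e}} \<le> truncated_mean (a + e) s - truncated_mean a s"
    "truncated_mean (a + e) s - truncated_mean a s \<le> (a + e) * prob {\<omega> \<in> space M. X s \<omega> \<in> {a<..a + e}}"
    "0 \<le> truncated_mean (a + e) s - truncated_mean a s"
proof -
  have [measurable]: "X s \<in> borel_measurable M" using assms by (intro rv)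
  let ?E = "{\<omega> \<in> space M. X s \<omega> \<in> {a<..a + e}}"
  have E: "?E \<in> events" by measurable
  have i: "integrable M (\<lambda>\<omega>. X s \<omega> * indicator {a<..a + e} (X s \<omega>))"
    using assms by (intro integrable_const_bound[where B="a + e"]) (auto simp: indicator_def)
  have "integrable M (\<lambda>\<omega>. c * indicator F \<omega>) \<and> c * prob F = (\<integral>\<omega>. c * indicator F \<omega> \<partial>M)"
    if "F \<in> events" for c :: real and F
    using that by (auto intro!: integrable_mult_right integrable_real_indicator simp: less_top[symmetric])
  then have j: "integrable M (\<lambda>\<omega>. c * indicator ?E \<omega>)"
    and c: "c * prob ?E = (\<integral>\<omega>. c * indicator ?E \<omega> \<partial>M)" for c :: real using E by blast+
  show low: "a * prob ?E \<le> truncated_mean (a + e) s - truncated_mean a s" unfolding truncated_mean_diff[OF assms] c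
    using assms by (intro integral_mono i j) (auto simp: indicator_def)
  show "truncated_mean (a + e) s - truncated_mean a s \<le> (a + e) * prob ?E" unfolding truncated_mean_diff[OF assms] c
    using assms by (intro integral_mono i j) (auto simp: indicator_def)
  show "0 \<le> truncated_mean (a + e) s - truncated_mean a s" using low assms(2) by (meson measure_nonneg mult_nonneg_nonneg order_trans)
qed

lemma level_quotient_measurable:
  assumes "0 \<le> a" "0 < e"
  shows "level_quotient a e \<in> borel_measurable borel"
proof -
  have [measurable]: "(\<lambda>s. ennreal (truncated_mean a s) * indicator {0<..} s) \<in> borel_measurable borel"
      "(\<lambda>s. ennreal (truncated_mean (a + e) s) * indicator {0<..} s) \<in> borel_measurable borel"
    using assms by (auto intro!: truncated_mean_measurable)
  have "level_quotient a e = (\<lambda>s. ((ennreal (truncated_mean (a + e) s) * indicator {0<..} s) - (ennreal (truncated_mean a s) * indicator {0<..} s)) * ennreal (1 / (e * s)))"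
  proof
    fix s
    show "level_quotient a e s = ((ennreal (truncated_mean (a + e) s) * indicator {0<..} s) - (ennreal (truncated_mean a s) * indicator {0<..} s)) * ennreal (1 / (e * s))"
      using assms truncated_mean_diff_bounds(3)[of s a e] truncated_mean_bounds(1)[of s a]
      by (cases "0 < s") (auto simp: level_quotient_def ennreal_minus ennreal_mult[symmetric])
  qed
  also have "\<dots> \<in> borel_measurable borel" by measurable
  finally show ?thesis .
qed

text \<open>The difference of \<open>kendall_integrated\<close> at the levels \<open>a + e\<close>
  and \<open>a\<close>, obtained in \<open>ennreal\<close> by cancelling a common finite
  summand.\<close>

lemma level_quotient_integral:
  assumes t: "0 < t" and a: "0 \<le> a" and e: "0 < e"
  shows "(\<integral>\<^sup>+s. level_quotient a e s * indicator {0<..<t} s \<partial>lborel) =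
    ennreal (1 / e) * (\<integral>\<^sup>+y. ennreal (passage_prob t y) * indicator {a..<a + e} y \<partial>lborel)"
proof -
  let ?D = "\<lambda>s. ennreal ((truncated_mean (a + e) s - truncated_mean a s) / s) * indicator {0<..t} s"
  note [measurable] = truncated_mean_quotient_measurable[OF _ order_refl]
  have Deq: "?D s = ennreal e * (level_quotient a e s * indicator {0<..t} s)" for s
    using e truncated_mean_diff_bounds(3)[of s a e] a by (auto simp: level_quotient_def indicator_def ennreal_mult[symmetric])
  have [measurable]: "level_quotient a e \<in> borel_measurable borel" by (rule level_quotient_measurable[OF a e])
  have Dm: "?D \<in> borel_measurable lborel" unfolding Deq by measurable
  have I0: "(\<integral>\<^sup>+y. ennreal (passage_prob t y) * indicator {0..<a} y \<partial>lborel) < \<infinity>"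
  proof -
    have "(\<integral>\<^sup>+y. ennreal (passage_prob t y) * indicator {0..<a} y \<partial>lborel) \<le> (\<integral>\<^sup>+y. indicator {0..<a} y \<partial>lborel)"
      using passage_prob_bounds by (intro nn_integral_mono) (auto simp: indicator_def)
    then show ?thesis using a by (simp add: le_less_trans)
  qed
  have "(\<integral>\<^sup>+y. ennreal (passage_prob t y) * indicator {0..<a} y \<partial>lborel) + (\<integral>\<^sup>+y. ennreal (passage_prob t y) * indicator {a..<a + e} y \<partial>lborel)
     = (\<integral>\<^sup>+y. ennreal (passage_prob t y) * indicator {0..<a} y + ennreal (passage_prob t y) * indicator {a..<a + e} y \<partial>lborel)"
    by (rule nn_integral_add[symmetric]) measurable
  also have "\<dots> = (\<integral>\<^sup>+y. ennreal (passage_prob t y) * indicator {0..<a + e} y \<partial>lborel)"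
    using a e by (intro nn_integral_cong) (auto simp: indicator_def)
  also have "\<dots> = (\<integral>\<^sup>+s. ennreal (truncated_mean (a + e) s / s) * indicator {0<..t} s \<partial>lborel)"
    using a e by (intro kendall_integrated t) simp
  also have "\<dots> = (\<integral>\<^sup>+s. ennreal (truncated_mean a s / s) * indicator {0<..t} s + ?D s \<partial>lborel)"
  proof (rule nn_integral_cong)
    fix s
    have "ennreal (truncated_mean (a + e) s / s) = ennreal (truncated_mean a s / s) + ennreal ((truncated_mean (a + e) s - truncated_mean a s) / s)" if "0 < s"
      using that a e truncated_mean_bounds(1)[of s a] truncated_mean_diff_bounds(3)[of s a e]
      by (subst ennreal_plus[symmetric]) (auto simp: diff_divide_distrib divide_right_mono)
    then show "ennreal (truncated_mean (a + e) s / s) * indicator {0<..t} s = ennreal (truncated_mean a s / s) * indicator {0<..t} s + ?D s"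
      by (auto simp: indicator_def)
  qed
  also have "\<dots> = (\<integral>\<^sup>+s. ennreal (truncated_mean a s / s) * indicator {0<..t} s \<partial>lborel) + (\<integral>\<^sup>+s. ?D s \<partial>lborel)"
    using a Dm by (intro nn_integral_add) auto
  also have "(\<integral>\<^sup>+s. ennreal (truncated_mean a s / s) * indicator {0<..t} s \<partial>lborel) = (\<integral>\<^sup>+y. ennreal (passage_prob t y) * indicator {0..<a} y \<partial>lborel)"
    by (rule kendall_integrated[OF t a, symmetric])
  finally have "(\<integral>\<^sup>+y. ennreal (passage_prob t y) * indicator {a..<a + e} y \<partial>lborel) = (\<integral>\<^sup>+s. ?D s \<partial>lborel)"
    using I0 by (auto simp: ennreal_add_left_cancel)
  also have "\<dots> = ennreal e * (\<integral>\<^sup>+s. level_quotient a e s * indicator {0<..t} s \<partial>lborel)"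
    unfolding Deq by (rule nn_integral_cmult) measurable
  also have "(\<integral>\<^sup>+s. level_quotient a e s * indicator {0<..t} s \<partial>lborel) = (\<integral>\<^sup>+s. level_quotient a e s * indicator {0<..<t} s \<partial>lborel)"
    using AE_lborel_singleton[of t] by (intro nn_integral_cong_AE) (auto elim!: eventually_mono simp: indicator_def)
  finally have "ennreal (1 / e) * (\<integral>\<^sup>+y. ennreal (passage_prob t y) * indicator {a..<a + e} y \<partial>lborel) =
     (ennreal (1 / e) * ennreal e) * (\<integral>\<^sup>+s. level_quotient a e s * indicator {0<..<t} s \<partial>lborel)" by (simp add: mult.assoc)
  also have "ennreal (1 / e) * ennreal e = 1" using e by (simp add: ennreal_mult[symmetric])
  finally show ?thesis by simp
qed

text \<open>Passage probabilities decrease in the level, so their average over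
  \<open>[a, a + e)\<close> lies between the values at the ends.\<close>

lemma level_quotient_integral_bounds:
  assumes t: "0 < t" and a: "0 \<le> a" and e: "0 < e"
  shows "(\<integral>\<^sup>+s. level_quotient a e s * indicator {0<..<t} s \<partial>lborel) \<le> ennreal (passage_prob t a)"
    "ennreal (passage_prob t (a + e)) \<le> (\<integral>\<^sup>+s. level_quotient a e s * indicator {0<..<t} s \<partial>lborel)"
proof -
  have const: "ennreal (1 / e) * (\<integral>\<^sup>+y. ennreal c * indicator {a..<a + e} y \<partial>lborel) = ennreal c" if "0 \<le> c" for c
    using e that by (simp add: nn_integral_cmult ennreal_mult[symmetric])
  have "(\<integral>\<^sup>+y. ennreal (passage_prob t y) * indicator {a..<a + e} y \<partial>lborel) \<le> (\<integral>\<^sup>+y. ennreal (passage_prob t a) * indicator {a..<a + e} y \<partial>lborel)"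
    by (intro nn_integral_mono) (auto simp: indicator_def intro!: ennreal_leI passage_prob_mono)
  from mult_left_mono[OF this, of "ennreal (1 / e)"]
  have "ennreal (1 / e) * (\<integral>\<^sup>+y. ennreal (passage_prob t y) * indicator {a..<a + e} y \<partial>lborel) \<le> ennreal (passage_prob t a)"
    unfolding const[OF passage_prob_bounds(1)] by simp
  then show "(\<integral>\<^sup>+s. level_quotient a e s * indicator {0<..<t} s \<partial>lborel) \<le> ennreal (passage_prob t a)"
    unfolding level_quotient_integral[OF assms] .
  have "(\<integral>\<^sup>+y. ennreal (passage_prob t (a + e)) * indicator {a..<a + e} y \<partial>lborel) \<le> (\<integral>\<^sup>+y. ennreal (passage_prob t y) * indicator {a..<a + e} y \<partial>lborel)"
    by (intro nn_integral_mono) (auto simp: indicator_def intro!: ennreal_leI passage_prob_mono)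
  from mult_left_mono[OF this, of "ennreal (1 / e)"]
  have "ennreal (passage_prob t (a + e)) \<le> ennreal (1 / e) * (\<integral>\<^sup>+y. ennreal (passage_prob t y) * indicator {a..<a + e} y \<partial>lborel)"
    unfolding const[OF passage_prob_bounds(1)] by simp
  then show "ennreal (passage_prob t (a + e)) \<le> (\<integral>\<^sup>+s. level_quotient a e s * indicator {0<..<t} s \<partial>lborel)"
    unfolding level_quotient_integral[OF assms] .
qed

lemma nn_integral_reflect:
  fixes h :: "real \<Rightarrow> ennreal"
  assumes [measurable]: "h \<in> borel_measurable borel"
  shows "(\<integral>\<^sup>+s. h (c - s) \<partial>lborel) = (\<integral>\<^sup>+s. h s \<partial>lborel)"
  using nn_integral_real_affine[of h "-1" c] by simp

text \<open>Passing over the level \<open>a + b\<close> means passing over \<open>a\<close> first; averaging over a small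
  interval of levels \<open>b\<close> gives a convolution of the density at \<open>a\<close> with \<open>level_quotient b e\<close>.\<close>

lemma level_quotient_convolution:
  assumes T: "0 < T" and a: "0 \<le> a" and b: "0 \<le> b" and e: "0 < e"
    and f [measurable]: "f \<in> borel_measurable borel"
    and Gf: "\<And>s. 0 \<le> s \<Longrightarrow> s \<le> T \<Longrightarrow> ennreal (passage_prob s a) = (\<integral>\<^sup>+r. f r * indicator {0<..<s} r \<partial>lborel)"
  shows "AE r in lborel. 0 < r \<and> r < T \<longrightarrow> level_quotient (a + b) e r = (\<integral>\<^sup>+s. f s * level_quotient b e (r - s) * indicator {0<..<r} s \<partial>lborel)"
\<comment> \<open>Integrated over \<open>(0, t)\<close>, the left side becomes an average of passage
  probabilities over levels, to which \<open>passage_prob_convolution\<close> applies level by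
  level; exchanging integrals recovers the right side.\<close>
proof (rule AE_eq_if_integrals_eq)
  have ab: "0 \<le> a + b" using a b by simp
  have Wm [measurable]: "level_quotient b e \<in> borel_measurable borel" by (rule level_quotient_measurable[OF b e])
  show "level_quotient (a + b) e \<in> borel_measurable borel" by (rule level_quotient_measurable[OF ab e])
  show "(\<lambda>r. \<integral>\<^sup>+s. f s * level_quotient b e (r - s) * indicator {0<..<r} s \<partial>lborel) \<in> borel_measurable borel"
    by measurable
  show "(\<integral>\<^sup>+s. level_quotient (a + b) e s * indicator {0<..<T} s \<partial>lborel) < \<infinity>"
    using level_quotient_integral_bounds(1)[OF T ab e] by (rule le_less_trans) simp
  fix t assume t: "0 < t" "t \<le> T"
  have W0: "level_quotient b e v = 0" if "v \<le> 0" for v using that by (simp add: level_quotient_def)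
  have inner: "ennreal (1 / e) * (\<integral>\<^sup>+y. ennreal (passage_prob (t - s) y) * indicator {b..<b + e} y \<partial>lborel) =
       (\<integral>\<^sup>+r. level_quotient b e (r - s) * indicator {0<..<t} r \<partial>lborel)" if s: "0 < s" "s < t" for s
  proof -
    have "(\<integral>\<^sup>+r. level_quotient b e (r - s) * indicator {0<..<t} r \<partial>lborel) = (\<integral>\<^sup>+v. level_quotient b e v * indicator {0<..<t} (v + s) \<partial>lborel)"
      using nn_integral_real_affine[of "\<lambda>r. level_quotient b e (r - s) * indicator {0<..<t} r" 1 s] by (simp add: add.commute)
    also have "\<dots> = (\<integral>\<^sup>+v. level_quotient b e v * indicator {0<..<t - s} v \<partial>lborel)"
      using s by (intro nn_integral_cong) (auto simp: level_quotient_def indicator_def)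
    also have "\<dots> = ennreal (1 / e) * (\<integral>\<^sup>+y. ennreal (passage_prob (t - s) y) * indicator {b..<b + e} y \<partial>lborel)"
      using s by (intro level_quotient_integral b e) simp
    finally show ?thesis by simp
  qed
  have "(\<integral>\<^sup>+s. level_quotient (a + b) e s * indicator {0<..<t} s \<partial>lborel) =
     ennreal (1 / e) * (\<integral>\<^sup>+y. ennreal (passage_prob t y) * indicator {a + b..<a + b + e} y \<partial>lborel)"
    by (rule level_quotient_integral[OF t(1) ab e])
  also have "(\<integral>\<^sup>+y. ennreal (passage_prob t y) * indicator {a + b..<a + b + e} y \<partial>lborel) =
     (\<integral>\<^sup>+y. ennreal (passage_prob t (a + y)) * indicator {b..<b + e} y \<partial>lborel)"
    using nn_integral_real_affine[of "\<lambda>y. ennreal (passage_prob t y) * indicator {a + b..<a + b + e} y" 1 a]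
    by (simp add: indicator_def of_bool_def add.assoc)
  also have "\<dots> = (\<integral>\<^sup>+y. (\<integral>\<^sup>+s. f s * ennreal (passage_prob (t - s) y) * indicator {0<..<t} s * indicator {b..<b + e} y \<partial>lborel) \<partial>lborel)"
  proof (rule nn_integral_cong)
    fix y
    show "ennreal (passage_prob t (a + y)) * indicator {b..<b + e} y = (\<integral>\<^sup>+s. f s * ennreal (passage_prob (t - s) y) * indicator {0<..<t} s * indicator {b..<b + e} y \<partial>lborel)"
    proof (cases "y \<in> {b..<b + e}")
      case True
      then have y: "0 \<le> y" using b by simp
      have "ennreal (passage_prob t (a + y)) = (\<integral>\<^sup>+s. f s * ennreal (passage_prob (t - s) y) * indicator {0<..<t} s \<partial>lborel)"
        using t by (intro passage_prob_convolution t(1) f a y Gf) auto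
      then show ?thesis using True by simp
    qed simp
  qed
  also have "\<dots> = (\<integral>\<^sup>+s. (\<integral>\<^sup>+y. f s * ennreal (passage_prob (t - s) y) * indicator {0<..<t} s * indicator {b..<b + e} y \<partial>lborel) \<partial>lborel)"
    by (rule lborel_pair.Fubini') measurable
  also have "ennreal (1 / e) * \<dots> = (\<integral>\<^sup>+s. ennreal (1 / e) * (\<integral>\<^sup>+y. f s * ennreal (passage_prob (t - s) y) * indicator {0<..<t} s * indicator {b..<b + e} y \<partial>lborel) \<partial>lborel)"
    by (rule nn_integral_cmult[symmetric]) measurable
  also have "\<dots> = (\<integral>\<^sup>+s. (\<integral>\<^sup>+r. f s * level_quotient b e (r - s) * indicator {0<..<r} s * indicator {0<..<t} r \<partial>lborel) \<partial>lborel)"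
  proof (rule nn_integral_cong)
    fix s
    show "ennreal (1 / e) * (\<integral>\<^sup>+y. f s * ennreal (passage_prob (t - s) y) * indicator {0<..<t} s * indicator {b..<b + e} y \<partial>lborel) =
       (\<integral>\<^sup>+r. f s * level_quotient b e (r - s) * indicator {0<..<r} s * indicator {0<..<t} r \<partial>lborel)"
    proof (cases "0 < s \<and> s < t")
      case True
      have "ennreal (1 / e) * (\<integral>\<^sup>+y. f s * ennreal (passage_prob (t - s) y) * indicator {0<..<t} s * indicator {b..<b + e} y \<partial>lborel)
        = ennreal (1 / e) * (\<integral>\<^sup>+y. f s * (ennreal (passage_prob (t - s) y) * indicator {b..<b + e} y) \<partial>lborel)"
        using True by (simp add: mult.assoc)
      also have "\<dots> = f s * (ennreal (1 / e) * (\<integral>\<^sup>+y. ennreal (passage_prob (t - s) y) * indicator {b..<b + e} y \<partial>lborel))"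
        by (subst nn_integral_cmult) (simp_all add: mult_ac)
      also have "\<dots> = (\<integral>\<^sup>+r. f s * (level_quotient b e (r - s) * indicator {0<..<t} r) \<partial>lborel)"
        using True by (subst inner) (auto simp: nn_integral_cmult)
      also have "\<dots> = (\<integral>\<^sup>+r. f s * level_quotient b e (r - s) * indicator {0<..<r} s * indicator {0<..<t} r \<partial>lborel)"
        using True by (intro nn_integral_cong) (auto simp: indicator_def W0)
      finally show ?thesis .
    next
      case False
      have z: "f s * level_quotient b e (r - s) * indicator {0<..<r} s * indicator {0<..<t} r = 0" for r
        using False by (auto simp: indicator_def)
      have "(\<integral>\<^sup>+r. f s * level_quotient b e (r - s) * indicator {0<..<r} s * indicator {0<..<t} r \<partial>lborel) = 0" unfolding z by simp
      moreover have "indicator {0<..<t} s = (0::ennreal)" using False by (auto simp: indicator_def)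
      ultimately show ?thesis by simp
    qed
  qed
  also have "\<dots> = (\<integral>\<^sup>+r. (\<integral>\<^sup>+s. f s * level_quotient b e (r - s) * indicator {0<..<r} s * indicator {0<..<t} r \<partial>lborel) \<partial>lborel)"
    by (rule lborel_pair.Fubini'[symmetric]) measurable
  also have "\<dots> = (\<integral>\<^sup>+r. (\<integral>\<^sup>+s. f s * level_quotient b e (r - s) * indicator {0<..<r} s \<partial>lborel) * indicator {0<..<t} r \<partial>lborel)"
    by (intro nn_integral_cong nn_integral_multc) measurable
  finally show "(\<integral>\<^sup>+s. level_quotient (a + b) e s * indicator {0<..<t} s \<partial>lborel) =
      (\<integral>\<^sup>+r. (\<integral>\<^sup>+s. f s * level_quotient b e (r - s) * indicator {0<..<r} s \<partial>lborel) * indicator {0<..<t} r \<partial>lborel)" .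
qed

text \<open>This is uniform integrability in \<open>e\<close>: the last integral does not depend on \<open>e\<close> and tends
  to \<open>0\<close> as \<open>K\<close> grows.\<close>

lemma level_quotient_truncation:
  assumes T: "0 < T" and a: "0 \<le> a" and b: "0 \<le> b" and e: "0 < e" and t: "0 < t" "t \<le> T"
    and f [measurable]: "f \<in> borel_measurable borel"
    and Gf: "\<And>s. 0 \<le> s \<Longrightarrow> s \<le> T \<Longrightarrow> ennreal (passage_prob s a) = (\<integral>\<^sup>+r. f r * indicator {0<..<s} r \<partial>lborel)"
  shows "(\<integral>\<^sup>+r. level_quotient (a + b) e r * indicator {0<..<t} r \<partial>lborel) \<le>
    (\<integral>\<^sup>+r. min (level_quotient (a + b) e r) K * indicator {0<..<t} r \<partial>lborel) + (\<integral>\<^sup>+s. (f s - K) * indicator {0<..<T} s \<partial>lborel)"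
proof -
  have ab: "0 \<le> a + b" using a b by simp
  have Wm [measurable]: "level_quotient b e \<in> borel_measurable borel" "level_quotient (a + b) e \<in> borel_measurable borel"
    by (rule level_quotient_measurable[OF b e], rule level_quotient_measurable[OF ab e])
  have W0: "level_quotient b e v = 0" if "v \<le> 0" for v using that by (simp add: level_quotient_def)
  \<comment> \<open>The density \<open>f\<close> is split at height \<open>K\<close>. The lower
    part, convolved with a kernel of mass at most 1, contributes at most \<open>K\<close>;
    \<open>R\<close> is the contribution of the excess, so the quotient exceeds \<open>K\<close> by
    at most \<open>R\<close>.\<close>
  define R where "R r = (\<integral>\<^sup>+s. (f s - K) * level_quotient b e (r - s) * indicator {0<..<r} s \<partial>lborel)" for r
  have Rm [measurable]: "R \<in> borel_measurable borel" unfolding R_def by measurable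
  have mass: "(\<integral>\<^sup>+s. level_quotient b e (r - s) * indicator {0<..<r} s \<partial>lborel) \<le> 1" if r: "0 < r" for r
  proof -
    have "(\<integral>\<^sup>+s. level_quotient b e (r - s) * indicator {0<..<r} s \<partial>lborel) = (\<integral>\<^sup>+s. level_quotient b e (r - s) * indicator {0<..<r} (r - s) \<partial>lborel)"
      by (intro nn_integral_cong) (auto simp: indicator_def)
    also have "\<dots> = (\<integral>\<^sup>+v. level_quotient b e v * indicator {0<..<r} v \<partial>lborel)"
      using nn_integral_reflect[of "\<lambda>v. level_quotient b e v * indicator {0<..<r} v" r] by simp
    also have "\<dots> \<le> ennreal (passage_prob r b)" by (rule level_quotient_integral_bounds(1)[OF r b e])
    also have "\<dots> \<le> 1" using passage_prob_bounds(2) by (metis ennreal_leI ennreal_1)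
    finally show ?thesis .
  qed
  have conv: "AE r in lborel. 0 < r \<and> r < T \<longrightarrow> level_quotient (a + b) e r = (\<integral>\<^sup>+s. f s * level_quotient b e (r - s) * indicator {0<..<r} s \<partial>lborel)"
    by (rule level_quotient_convolution[OF T a b e f Gf])
  have "AE r in lborel. level_quotient (a + b) e r * indicator {0<..<t} r \<le> min (level_quotient (a + b) e r) K * indicator {0<..<t} r + R r * indicator {0<..<t} r"
    using conv
  proof eventually_elim
    case (elim r)
    show ?case
    proof (cases "0 < r \<and> r < t")
      case True
      then have "level_quotient (a + b) e r = (\<integral>\<^sup>+s. f s * level_quotient b e (r - s) * indicator {0<..<r} s \<partial>lborel)" using elim t by simp
      also have "\<dots> \<le> (\<integral>\<^sup>+s. K * (level_quotient b e (r - s) * indicator {0<..<r} s) + (f s - K) * level_quotient b e (r - s) * indicator {0<..<r} s \<partial>lborel)"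
      proof (rule nn_integral_mono)
        fix s
        have "f s \<le> K + (f s - K)"
          by (cases "K \<le> f s") (auto simp: add_diff_inverse_ennreal intro: add_increasing2)
        then have "f s * (level_quotient b e (r - s) * indicator {0<..<r} s) \<le> (K + (f s - K)) * (level_quotient b e (r - s) * indicator {0<..<r} s)"
          by (rule mult_right_mono) simp
        then show "f s * level_quotient b e (r - s) * indicator {0<..<r} s \<le> K * (level_quotient b e (r - s) * indicator {0<..<r} s) + (f s - K) * level_quotient b e (r - s) * indicator {0<..<r} s"
          by (simp add: distrib_right mult.assoc)
      qed
      also have "\<dots> = (\<integral>\<^sup>+s. K * (level_quotient b e (r - s) * indicator {0<..<r} s) \<partial>lborel) + R r"
        unfolding R_def by (rule nn_integral_add) measurable
      also have "(\<integral>\<^sup>+s. K * (level_quotient b e (r - s) * indicator {0<..<r} s) \<partial>lborel) = K * (\<integral>\<^sup>+s. level_quotient b e (r - s) * indicator {0<..<r} s \<partial>lborel)"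
        by (rule nn_integral_cmult) measurable
      also have "\<dots> + R r \<le> K * 1 + R r" using mass True by (intro add_right_mono mult_left_mono) auto
      finally have "level_quotient (a + b) e r \<le> K + R r" by simp
      then have "level_quotient (a + b) e r \<le> min (level_quotient (a + b) e r) K + R r"
        by (cases "level_quotient (a + b) e r \<le> K") (auto simp: min_def add_increasing2)
      then show ?thesis using True by simp
    next
      case False
      then have "indicator {0<..<t} r = (0::ennreal)" by (auto simp: indicator_def)
      then show ?thesis by simp
    qed
  qed
  then have "(\<integral>\<^sup>+r. level_quotient (a + b) e r * indicator {0<..<t} r \<partial>lborel) \<le>
     (\<integral>\<^sup>+r. min (level_quotient (a + b) e r) K * indicator {0<..<t} r + R r * indicator {0<..<t} r \<partial>lborel)"
    by (rule nn_integral_mono_AE)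
  also have "\<dots> = (\<integral>\<^sup>+r. min (level_quotient (a + b) e r) K * indicator {0<..<t} r \<partial>lborel) + (\<integral>\<^sup>+r. R r * indicator {0<..<t} r \<partial>lborel)"
    by (rule nn_integral_add) measurable
  also have "(\<integral>\<^sup>+r. R r * indicator {0<..<t} r \<partial>lborel) \<le> (\<integral>\<^sup>+s. (f s - K) * indicator {0<..<T} s \<partial>lborel)"
  proof -
    have "(\<integral>\<^sup>+r. R r * indicator {0<..<t} r \<partial>lborel) = (\<integral>\<^sup>+r. (\<integral>\<^sup>+s. (f s - K) * level_quotient b e (r - s) * indicator {0<..<r} s * indicator {0<..<t} r \<partial>lborel) \<partial>lborel)"
      unfolding R_def by (intro nn_integral_cong nn_integral_multc[symmetric]) measurable
    also have "\<dots> = (\<integral>\<^sup>+s. (\<integral>\<^sup>+r. (f s - K) * level_quotient b e (r - s) * indicator {0<..<r} s * indicator {0<..<t} r \<partial>lborel) \<partial>lborel)"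
      by (rule lborel_pair.Fubini') measurable
    also have "\<dots> \<le> (\<integral>\<^sup>+s. (f s - K) * indicator {0<..<T} s \<partial>lborel)"
    proof (rule nn_integral_mono)
      fix s
      show "(\<integral>\<^sup>+r. (f s - K) * level_quotient b e (r - s) * indicator {0<..<r} s * indicator {0<..<t} r \<partial>lborel) \<le> (f s - K) * indicator {0<..<T} s"
      proof (cases "0 < s \<and> s < t")
        case True
        have "(\<integral>\<^sup>+r. (f s - K) * level_quotient b e (r - s) * indicator {0<..<r} s * indicator {0<..<t} r \<partial>lborel) \<le>
            (\<integral>\<^sup>+r. (f s - K) * (level_quotient b e (r - s) * indicator {0<..<t} (r - s)) \<partial>lborel)"
          using True W0 by (intro nn_integral_mono) (auto simp: indicator_def)
        also have "\<dots> = (f s - K) * (\<integral>\<^sup>+r. level_quotient b e (r - s) * indicator {0<..<t} (r - s) \<partial>lborel)"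
          by (rule nn_integral_cmult) measurable
        also have "(\<integral>\<^sup>+r. level_quotient b e (r - s) * indicator {0<..<t} (r - s) \<partial>lborel) = (\<integral>\<^sup>+v. level_quotient b e v * indicator {0<..<t} v \<partial>lborel)"
          using nn_integral_real_affine[of "\<lambda>v. level_quotient b e v * indicator {0<..<t} v" 1 "-s"] by simp
        also have "(f s - K) * \<dots> \<le> (f s - K) * 1"
          using level_quotient_integral_bounds(1)[OF t(1) b e] passage_prob_bounds(2)[of t b]
          by (intro mult_left_mono) (auto intro: order_trans simp: ennreal_leI)
        finally show ?thesis using True t by simp
      next
        case False
        have z: "(f s - K) * level_quotient b e (r - s) * indicator {0<..<r} s * indicator {0<..<t} r = 0" for r
          using False by (auto simp: indicator_def)
        show ?thesis unfolding z by simp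
      qed
    qed
    finally show ?thesis .
  qed
  finally show ?thesis by (simp add: add_left_mono)
qed

text \<open>On the window above \<open>u\<close> the value of \<open>X s\<close> is between
  \<open>u\<close> and \<open>u + e n\<close>, so the quotient is squeezed between these two
  multiples of the difference quotient of the distribution function, up to the factor
  \<open>1 / s\<close>. All windows lie to the right of \<open>u\<close>, hence the right-hand
  derivative.\<close>

lemma level_quotient_tendsto:
  assumes s: "0 < s" and u: "0 \<le> u"
    and D: "(cdf (distr M borel (X s)) has_real_derivative q u s) (at_right u)"
  shows "(\<lambda>n. level_quotient u (1 / Suc n) s) \<longlonglongrightarrow> ennreal (u * q u s / s)"
proof -
  define e where "e n = 1 / real (Suc n)" for n
  have e: "0 < e n" for n by (simp add: e_def)
  have e0: "e \<longlonglongrightarrow> 0" unfolding e_def using LIMSEQ_Suc[OF lim_const_over_n[of 1]] by simp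
  have [measurable]: "X s \<in> borel_measurable M" using s by (intro rv) simp
  let ?F = "cdf (distr M borel (X s))"
  let ?P = "\<lambda>n. prob {\<omega> \<in> space M. X s \<omega> \<in> {u<..u + e n}}"
  have cdf: "?F x = prob {\<omega> \<in> space M. X s \<omega> \<le> x}" for x
    unfolding cdf_def by (subst measure_distr) (auto intro!: arg_cong[where f=prob])
  have P: "?F (u + e n) - ?F u = ?P n" for n
  proof -
    have "{\<omega> \<in> space M. X s \<omega> \<in> {u<..u + e n}} = {\<omega> \<in> space M. X s \<omega> \<le> u + e n} - {\<omega> \<in> space M. X s \<omega> \<le> u}" by auto
    moreover have "prob ({\<omega> \<in> space M. X s \<omega> \<le> u + e n} - {\<omega> \<in> space M. X s \<omega> \<le> u}) = ?F (u + e n) - ?F u"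
      unfolding cdf using e[of n] by (intro finite_measure_Diff) auto
    ultimately show ?thesis by simp
  qed
  have "((\<lambda>y. (?F y - ?F u) / (y - u)) \<longlongrightarrow> q u s) (at_right u)"
    using D by (simp add: has_field_derivative_iff)
  moreover have "filterlim (\<lambda>n. u + e n) (at_right u) sequentially"
  proof -
    have "e n \<noteq> 0" for n using e[of n] by simp
    moreover have "(\<lambda>n. u + e n) \<longlonglongrightarrow> u" using tendsto_add[OF tendsto_const e0, of u] by simp
    ultimately show ?thesis unfolding filterlim_at using e by auto
  qed
  ultimately have "(\<lambda>n. (?F (u + e n) - ?F u) / (u + e n - u)) \<longlonglongrightarrow> q u s"
    by (rule filterlim_compose)
  then have lim: "(\<lambda>n. ?P n / e n) \<longlonglongrightarrow> q u s" by (simp add: P)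
  have "(\<lambda>n. (truncated_mean (u + e n) s - truncated_mean u s) / (e n * s)) \<longlonglongrightarrow> u * q u s / s"
  proof (rule tendsto_sandwich)
    show "(\<lambda>n. u * (?P n / e n) / s) \<longlonglongrightarrow> u * q u s / s" using s by (intro tendsto_intros lim) auto
    show "(\<lambda>n. (u + e n) * (?P n / e n) / s) \<longlonglongrightarrow> u * q u s / s"
    proof -
      have "(\<lambda>n. (u + e n) * (?P n / e n) / s) \<longlonglongrightarrow> (u + 0) * q u s / s"
        using s by (intro tendsto_intros lim e0) auto
      then show ?thesis by simp
    qed
    show "\<forall>\<^sub>F n in sequentially. u * (?P n / e n) / s \<le> (truncated_mean (u + e n) s - truncated_mean u s) / (e n * s)"
    proof (rule always_eventually, rule allI)
      fix n
      have "u * ?P n / (e n * s) \<le> (truncated_mean (u + e n) s - truncated_mean u s) / (e n * s)"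
        using truncated_mean_diff_bounds(1)[of s u "e n"] s u e[of n] by (intro divide_right_mono) auto
      then show "u * (?P n / e n) / s \<le> (truncated_mean (u + e n) s - truncated_mean u s) / (e n * s)" by (simp add: field_simps)
    qed
    show "\<forall>\<^sub>F n in sequentially. (truncated_mean (u + e n) s - truncated_mean u s) / (e n * s) \<le> (u + e n) * (?P n / e n) / s"
    proof (rule always_eventually, rule allI)
      fix n
      have "(truncated_mean (u + e n) s - truncated_mean u s) / (e n * s) \<le> (u + e n) * ?P n / (e n * s)"
        using truncated_mean_diff_bounds(2)[of s u "e n"] s u e[of n] by (intro divide_right_mono) auto
      also have "\<dots> = (u + e n) * (?P n / e n) / s" by simp
      finally show "(truncated_mean (u + e n) s - truncated_mean u s) / (e n * s) \<le> (u + e n) * (?P n / e n) / s" .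
    qed
  qed
  then have "(\<lambda>n. ennreal ((truncated_mean (u + e n) s - truncated_mean u s) / (e n * s))) \<longlonglongrightarrow> ennreal (u * q u s / s)" by (rule tendsto_ennrealI)
  then show ?thesis using s by (simp add: level_quotient_def e_def)
qed

text \<open>Fatou's lemma bounds the integral of the limit by the passage probability. Conversely,
  quotients cut at height \<open>K\<close> converge under a constant bound, and what the cut removes
  is at most \<open>\<eta> K\<close>, uniformly in \<open>n\<close>; then \<open>K\<close> tends to
  infinity.\<close>

theorem kendall_at:
  assumes T: "0 < T" and u: "0 < u"
    and D: "AE s in lborel. 0 < s \<and> s < T \<longrightarrow> (cdf (distr M borel (X s)) has_real_derivative q u s) (at_right u)"
    and t: "0 \<le> t" "t \<le> T"
  shows "ennreal (passage_prob t u) = (\<integral>\<^sup>+s. kendall_density u s * indicator {0<..<t} s \<partial>lborel)"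
proof (cases "t = 0")
  case True then show ?thesis by (simp add: passage_prob_nonpos_time)
next
  case False
  then have t0: "0 < t" using t by simp
  \<comment> \<open>Any unexceptional level below \<open>u\<close> will do: its passage time has an
    integrable density, from which the passage over \<open>u\<close> is restarted.\<close>
  obtain a where a: "0 < a" "a < u" "0 < a \<longrightarrow> (\<forall>t>0. ennreal (passage_prob t a) = (\<integral>\<^sup>+s. kendall_density a s * indicator {0<..<t} s \<partial>lborel))"
    using AE_exists_in_interval[OF kendall_AE u] by blast
  define f where "f = kendall_density a"
  have f [measurable]: "f \<in> borel_measurable borel" unfolding f_def by measurable
  have Gf: "ennreal (passage_prob s a) = (\<integral>\<^sup>+r. f r * indicator {0<..<s} r \<partial>lborel)" if "0 \<le> s" "s \<le> T" for s
    using a that by (cases "s = 0") (auto simp: f_def passage_prob_nonpos_time)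
  define b where "b = u - a"
  have b: "0 \<le> b" "a + b = u" using a by (simp_all add: b_def)
  define e where "e n = 1 / real (Suc n)" for n
  have e: "0 < e n" for n by (simp add: e_def)
  have e0: "e \<longlonglongrightarrow> 0" unfolding e_def using LIMSEQ_Suc[OF lim_const_over_n[of 1]] by simp
  have [measurable]: "level_quotient u (e n) \<in> borel_measurable borel" for n using u e by (intro level_quotient_measurable) auto
  have kdm [measurable]: "kendall_density u \<in> borel_measurable borel" by measurable
  have conv: "AE s in lborel. 0 < s \<and> s < T \<longrightarrow> (\<lambda>n. level_quotient u (e n) s) \<longlonglongrightarrow> kendall_density u s"
    using D
  proof eventually_elim
    case (elim s)
    then show ?case using level_quotient_tendsto[of s u] u by (auto simp: kendall_density_def e_def)
  qed
  have passage_prob_lim: "(\<lambda>n. ennreal (passage_prob t (u + e n))) \<longlonglongrightarrow> ennreal (passage_prob t u)"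
  proof (intro tendsto_ennrealI passage_prob_tendsto_level)
    show "(\<lambda>n. u + e n) \<longlonglongrightarrow> u" using tendsto_add[OF tendsto_const e0, of u] by simp
  qed (use e in \<open>simp add: less_imp_le\<close>)
  \<comment> \<open>The limit of the integrals follows from right-continuity of the passage
    probability in the level; it remains to identify it with the integral of the pointwise
    limit.\<close>
  have level_quotient_lim: "(\<lambda>n. \<integral>\<^sup>+s. level_quotient u (e n) s * indicator {0<..<t} s \<partial>lborel) \<longlonglongrightarrow> ennreal (passage_prob t u)"
    by (rule tendsto_sandwich[OF _ _ passage_prob_lim tendsto_const])
      (use level_quotient_integral_bounds[OF t0 _ e] u in \<open>auto intro!: always_eventually\<close>)
  show ?thesis
  proof (rule antisym)
    have "(\<integral>\<^sup>+s. kendall_density u s * indicator {0<..<t} s \<partial>lborel) \<le> (\<integral>\<^sup>+s. liminf (\<lambda>n. level_quotient u (e n) s * indicator {0<..<t} s) \<partial>lborel)"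
    proof (rule nn_integral_mono_AE)
      show "AE s in lborel. kendall_density u s * indicator {0<..<t} s \<le> liminf (\<lambda>n. level_quotient u (e n) s * indicator {0<..<t} s)"
        using conv
      proof eventually_elim
        case (elim s)
        show ?case
        proof (cases "s \<in> {0<..<t}")
          case True
          then have "liminf (\<lambda>n. level_quotient u (e n) s) = kendall_density u s" using elim t by (intro lim_imp_Liminf) auto
          then show ?thesis using True by simp
        qed simp
      qed
    qed
    also have "\<dots> \<le> liminf (\<lambda>n. \<integral>\<^sup>+s. level_quotient u (e n) s * indicator {0<..<t} s \<partial>lborel)"
      by (rule nn_integral_liminf) measurable
    also have "\<dots> = ennreal (passage_prob t u)" using level_quotient_lim by (intro lim_imp_Liminf) auto
    finally show "(\<integral>\<^sup>+s. kendall_density u s * indicator {0<..<t} s \<partial>lborel) \<le> ennreal (passage_prob t u)" .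
  next
    define \<eta> where "\<eta> K = (\<integral>\<^sup>+s. (f s - of_nat K) * indicator {0<..<T} s \<partial>lborel)" for K :: nat
    have fin: "(\<integral>\<^sup>+s. f s * indicator {0<..<T} s \<partial>lborel) < \<infinity>"
      using Gf[of T] T by (metis ennreal_less_top infinity_ennreal_def less_imp_le order_refl)
    have eta0: "\<eta> \<longlonglongrightarrow> (\<integral>\<^sup>+s. 0 \<partial>(lborel :: real measure))"
      unfolding \<eta>_def
    proof (rule nn_integral_dominated_convergence[where w="\<lambda>s. f s * indicator {0<..<T} s"])
      show "AE s in lborel. (f s - of_nat K) * indicator {0<..<T} s \<le> f s * indicator {0<..<T} s" for K
        by (intro AE_I2 mult_right_mono) (auto simp: diff_le_self_ennreal)
      have "AE s in lborel. f s * indicator {0<..<T} s \<noteq> \<infinity>" using fin by (intro nn_integral_PInf_AE) auto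
      then show "AE s in lborel. (\<lambda>K. (f s - of_nat K) * indicator {0<..<T} s) \<longlonglongrightarrow> 0"
      proof eventually_elim
        case (elim s)
        show ?case
        proof (cases "s \<in> {0<..<T}")
          case True
          then have fs: "f s < \<infinity>" using elim by (simp add: less_top)
          then obtain N :: nat where N: "f s < of_nat N" using ennreal_Ex_less_of_nat by (metis infinity_ennreal_def)
          have "\<forall>\<^sub>F K in sequentially. (f s - of_nat K) * indicator {0<..<T} s = 0"
            using eventually_ge_at_top[of N]
          proof eventually_elim
            case (elim K)
            have "f s \<le> of_nat K" using N elim by (meson less_imp_le of_nat_mono order_trans)
            then have "f s - of_nat K = 0" using fs by (simp add: diff_eq_0_iff_ennreal)
            then show ?case by simp
          qed
          then show ?thesis by (rule tendsto_eventually)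
        qed simp
      qed
    qed (use fin in simp_all)
    have bound: "ennreal (passage_prob t u) \<le> (\<integral>\<^sup>+s. kendall_density u s * indicator {0<..<t} s \<partial>lborel) + \<eta> K" for K
    proof -
      have min_lim: "(\<lambda>n. \<integral>\<^sup>+s. min (level_quotient u (e n) s) (of_nat K) * indicator {0<..<t} s \<partial>lborel) \<longlonglongrightarrow>
         (\<integral>\<^sup>+s. min (kendall_density u s) (of_nat K) * indicator {0<..<t} s \<partial>lborel)"
      proof (rule nn_integral_dominated_convergence[where w="\<lambda>s. of_nat K * indicator {0<..<t} s"])
        show "AE s in lborel. min (level_quotient u (e n) s) (of_nat K) * indicator {0<..<t} s \<le> of_nat K * indicator {0<..<t} s" for n
          by (intro AE_I2 mult_right_mono) auto
        show "(\<integral>\<^sup>+s. of_nat K * indicator {0<..<t} s \<partial>lborel) < \<infinity>"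
          using t0 by (simp add: nn_integral_cmult ennreal_mult_less_top ennreal_of_nat_eq_real_of_nat)
        show "AE s in lborel. (\<lambda>n. min (level_quotient u (e n) s) (of_nat K) * indicator {0<..<t} s) \<longlonglongrightarrow> min (kendall_density u s) (of_nat K) * indicator {0<..<t} s"
          using conv
        proof eventually_elim
          case (elim s)
          show ?case
          proof (cases "s \<in> {0<..<t}")
            case True
            then have "(\<lambda>n. min (level_quotient u (e n) s) (of_nat K)) \<longlonglongrightarrow> min (kendall_density u s) (of_nat K)"
              using elim t by (intro tendsto_min tendsto_const) auto
            then show ?thesis using True by simp
          qed simp
        qed
      qed simp_all
      have "(\<lambda>n. (\<integral>\<^sup>+s. min (level_quotient u (e n) s) (of_nat K) * indicator {0<..<t} s \<partial>lborel) + \<eta> K) \<longlonglongrightarrow>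
         (\<integral>\<^sup>+s. min (kendall_density u s) (of_nat K) * indicator {0<..<t} s \<partial>lborel) + \<eta> K"
        by (intro tendsto_add min_lim tendsto_const)
      from LIMSEQ_le[OF level_quotient_lim this]
      have "ennreal (passage_prob t u) \<le> (\<integral>\<^sup>+s. min (kendall_density u s) (of_nat K) * indicator {0<..<t} s \<partial>lborel) + \<eta> K"
        using level_quotient_truncation[OF T less_imp_le[OF a(1)] b(1) e t0 t(2) f Gf, of _ "of_nat K"]
        by (auto simp: b(2) \<eta>_def)
      also have "\<dots> \<le> (\<integral>\<^sup>+s. kendall_density u s * indicator {0<..<t} s \<partial>lborel) + \<eta> K"
        by (intro add_right_mono nn_integral_mono mult_right_mono) auto
      finally show ?thesis .
    qed
    have "(\<lambda>K. (\<integral>\<^sup>+s. kendall_density u s * indicator {0<..<t} s \<partial>lborel) + \<eta> K) \<longlonglongrightarrow>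
        (\<integral>\<^sup>+s. kendall_density u s * indicator {0<..<t} s \<partial>lborel) + (\<integral>\<^sup>+s. 0 \<partial>(lborel :: real measure))"
      by (intro tendsto_add tendsto_const eta0)
    then have "ennreal (passage_prob t u) \<le> (\<integral>\<^sup>+s. kendall_density u s * indicator {0<..<t} s \<partial>lborel) + (\<integral>\<^sup>+s. 0 \<partial>(lborel :: real measure))"
      by (rule LIMSEQ_le_const) (use bound in blast)
    then show "ennreal (passage_prob t u) \<le> (\<integral>\<^sup>+s. kendall_density u s * indicator {0<..<t} s \<partial>lborel)" by simp
  qed
qed

end

section \<open>Change of drift\<close>

context regular_levy_density
begin

text \<open>\<open>passage_position\<close> compares two measures on half-lines; as finite measures
  with equal distribution functions they coincide, which allows arbitrary test functions.\<close>

lemma passage_law: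
  fixes f :: "real \<Rightarrow> ennreal" and \<phi> :: "real \<Rightarrow> ennreal"
  assumes t: "0 < t" and f [measurable]: "f \<in> borel_measurable borel" and a: "0 \<le> a"
    and Gf: "\<And>s. 0 \<le> s \<Longrightarrow> s \<le> t \<Longrightarrow> ennreal (passage_prob s a) = (\<integral>\<^sup>+r. f r * indicator {0<..<s} r \<partial>lborel)"
    and \<phi> [measurable]: "\<phi> \<in> borel_measurable borel"
  shows "(\<integral>\<^sup>+\<omega>. indicator (passing t a) \<omega> * \<phi> (X t \<omega>) \<partial>M) =
    (\<integral>\<^sup>+x. (\<integral>\<^sup>+s. f s * ennreal (q (x - a) (t - s)) * indicator {0<..<t} s \<partial>lborel) * \<phi> x \<partial>lborel)"
proof -
  define \<rho> where "\<rho> x = (\<integral>\<^sup>+s. f s * ennreal (q (x - a) (t - s)) * indicator {0<..<t} s \<partial>lborel)" for x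
  have qm [measurable]: "(\<lambda>p. q (fst p - a) (t - snd p)) \<in> borel_measurable (borel \<Otimes>\<^sub>M borel)"
    "(\<lambda>p. q (snd p - a) (t - fst p)) \<in> borel_measurable (borel \<Otimes>\<^sub>M borel)"
    using q_measurable by measurable
  have [measurable]: "\<rho> \<in> borel_measurable borel" unfolding \<rho>_def by measurable
  have [measurable]: "X t \<in> borel_measurable M" using t by (intro rv) simp
  define N1 where "N1 = distr (density M (indicator (passing t a))) borel (X t)"
  define N2 where "N2 = density lborel \<rho>"
  have em1: "emeasure N1 A = emeasure M (passing t a \<inter> {\<omega> \<in> space M. X t \<omega> \<in> A})" if [measurable]: "A \<in> sets borel" for A
  proof -
    have "emeasure N1 A = emeasure (density M (indicator (passing t a))) {\<omega> \<in> space M. X t \<omega> \<in> A}"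
      unfolding N1_def by (subst emeasure_distr) (auto simp: vimage_def Int_def conj_commute)
    also have "\<dots> = (\<integral>\<^sup>+\<omega>. indicator (passing t a) \<omega> * indicator {\<omega> \<in> space M. X t \<omega> \<in> A} \<omega> \<partial>M)"
      by (subst emeasure_density) auto
    also have "\<dots> = (\<integral>\<^sup>+\<omega>. indicator (passing t a \<inter> {\<omega> \<in> space M. X t \<omega> \<in> A}) \<omega> \<partial>M)"
      by (simp add: indicator_inter_arith)
    also have "\<dots> = emeasure M (passing t a \<inter> {\<omega> \<in> space M. X t \<omega> \<in> A})"
      by (rule nn_integral_indicator) measurable
    finally show ?thesis .
  qed
  have atMost: "emeasure N1 {..x} = emeasure N2 {..x}" for x
  proof -
    have "emeasure N1 {..x} = (\<integral>\<^sup>+s. f s * (\<integral>\<^sup>+z. ennreal (q z (t - s)) * indicator {..x - a} z \<partial>lborel) * indicator {0<..<t} s \<partial>lborel)"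
      using passage_position[OF t f a Gf, of "x - a"] by (simp add: em1)
    also have "\<dots> = (\<integral>\<^sup>+s. (\<integral>\<^sup>+z. f s * ennreal (q (z - a) (t - s)) * indicator {0<..<t} s * indicator {..x} z \<partial>lborel) \<partial>lborel)"
    proof (rule nn_integral_cong)
      fix s
      have "(\<integral>\<^sup>+z. ennreal (q z (t - s)) * indicator {..x - a} z \<partial>lborel) = (\<integral>\<^sup>+z. ennreal (q (z - a) (t - s)) * indicator {..x - a} (z - a) \<partial>lborel)"
        using nn_integral_real_affine[of "\<lambda>z. ennreal (q z (t - s)) * indicator {..x - a} z" 1 "-a"] by simp
      also have "\<dots> = (\<integral>\<^sup>+z. ennreal (q (z - a) (t - s)) * indicator {..x} z \<partial>lborel)"
        by (intro nn_integral_cong) (auto simp: indicator_def)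
      finally have "f s * (\<integral>\<^sup>+z. ennreal (q z (t - s)) * indicator {..x - a} z \<partial>lborel) * indicator {0<..<t} s =
        (f s * indicator {0<..<t} s) * (\<integral>\<^sup>+z. ennreal (q (z - a) (t - s)) * indicator {..x} z \<partial>lborel)" by (simp add: mult_ac)
      also have "\<dots> = (\<integral>\<^sup>+z. (f s * indicator {0<..<t} s) * (ennreal (q (z - a) (t - s)) * indicator {..x} z) \<partial>lborel)"
        by (rule nn_integral_cmult[symmetric]) measurable
      finally show "f s * (\<integral>\<^sup>+z. ennreal (q z (t - s)) * indicator {..x - a} z \<partial>lborel) * indicator {0<..<t} s =
         (\<integral>\<^sup>+z. f s * ennreal (q (z - a) (t - s)) * indicator {0<..<t} s * indicator {..x} z \<partial>lborel)" by (simp add: mult_ac)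
    qed
    also have "\<dots> = (\<integral>\<^sup>+z. (\<integral>\<^sup>+s. f s * ennreal (q (z - a) (t - s)) * indicator {0<..<t} s * indicator {..x} z \<partial>lborel) \<partial>lborel)"
      by (rule lborel_pair.Fubini') measurable
    also have "\<dots> = (\<integral>\<^sup>+z. \<rho> z * indicator {..x} z \<partial>lborel)"
      unfolding \<rho>_def by (intro nn_integral_cong nn_integral_multc) measurable
    also have "\<dots> = emeasure N2 {..x}" unfolding N2_def by (subst emeasure_density) auto
    finally show ?thesis .
  qed
  have "N1 = N2"
  proof (rule cdf_unique')
    have "emeasure N1 UNIV \<le> 1" using em1[of UNIV] emeasure_le_1 by simp
    then show "finite_borel_measure N1"
      by (intro finite_borel_measure.intro finite_measureI finite_borel_measure_axioms.intro) (auto simp: N1_def top_unique)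
    \<comment> \<open>That the density \<rho> has finite integral is not visible from its formula;
      it is read off from increasing half-lines, where \<open>N2\<close> agrees with
      \<open>N1\<close>.\<close>
    have "emeasure N2 UNIV \<le> 1"
    proof -
      have "(\<Union>n::nat. {..real n}) = UNIV" using real_arch_simple by auto
      moreover have "emeasure N2 (\<Union>n::nat. {..real n}) = (SUP n. emeasure N2 {..real n})"
        by (intro SUP_emeasure_incseq[symmetric]) (auto simp: N2_def incseq_def)
      moreover have "(SUP n. emeasure N2 {..real n}) \<le> 1"
        using emeasure_le_1 by (intro SUP_least) (simp add: atMost[symmetric] em1)
      ultimately show ?thesis by simp
    qed
    then show "finite_borel_measure N2"
      by (intro finite_borel_measure.intro finite_measureI finite_borel_measure_axioms.intro) (auto simp: N2_def top_unique)
    show "cdf N1 = cdf N2" by (simp add: fun_eq_iff cdf_def measure_def atMost)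
  qed
  have "(\<integral>\<^sup>+\<omega>. indicator (passing t a) \<omega> * \<phi> (X t \<omega>) \<partial>M) = (\<integral>\<^sup>+x. \<phi> x \<partial>N1)"
    unfolding N1_def by (simp add: nn_integral_distr nn_integral_density)
  also have "\<dots> = (\<integral>\<^sup>+x. \<phi> x \<partial>N2)" unfolding \<open>N1 = N2\<close> ..
  also have "\<dots> = (\<integral>\<^sup>+x. \<rho> x * \<phi> x \<partial>lborel)" unfolding N2_def by (rule nn_integral_density) measurable
  finally show ?thesis unfolding \<rho>_def .
qed

text \<open>For \<open>d = c1 - c2\<close>, the expression compared with \<open>u\<close> is the
  original process minus the broken barrier at time \<open>T + s\<close>.\<close>

definition late_exceed :: "real \<Rightarrow> real \<Rightarrow> ereal \<Rightarrow> real \<Rightarrow> 'a set" where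
  "late_exceed T d r u = {\<omega> \<in> space M. \<exists>s. 0 \<le> s \<and> ereal s < r \<and> u < X (T + s) \<omega> + d * s}"

lemma prob_exceed_antimono: "z \<le> z' \<Longrightarrow> prob (exceed d r z') \<le> prob (exceed d r z)"
  by (intro finite_measure_mono exceed_event) (force simp: exceed_def)

lemma prob_exceed_measurable [measurable]: "(\<lambda>z. prob (exceed d r z)) \<in> borel_measurable borel"
proof -
  have "mono (\<lambda>z. - prob (exceed d r z))" by (intro monoI) (simp add: prob_exceed_antimono)
  then have "(\<lambda>z. - (- prob (exceed d r z))) \<in> borel_measurable borel"
    by (intro borel_measurable_uminus borel_measurable_mono)
  then show ?thesis by simp
qed

lemma late_exceed_eq:
  assumes T: "0 \<le> T"
  shows "late_exceed T d r u = {\<omega> \<in> space M. shifted T \<omega> \<in> exceed_paths d r (u - X T \<omega>)}"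
  unfolding late_exceed_def shifted_in_exceed_paths_iff[OF T] by (auto simp: algebra_simps)

text \<open>The path up to \<open>T\<close> and the increments after \<open>T\<close> are independent, so the future can be
  integrated out first.\<close>

lemma emeasure_late_not_early:
  assumes T: "0 \<le> T"
  shows "late_exceed T d r u - passing T u \<in> events"
    "emeasure M (late_exceed T d r u - passing T u) = (\<integral>\<^sup>+\<omega>. indicator (space M - passing T u) \<omega> * ennreal (prob (exceed d r (u - X T \<omega>))) \<partial>M)"
proof -
  let ?P = "\<Pi>\<^sub>M s\<in>{0..T}. (borel :: real measure)"
  \<comment> \<open>The event as a set of pairs of past and future, since their joint law is a
    product; the level left to climb couples the two through \<open>fst pw T\<close>. Rational times
    make the set measurable.\<close>
  define D where "D = {pw \<in> space (?P \<Otimes>\<^sub>M paths). fst pw \<notin> past_passing T T u \<and> (\<exists>v\<in>{v\<in>\<rat>. 0 \<le> v \<and> ereal v < r}. u - fst pw T < snd pw v + d * v)}"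
  have D: "D \<in> sets (?P \<Otimes>\<^sub>M paths)"
  proof -
    have cnt: "countable {v\<in>\<rat>. 0 \<le> v \<and> ereal v < r}" by (rule countable_subset[OF _ countable_rat]) auto
    have pm [measurable]: "past_passing T T u \<in> sets ?P" by (rule past_passing_measurable) simp
    have [measurable]: "(\<lambda>p. p T) \<in> borel_measurable ?P" using T by (intro measurable_component_singleton) auto
    have m: "(\<lambda>w. w v) \<in> borel_measurable paths" if "v \<in> {v\<in>\<rat>. 0 \<le> v \<and> ereal v < r}" for v
      using that by (intro measurable_component_singleton) auto
    have "{pw \<in> space (?P \<Otimes>\<^sub>M paths). u - fst pw T < snd pw v + d * v} \<in> sets (?P \<Otimes>\<^sub>M paths)" if "v \<in> {v\<in>\<rat>. 0 \<le> v \<and> ereal v < r}" for v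
    proof -
      note [measurable] = m[OF that]
      show ?thesis by measurable
    qed
    then have "(\<Union>v\<in>{v\<in>\<rat>. 0 \<le> v \<and> ereal v < r}. {pw \<in> space (?P \<Otimes>\<^sub>M paths). u - fst pw T < snd pw v + d * v}) \<in> sets (?P \<Otimes>\<^sub>M paths)"
      by (rule sets.countable_UN''[OF cnt])
    also have "(\<Union>v\<in>{v\<in>\<rat>. 0 \<le> v \<and> ereal v < r}. {pw \<in> space (?P \<Otimes>\<^sub>M paths). u - fst pw T < snd pw v + d * v}) =
        {pw \<in> space (?P \<Otimes>\<^sub>M paths). \<exists>v\<in>{v\<in>\<rat>. 0 \<le> v \<and> ereal v < r}. u - fst pw T < snd pw v + d * v}"
      by blast
    finally have "{pw \<in> space (?P \<Otimes>\<^sub>M paths). \<exists>v\<in>{v\<in>\<rat>. 0 \<le> v \<and> ereal v < r}. u - fst pw T < snd pw v + d * v} \<in> sets (?P \<Otimes>\<^sub>M paths)" .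
    moreover have "{pw \<in> space (?P \<Otimes>\<^sub>M paths). fst pw \<notin> past_passing T T u} \<in> sets (?P \<Otimes>\<^sub>M paths)" by measurable
    ultimately have "{pw \<in> space (?P \<Otimes>\<^sub>M paths). fst pw \<notin> past_passing T T u} \<inter> {pw \<in> space (?P \<Otimes>\<^sub>M paths). \<exists>v\<in>{v\<in>\<rat>. 0 \<le> v \<and> ereal v < r}. u - fst pw T < snd pw v + d * v} \<in> sets (?P \<Otimes>\<^sub>M paths)"
      by (rule sets.Int[rotated])
    also have "{pw \<in> space (?P \<Otimes>\<^sub>M paths). fst pw \<notin> past_passing T T u} \<inter> {pw \<in> space (?P \<Otimes>\<^sub>M paths). \<exists>v\<in>{v\<in>\<rat>. 0 \<le> v \<and> ereal v < r}. u - fst pw T < snd pw v + d * v} = D"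
      unfolding D_def by blast
    finally show ?thesis .
  qed
  have pT: "past T \<omega> T = X T \<omega>" for \<omega> using T by (simp add: past_def)
  have sp: "past T \<omega> \<in> space ?P" "shifted T \<omega> \<in> space paths" for \<omega>
    by (simp_all add: past_def shifted_def space_PiM)
  have pair: "(\<lambda>\<omega>. (past T \<omega>, shifted T \<omega>)) \<in> measurable M (?P \<Otimes>\<^sub>M paths)"
    using past_measurable shifted_measurable[OF T] by measurable
  have vim: "late_exceed T d r u - passing T u = (\<lambda>\<omega>. (past T \<omega>, shifted T \<omega>)) -` D \<inter> space M"
    unfolding late_exceed_eq[OF T] passing_eq_past[OF order_refl] D_def exceed_paths_def
    using sp by (auto simp: space_pair_measure pT)
  show "late_exceed T d r u - passing T u \<in> events" unfolding vim by (rule measurable_sets[OF pair D])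
  interpret S: prob_space "distr M paths (shifted T)" by (rule prob_space_distr[OF shifted_measurable[OF T]])
  have "emeasure M (late_exceed T d r u - passing T u) = emeasure (distr M (?P \<Otimes>\<^sub>M paths) (\<lambda>\<omega>. (past T \<omega>, shifted T \<omega>))) D"
    unfolding vim by (rule emeasure_distr[OF pair D, symmetric])
  also have "distr M (?P \<Otimes>\<^sub>M paths) (\<lambda>\<omega>. (past T \<omega>, shifted T \<omega>)) = distr M ?P (past T) \<Otimes>\<^sub>M distr M paths (shifted T)"
    using indep_past_shifted[OF T] unfolding indep_var_distribution_eq by simp
  also have "emeasure \<dots> D = (\<integral>\<^sup>+p. emeasure (distr M paths (shifted T)) (Pair p -` D) \<partial>distr M ?P (past T))"
  proof (rule S.emeasure_pair_measure_alt)
    have "sets (distr M ?P (past T) \<Otimes>\<^sub>M distr M paths (shifted T)) = sets (?P \<Otimes>\<^sub>M paths)"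
      by (intro sets_pair_measure_cong) auto
    then show "D \<in> sets (distr M ?P (past T) \<Otimes>\<^sub>M distr M paths (shifted T))" using D by simp
  qed
  also have "\<dots> = (\<integral>\<^sup>+\<omega>. emeasure (distr M paths (shifted T)) (Pair (past T \<omega>) -` D) \<partial>M)"
  proof (rule nn_integral_distr[OF past_measurable])
    have "sets (?P \<Otimes>\<^sub>M distr M paths (shifted T)) = sets (?P \<Otimes>\<^sub>M paths)"
      by (intro sets_pair_measure_cong) auto
    then have "(\<lambda>p. emeasure (distr M paths (shifted T)) (Pair p -` D)) \<in> borel_measurable ?P"
      using D by (intro S.measurable_emeasure_Pair) simp
    then show "(\<lambda>p. emeasure (distr M paths (shifted T)) (Pair p -` D)) \<in> borel_measurable (distr M ?P (past T))"
      by simp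
  qed
  also have "\<dots> = (\<integral>\<^sup>+\<omega>. indicator (space M - passing T u) \<omega> * ennreal (prob (exceed d r (u - X T \<omega>))) \<partial>M)"
  proof (rule nn_integral_cong)
    fix \<omega> assume w: "\<omega> \<in> space M"
    show "emeasure (distr M paths (shifted T)) (Pair (past T \<omega>) -` D) = indicator (space M - passing T u) \<omega> * ennreal (prob (exceed d r (u - X T \<omega>)))"
    proof (cases "\<omega> \<in> passing T u")
      case True
      then have "past T \<omega> \<in> past_passing T T u" unfolding passing_eq_past[OF order_refl] by simp
      then have "Pair (past T \<omega>) -` D = {}" unfolding D_def by auto
      then show ?thesis using True by simp
    next
      case False
      then have "past T \<omega> \<notin> past_passing T T u" using w unfolding passing_eq_past[OF order_refl] by simp
      then have "Pair (past T \<omega>) -` D = exceed_paths d r (u - X T \<omega>)"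
        unfolding D_def exceed_paths_def using sp(1)[of \<omega>] by (auto simp: space_pair_measure pT)
      then have "emeasure (distr M paths (shifted T)) (Pair (past T \<omega>) -` D) = emeasure (distr M paths path) (exceed_paths d r (u - X T \<omega>))"
        unfolding distr_shifted[OF T] by simp
      also have "\<dots> = emeasure M (exceed d r (u - X T \<omega>))"
        by (simp add: emeasure_distr exceed_eq_vimage)
      finally show ?thesis using False w by (simp add: emeasure_eq_measure)
    qed
  qed
  finally show "emeasure M (late_exceed T d r u - passing T u) = (\<integral>\<^sup>+\<omega>. indicator (space M - passing T u) \<omega> * ennreal (prob (exceed d r (u - X T \<omega>))) \<partial>M)" .
qed

text \<open>For \<open>z > 0\<close>, the density of \<open>u - X T\<close> on the event of passage
  before \<open>T\<close>: the passage happens at \<open>T - s\<close>, and in the remaining time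
  \<open>s\<close> the path moves from \<open>u\<close> to \<open>u - z\<close>.\<close>

definition late_density :: "real \<Rightarrow> real \<Rightarrow> real \<Rightarrow> ennreal" where
  "late_density T u z = (\<integral>\<^sup>+s. kendall_density u (T - s) * ennreal (q (- z) s) * indicator {0<..<T} s \<partial>lborel)"

lemma late_density_measurable [measurable]: "late_density T u \<in> borel_measurable borel"
proof -
  have [measurable]: "(\<lambda>p. q (- fst p) (snd p)) \<in> borel_measurable (borel \<Otimes>\<^sub>M borel)"
    using q_measurable by measurable
  have [measurable]: "kendall_density u \<in> borel_measurable borel" by measurable
  show ?thesis unfolding late_density_def by measurable
qed

text \<open>Both parts are the substitution \<open>x = u - z\<close>, in the law of
  \<open>X T\<close> and in \<open>passage_law\<close>. The second also replaces the passage time by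
  the time remaining after it.\<close>

lemma terminal_integrals:
  assumes T: "0 < T" and u: "0 < u"
    and D: "AE s in lborel. 0 < s \<and> s < T \<longrightarrow> (cdf (distr M borel (X s)) has_real_derivative q u s) (at_right u)"
    and Q [measurable]: "Q \<in> borel_measurable borel"
  shows "(\<integral>\<^sup>+\<omega>. Q (u - X T \<omega>) * indicator {..<u} (X T \<omega>) \<partial>M) =
      (\<integral>\<^sup>+z. Q z * ennreal (q (u - z) T) * indicator {0<..} z \<partial>lborel)"
    "(\<integral>\<^sup>+\<omega>. indicator (passing T u) \<omega> * (Q (u - X T \<omega>) * indicator {..<u} (X T \<omega>)) \<partial>M) =
      (\<integral>\<^sup>+z. Q z * late_density T u z * indicator {0<..} z \<partial>lborel)"
proof -
  define \<phi> where "\<phi> x = Q (u - x) * indicator {..<u} x" for x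
  have [measurable]: "\<phi> \<in> borel_measurable borel" unfolding \<phi>_def by measurable
  have \<phi>_refl: "\<phi> (u - z) = Q z * indicator {0<..} z" for z by (simp add: \<phi>_def indicator_def)
  have [measurable]: "(\<lambda>x. q x T) \<in> borel_measurable borel" using q_measurable by measurable
  have "(\<integral>\<^sup>+\<omega>. \<phi> (X T \<omega>) \<partial>M) = (\<integral>\<^sup>+x. ennreal (q x T) * \<phi> x \<partial>lborel)"
    by (rule distributed_nn_integral[OF density[OF T], symmetric]) simp
  also have "\<dots> = (\<integral>\<^sup>+z. ennreal (q (u - z) T) * \<phi> (u - z) \<partial>lborel)"
    by (rule nn_integral_reflect[symmetric]) measurable
  finally show "(\<integral>\<^sup>+\<omega>. Q (u - X T \<omega>) * indicator {..<u} (X T \<omega>) \<partial>M) =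
      (\<integral>\<^sup>+z. Q z * ennreal (q (u - z) T) * indicator {0<..} z \<partial>lborel)"
    unfolding \<phi>_refl by (simp add: \<phi>_def mult_ac)
  have [measurable]: "kendall_density u \<in> borel_measurable borel" by measurable
  have [measurable]: "(\<lambda>p. q (fst p - u) (T - snd p)) \<in> borel_measurable (borel \<Otimes>\<^sub>M borel)"
    using q_measurable by measurable
  have "(\<integral>\<^sup>+\<omega>. indicator (passing T u) \<omega> * \<phi> (X T \<omega>) \<partial>M) =
    (\<integral>\<^sup>+x. (\<integral>\<^sup>+s. kendall_density u s * ennreal (q (x - u) (T - s)) * indicator {0<..<T} s \<partial>lborel) * \<phi> x \<partial>lborel)"
    using kendall_at[OF T u D] u by (intro passage_law T) auto
  also have "\<dots> = (\<integral>\<^sup>+z. (\<integral>\<^sup>+s. kendall_density u s * ennreal (q (u - z - u) (T - s)) * indicator {0<..<T} s \<partial>lborel) * \<phi> (u - z) \<partial>lborel)"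
    by (rule nn_integral_reflect[symmetric]) measurable
  also have "\<dots> = (\<integral>\<^sup>+z. Q z * late_density T u z * indicator {0<..} z \<partial>lborel)"
  proof (rule nn_integral_cong)
    fix z
    have [measurable]: "(\<lambda>s. q (- z) s) \<in> borel_measurable borel" using q_measurable by measurable
    have "(\<integral>\<^sup>+s. kendall_density u s * ennreal (q (u - z - u) (T - s)) * indicator {0<..<T} s \<partial>lborel) =
      (\<integral>\<^sup>+s. kendall_density u s * ennreal (q (- z) (T - s)) * indicator {0<..<T} s \<partial>lborel)" by simp
    also have "\<dots> = (\<integral>\<^sup>+s. kendall_density u (T - s) * ennreal (q (- z) (T - (T - s))) * indicator {0<..<T} (T - s) \<partial>lborel)"
      by (rule nn_integral_reflect[symmetric]) measurable
    also have "\<dots> = late_density T u z" unfolding late_density_def by (intro nn_integral_cong) (auto simp: indicator_def)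
    finally show "(\<integral>\<^sup>+s. kendall_density u s * ennreal (q (u - z - u) (T - s)) * indicator {0<..<T} s \<partial>lborel) * \<phi> (u - z) = Q z * late_density T u z * indicator {0<..} z"
      unfolding \<phi>_refl by (simp add: mult_ac)
  qed
  finally show "(\<integral>\<^sup>+\<omega>. indicator (passing T u) \<omega> * (Q (u - X T \<omega>) * indicator {..<u} (X T \<omega>)) \<partial>M) =
      (\<integral>\<^sup>+z. Q z * late_density T u z * indicator {0<..} z \<partial>lborel)"
    unfolding \<phi>_def .
qed

text \<open>Paths that have not passed before \<open>T\<close> end at or below \<open>u\<close>, and
  equality has probability 0; so the indicator of \<open>X T < u\<close> can be inserted, and the
  complementary part of that event is the passage term. The balance is additive because subtraction
  in \<open>ennreal\<close> is truncated.\<close>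

lemma late_not_early:
  assumes T: "0 < T" and u: "0 < u"
    and D: "AE s in lborel. 0 < s \<and> s < T \<longrightarrow> (cdf (distr M borel (X s)) has_real_derivative q u s) (at_right u)"
  shows "emeasure M (late_exceed T d r u - passing T u) + (\<integral>\<^sup>+z. ennreal (prob (exceed d r z)) * late_density T u z * indicator {0<..} z \<partial>lborel)
     = (\<integral>\<^sup>+z. ennreal (prob (exceed d r z)) * ennreal (q (u - z) T) * indicator {0<..} z \<partial>lborel)"
proof -
  have T0: "0 \<le> T" using T by simp
  let ?Q = "\<lambda>z. ennreal (prob (exceed d r z))"
  have [measurable]: "X T \<in> borel_measurable M" using T by (intro rv) simp
  have "emeasure M (late_exceed T d r u - passing T u) = (\<integral>\<^sup>+\<omega>. indicator (space M - passing T u) \<omega> * (?Q (u - X T \<omega>) * indicator {..<u} (X T \<omega>)) \<partial>M)"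
    unfolding emeasure_late_not_early(2)[OF T0]
  proof (rule nn_integral_cong_AE)
    show "AE \<omega> in M. indicator (space M - passing T u) \<omega> * ?Q (u - X T \<omega>) = indicator (space M - passing T u) \<omega> * (?Q (u - X T \<omega>) * indicator {..<u} (X T \<omega>))"
      using AE_neq[OF T, of u]
    proof eventually_elim
      case (elim \<omega>)
      show ?case
      proof (cases "\<omega> \<in> space M - passing T u")
        case True
        then have "X v \<omega> \<le> u" if "0 \<le> v" "v < T" for v using that by (force simp: passing_def not_less)
        then have "X T \<omega> \<le> u" by (rule regular_path_le_at_end[OF regular T])
        then show ?thesis using elim by (simp add: less_le)
      qed simp
    qed
  qed
  moreover have "(\<integral>\<^sup>+\<omega>. indicator (space M - passing T u) \<omega> * (?Q (u - X T \<omega>) * indicator {..<u} (X T \<omega>)) \<partial>M)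
     + (\<integral>\<^sup>+\<omega>. indicator (passing T u) \<omega> * (?Q (u - X T \<omega>) * indicator {..<u} (X T \<omega>)) \<partial>M)
    = (\<integral>\<^sup>+\<omega>. ?Q (u - X T \<omega>) * indicator {..<u} (X T \<omega>) \<partial>M)"
  proof (subst nn_integral_add[symmetric])
    show "(\<integral>\<^sup>+\<omega>. indicator (space M - passing T u) \<omega> * (?Q (u - X T \<omega>) * indicator {..<u} (X T \<omega>)) +
         indicator (passing T u) \<omega> * (?Q (u - X T \<omega>) * indicator {..<u} (X T \<omega>)) \<partial>M) = (\<integral>\<^sup>+\<omega>. ?Q (u - X T \<omega>) * indicator {..<u} (X T \<omega>) \<partial>M)"
      by (intro nn_integral_cong) (auto simp: indicator_def)
  qed measurable
  ultimately show ?thesis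
    unfolding terminal_integrals(1)[OF T u D, of ?Q, simplified] terminal_integrals(2)[OF T u D, of ?Q, simplified] by simp
qed

end

section \<open>From the given process to regular paths\<close>

lemma (in prob_space) indep_vars_cong_AE:
  assumes ind: "indep_vars (\<lambda>_. borel) Z {..<n::nat}"
    and rv: "\<And>i. i < n \<Longrightarrow> Z' i \<in> borel_measurable M"
    and eq: "\<And>i. i < n \<Longrightarrow> AE \<omega> in M. Z i \<omega> = (Z' i \<omega> :: real)"
  shows "indep_vars (\<lambda>_. borel) Z' {..<n}"
proof (cases "n = 0")
  case True
  then show ?thesis by (simp add: indep_vars_def indep_sets_def)
next
  case False
  then have ne: "{..<n} \<noteq> {}" by auto
  have Zrv: "Z i \<in> borel_measurable M" if "i < n" for i using ind that by (auto simp: indep_vars_def)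
  \<comment> \<open>Independence is a property of the joint law and the marginals, and these do not
    change when the variables are altered on a null set.\<close>
  have "AE \<omega> in M. \<forall>i\<in>{..<n}. Z i \<omega> = Z' i \<omega>"
    using eq by (subst AE_finite_all) auto
  then have "AE \<omega> in M. (\<lambda>i\<in>{..<n}. Z i \<omega>) = (\<lambda>i\<in>{..<n}. Z' i \<omega>)"
    by eventually_elim (auto simp: restrict_def fun_eq_iff)
  then have "distr M (\<Pi>\<^sub>M i\<in>{..<n}. borel) (\<lambda>\<omega>. \<lambda>i\<in>{..<n}. Z i \<omega>) = distr M (\<Pi>\<^sub>M i\<in>{..<n}. borel) (\<lambda>\<omega>. \<lambda>i\<in>{..<n}. Z' i \<omega>)"
    using rv Zrv by (intro distr_cong_AE measurable_restrict) auto
  moreover have "distr M (\<Pi>\<^sub>M i\<in>{..<n}. borel) (\<lambda>\<omega>. \<lambda>i\<in>{..<n}. Z i \<omega>) = (\<Pi>\<^sub>M i\<in>{..<n}. distr M borel (Z i))"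
    using ind Zrv by (subst indep_vars_iff_distr_eq_PiM'[symmetric, OF ne]) auto
  moreover have "(\<Pi>\<^sub>M i\<in>{..<n}. distr M borel (Z i)) = (\<Pi>\<^sub>M i\<in>{..<n}. distr M borel (Z' i))"
    using eq rv Zrv by (intro PiM_cong distr_cong_AE) auto
  ultimately show ?thesis
    using rv by (subst indep_vars_iff_distr_eq_PiM'[OF ne]) auto
qed

text \<open>The irregular outcomes need not form an event, so the paths are set to 0 on a measurable
  null set containing them. Subtracting a linear drift at the same time keeps increments independent
  and stationary, and being continuous it leaves the jumps unchanged.\<close>

lemma regular_modification:
  assumes "spectrally_negative_levy_process M Y"
  obtains X where "regular_levy M X" "AE \<omega> in M. \<forall>t. X t \<omega> = Y t \<omega> - c * t"
proof -
  interpret Y: spectrally_negative_levy_process M Y by fact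
  define good where "good \<omega> \<longleftrightarrow> Y 0 \<omega> = 0 \<and> ((\<forall>t\<ge>0. continuous (at_right t) (\<lambda>s. Y s \<omega>)) \<and>
      (\<forall>t>0. \<exists>l. ((\<lambda>s. Y s \<omega>) \<longlongrightarrow> l) (at_left t))) \<and> (\<forall>t>0. Y t \<omega> - Lim (at_left t) (\<lambda>s. Y s \<omega>) \<le> 0)" for \<omega>
  have "AE \<omega> in M. good \<omega>"
    using Y.start_zero Y.cadlag Y.no_positive_jumps unfolding good_def by eventually_elim blast
  then obtain N where N: "{\<omega> \<in> space M. \<not> good \<omega>} \<subseteq> N" "emeasure M N = 0" "N \<in> sets M" by (rule AE_E)
  define X where "X t \<omega> = (if \<omega> \<in> space M - N then Y t \<omega> - c * t else 0)" for t \<omega>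
  have AE_eq: "AE \<omega> in M. \<forall>t. X t \<omega> = Y t \<omega> - c * t"
  proof -
    have "AE \<omega> in M. \<omega> \<notin> N" using N by (intro AE_not_in) auto
    then show ?thesis using AE_space by eventually_elim (simp add: X_def)
  qed
  have rv: "X t \<in> borel_measurable M" if "0 \<le> t" for t
  proof -
    have [measurable]: "Y t \<in> borel_measurable M" "space M - N \<in> sets M" using Y.random_variable[OF that] N by auto
    show ?thesis unfolding X_def by measurable
  qed
  have "regular_levy M X"
  proof unfold_locales
    show "X 0 \<omega> = 0" for \<omega>
    proof (cases "\<omega> \<in> space M - N")
      case True
      then have "good \<omega>" using N by blast
      then show ?thesis by (simp add: X_def good_def)
    next
      case False
      then show ?thesis unfolding X_def by (simp only: if_False)
    qed
    show "Y.indep_vars (\<lambda>_. borel) (\<lambda>i \<omega>. X (t (Suc i)) \<omega> - X (t i) \<omega>) {..<n}"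
      if t: "0 \<le> t 0" "\<And>i. i < n \<Longrightarrow> t i \<le> t (Suc i)" for n and t :: "nat \<Rightarrow> real"
    proof -
      have nn: "0 \<le> t i" if "i \<le> n" for i
        using that
      proof (induction i)
        case (Suc i)
        then show ?case using t(2)[of i] by simp
      qed (use t in simp)
      have "Y.indep_vars (\<lambda>_. borel) (\<lambda>i \<omega>. Y (t (Suc i)) \<omega> - Y (t i) \<omega>) {..<n}"
        using t by (rule Y.indep_increments)
      then have "Y.indep_vars (\<lambda>_. borel) (\<lambda>i \<omega>. (Y (t (Suc i)) \<omega> - Y (t i) \<omega>) - c * (t (Suc i) - t i)) {..<n}"
        by (rule Y.indep_vars_compose2[where Y="\<lambda>i x. x - c * (t (Suc i) - t i)"]) auto
      then show ?thesis
      proof (rule Y.indep_vars_cong_AE)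
        show "(\<lambda>\<omega>. X (t (Suc i)) \<omega> - X (t i) \<omega>) \<in> borel_measurable M" if "i < n" for i
          using that nn by (intro borel_measurable_diff rv) auto
        show "AE \<omega> in M. (Y (t (Suc i)) \<omega> - Y (t i) \<omega>) - c * (t (Suc i) - t i) = X (t (Suc i)) \<omega> - X (t i) \<omega>" for i
          using AE_eq
        proof eventually_elim
          case (elim \<omega>)
          have Xe: "X s \<omega> = Y s \<omega> - c * s" for s using elim by blast
          show ?case unfolding Xe by (simp add: algebra_simps)
        qed
      qed
    qed
    show "distr M borel (\<lambda>\<omega>. X t \<omega> - X s \<omega>) = distr M borel (X (t - s))" if st: "0 \<le> s" "s \<le> t" for s t
    proof -
      have [measurable]: "Y t \<in> borel_measurable M" "Y s \<in> borel_measurable M" "Y (t - s) \<in> borel_measurable M"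
        "X t \<in> borel_measurable M" "X s \<in> borel_measurable M" "X (t - s) \<in> borel_measurable M"
        using st by (auto intro: Y.random_variable rv)
      have "distr M borel (\<lambda>\<omega>. X t \<omega> - X s \<omega>) = distr M borel (\<lambda>\<omega>. (Y t \<omega> - Y s \<omega>) - c * (t - s))"
      proof (rule distr_cong_AE)
        show "AE \<omega> in M. X t \<omega> - X s \<omega> = (Y t \<omega> - Y s \<omega>) - c * (t - s)"
          using AE_eq
        proof eventually_elim
          case (elim \<omega>)
          have Xe: "X s \<omega> = Y s \<omega> - c * s" for s using elim by blast
          show ?case unfolding Xe by (simp add: algebra_simps)
        qed
      qed auto
      also have "\<dots> = distr (distr M borel (\<lambda>\<omega>. Y t \<omega> - Y s \<omega>)) borel (\<lambda>x. x - c * (t - s))"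
        by (subst distr_distr) (auto simp: comp_def)
      also have "\<dots> = distr (distr M borel (Y (t - s))) borel (\<lambda>x. x - c * (t - s))"
        using Y.stationary_increments[OF st] by simp
      also have "\<dots> = distr M borel (\<lambda>\<omega>. Y (t - s) \<omega> - c * (t - s))"
        by (subst distr_distr) (auto simp: comp_def)
      also have "\<dots> = distr M borel (X (t - s))"
      proof (rule distr_cong_AE)
        show "AE \<omega> in M. Y (t - s) \<omega> - c * (t - s) = X (t - s) \<omega>" using AE_eq by eventually_elim simp
      qed auto
      finally show ?thesis .
    qed
    show "regular_path (\<lambda>t. X t \<omega>)" for \<omega>
    proof (cases "\<omega> \<in> space M - N")
      case False
      then have "(\<lambda>t. X t \<omega>) = (\<lambda>_. 0)" by (auto simp: X_def)
      then show ?thesis by (auto simp: regular_path_def intro!: exI[of _ 0])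
    next
      case True
      then have gd: "good \<omega>" using N by blast
      have Xe: "X t \<omega> = Y t \<omega> - c * t" for t using True by (simp add: X_def)
      show ?thesis
        unfolding regular_path_def Xe
      proof (intro conjI allI impI)
        show "Y 0 \<omega> - c * 0 = 0" using gd by (simp add: good_def)
        show "((\<lambda>t. Y t \<omega> - c * t) \<longlongrightarrow> Y t \<omega> - c * t) (at_right t)" if "0 \<le> t" for t
        proof -
          have "((\<lambda>s. Y s \<omega>) \<longlongrightarrow> Y t \<omega>) (at_right t)" using gd that by (simp add: good_def continuous_within)
          then show ?thesis by (intro tendsto_intros)
        qed
        show "\<exists>l\<ge>Y t \<omega> - c * t. ((\<lambda>t. Y t \<omega> - c * t) \<longlongrightarrow> l) (at_left t)" if t: "0 < t" for t
        proof -
          obtain l where l: "((\<lambda>s. Y s \<omega>) \<longlongrightarrow> l) (at_left t)" using gd t by (auto simp: good_def)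
          then have "Lim (at_left t) (\<lambda>s. Y s \<omega>) = l" by (intro tendsto_Lim) simp_all
          then have "Y t \<omega> \<le> l" using gd t by (auto simp: good_def)
          moreover have "((\<lambda>t. Y t \<omega> - c * t) \<longlongrightarrow> l - c * t) (at_left t)" by (intro tendsto_intros l)
          ultimately show ?thesis by (intro exI[of _ "l - c * t"]) auto
        qed
      qed
    qed
  qed (rule rv)
  then show ?thesis using AE_eq by (rule that)
qed

text \<open>The set in \<open>prob_sup_gt\<close> differs from an event by a subset of a null set,
  so it is measurable in the completion and has the same probability as that event.\<close>

lemma (in prob_space) prob_sup_gt_eq:
  assumes E: "E \<in> events"
    and eq: "AE \<omega> in M. (\<exists>t. 0 \<le> t \<and> ereal t < r \<and> x < V t \<omega>) \<longleftrightarrow> \<omega> \<in> E"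
  shows "prob_sup_gt M V r x = prob E"
proof -
  let ?A = "{\<omega> \<in> space M. (SUP t \<in> {t. 0 \<le> t \<and> ereal t < r}. ereal (V t \<omega>)) > ereal x}"
  have A: "?A = {\<omega> \<in> space M. \<exists>t. 0 \<le> t \<and> ereal t < r \<and> x < V t \<omega>}"
    by (auto simp: less_SUP_iff)
  have AE_iff: "AE \<omega> in M. \<omega> \<in> ?A \<longleftrightarrow> \<omega> \<in> E"
    using eq AE_space unfolding A by eventually_elim blast
  then obtain N where N: "{\<omega> \<in> space M. \<not> (\<omega> \<in> ?A \<longleftrightarrow> \<omega> \<in> E)} \<subseteq> N" "emeasure M N = 0" "N \<in> sets M" by (rule AE_E)
  have "?A \<in> sets (completion M)"
  proof (rule sets_completionI)
    show "?A = (E - N) \<union> (?A \<inter> N)" using N(1) sets.sets_into_space[OF E] by blast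
    show "N \<in> null_sets M" using N by auto
  qed (use E N in auto)
  then have "measure (completion M) ?A = measure (completion M) E"
    using AE_completion[OF AE_iff] E by (intro measure_eq_AE) auto
  then show ?thesis using E by (simp add: prob_sup_gt_def)
qed

text \<open>Measurability is asked of \<open>F'\<close> and not of \<open>F\<close>: integrands
  built from \<open>p\<close> are uncontrolled at times \<open>s \<le> 0\<close>, while those built
  from \<open>q\<close> are measurable everywhere and agree on \<open>A\<close>.\<close>

lemma set_integral_nonneg_eqI:
  fixes F :: "real \<Rightarrow> real"
  assumes [measurable]: "F' \<in> borel_measurable borel" "A \<in> sets borel"
    and eq: "\<And>x. x \<in> A \<Longrightarrow> F x = F' x" and nonneg: "\<And>x. x \<in> A \<Longrightarrow> 0 \<le> F' x"
    and I: "0 \<le> I" "(\<integral>\<^sup>+x. ennreal (F' x) * indicator A x \<partial>lborel) = ennreal I"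
  shows "set_integrable lborel A F" "(LINT x:A|lborel. F x) = I"
proof -
  have "(\<lambda>x. indicator A x *\<^sub>R F x) = (\<lambda>x. indicator A x * F' x)"
    using eq by (auto simp: fun_eq_iff indicator_def)
  moreover have "has_bochner_integral lborel (\<lambda>x. indicator A x * F' x) I"
  proof (rule has_bochner_integral_nn_integral)
    have "(\<integral>\<^sup>+x. ennreal (indicator A x * F' x) \<partial>lborel) = (\<integral>\<^sup>+x. ennreal (F' x) * indicator A x \<partial>lborel)"
      by (intro nn_integral_cong) (auto simp: indicator_def)
    then show "(\<integral>\<^sup>+x. ennreal (indicator A x * F' x) \<partial>lborel) = ennreal I" using I by simp
  qed (use nonneg I in \<open>auto simp: indicator_def\<close>)
  ultimately show "set_integrable lborel A F" "(LINT x:A|lborel. F x) = I"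
    unfolding set_integrable_def set_lebesgue_integral_def
    by (auto intro: integrable.intros simp: has_bochner_integral_integral_eq)
qed

text \<open>Holds also if the integral is infinite: the default value 0 of a non-integrable function
  matches \<open>enn2real\<close> at infinity. It can therefore be used for every \<open>z\<close>,
  before exceptional ones are known.\<close>

lemma set_integral_eq_enn2real:
  fixes F :: "real \<Rightarrow> real"
  assumes [measurable]: "F' \<in> borel_measurable borel" "A \<in> sets borel"
    and eq: "\<And>x. x \<in> A \<Longrightarrow> F x = F' x" and nonneg: "\<And>x. x \<in> A \<Longrightarrow> 0 \<le> F' x"
  shows "(LINT x:A|lborel. F x) = enn2real (\<integral>\<^sup>+x. ennreal (F' x) * indicator A x \<partial>lborel)"
proof -
  have "(\<lambda>x. indicator A x *\<^sub>R F x) = (\<lambda>x. indicator A x * F' x)"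
    using eq by (auto simp: fun_eq_iff indicator_def)
  then have "(LINT x:A|lborel. F x) = (\<integral>x. indicator A x * F' x \<partial>lborel)" by (simp add: set_lebesgue_integral_def)
  also have "\<dots> = enn2real (\<integral>\<^sup>+x. ennreal (indicator A x * F' x) \<partial>lborel)"
    using nonneg by (intro integral_eq_nn_integral) (auto simp: indicator_def)
  also have "(\<integral>\<^sup>+x. ennreal (indicator A x * F' x) \<partial>lborel) = (\<integral>\<^sup>+x. ennreal (F' x) * indicator A x \<partial>lborel)"
    by (intro nn_integral_cong) (auto simp: indicator_def)
  finally show ?thesis .
qed

theorem theorem5:
  fixes M :: "'a measure" and Y :: "real \<Rightarrow> 'a \<Rightarrow> real" and p :: "real \<Rightarrow> real \<Rightarrow> real"
    and c :: "real \<Rightarrow> real" and c1 c2 u T :: real and S :: ereal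
  assumes Y: "spectrally_negative_levy_process M Y"
    and density: "\<And>t. 0 < t \<Longrightarrow> distributed M lborel (Y t) (\<lambda>x. ennreal (p x t))"
    and density_nonneg: "\<And>x t. 0 < t \<Longrightarrow> 0 \<le> p x t"
    and density_measurable:
      "(\<lambda>(x, t). p x t) \<in> borel_measurable (restrict_space borel (UNIV \<times> {0<..}))"
    \<comment> \<open>Densities are unique only up to null sets, so the integral of \<open>p\<close> along the line
      \<open>x = u + c1 * s\<close> depends on the chosen version. There, \<open>p\<close> has to be the right-hand
      derivative of the distribution function (e.g. by right-continuity in \<open>x\<close>).\<close>
    and density_version:
      "AE s in lborel. 0 < s \<and> s < T \<longrightarrow>
         (cdf (distr M borel (Y s)) has_real_derivative p (u + c1 * s) s) (at_right (u + c1 * s))"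
    and "0 \<le> c1" and "0 \<le> c2" and "0 < u" and "0 < T" and "ereal T < S"
    and "\<And>t. 0 \<le> t \<Longrightarrow> t \<le> T \<Longrightarrow> c t = c1 * t"
    and "\<And>t. T < t \<Longrightarrow> c t = c2 * (t - T) + c1 * T"
  shows
    "let Q = (\<lambda>z. prob_sup_gt M (\<lambda>t \<omega>. Y t \<omega> - c2 * t) (S - ereal T) z);
         h = (\<lambda>z s. p (- z + c1 * s) s / (T - s) * p (u + c1 * (T - s)) (T - s));
         A = prob_sup_gt M (\<lambda>t \<omega>. Y t \<omega> - c1 * t) (ereal T) u;
         B = (LINT z:{0<..}|lborel. Q z * p (- z + u + c1 * T) T)
               - u * (LINT z:{0<..}|lborel. Q z * (LINT s:{0<..<T}|lborel. h z s))
     in prob_sup_gt M (\<lambda>t \<omega>. Y t \<omega> - c t) S u = A + B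
        \<and> A = u * (LINT s:{0<..<T}|lborel. p (u + c1 * s) s / s)
        \<comment> \<open>all integrals above are genuine, not default values\<close>
        \<and> set_integrable lborel {0<..<T} (\<lambda>s. p (u + c1 * s) s / s)
        \<and> set_integrable lborel {0<..} (\<lambda>z. Q z * p (- z + u + c1 * T) T)
        \<and> (AE z in lborel. 0 < z \<longrightarrow> set_integrable lborel {0<..<T} (h z))
        \<and> set_integrable lborel {0<..} (\<lambda>z. Q z * (LINT s:{0<..<T}|lborel. h z s))"
proof -
  note u = \<open>0 < u\<close> and T = \<open>0 < T\<close> and TS = \<open>ereal T < S\<close>
  note c_early = assms(11) and c_late = assms(12)
  obtain X where X: "regular_levy M X" and XY: "AE \<omega> in M. \<forall>t. X t \<omega> = Y t \<omega> - c1 * t"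
    using regular_modification[OF Y] by blast
  have rvX: "X t \<in> borel_measurable M" if "0 \<le> t" for t
    using X that by (simp add: regular_levy_def levy_increments.rv)
  interpret Y: spectrally_negative_levy_process M Y by (rule Y)
  \<comment> \<open>Subtracting the drift shears the densities along lines of slope
    \<open>c1\<close>; the value 0 removes the times at which \<open>p\<close> is
    unconstrained.\<close>
  define q where "q x t = (if 0 < t then p (x + c1 * t) t else 0)" for x t
  have q_measurable: "(\<lambda>(x, t). q x t) \<in> borel_measurable (borel \<Otimes>\<^sub>M borel)"
  proof -
    have op: "(UNIV \<times> {0<..} :: (real \<times> real) set) \<inter> space borel \<in> sets borel" by (auto intro!: borel_open open_Times)
    have "(\<lambda>xt. if xt \<in> UNIV \<times> {0<..} then (\<lambda>(x, t). p x t) xt else 0) \<in> borel_measurable borel"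
      using density_measurable measurable_restrict_space_iff[OF op, of 0 borel "\<lambda>(x, t). p x t"] by simp
    then have m: "(\<lambda>xt. if xt \<in> UNIV \<times> {0<..} then (\<lambda>(x, t). p x t) xt else 0) \<in> borel_measurable (borel \<Otimes>\<^sub>M borel)"
      by (simp add: borel_prod)
    have shear: "(\<lambda>xt. (fst xt + c1 * snd xt, snd xt)) \<in> measurable (borel \<Otimes>\<^sub>M borel) (borel \<Otimes>\<^sub>M borel)" by measurable
    have "(\<lambda>(x, t). q x t) = (\<lambda>xt. (\<lambda>xt. if xt \<in> UNIV \<times> {0<..} then (\<lambda>(x, t). p x t) xt else 0) (fst xt + c1 * snd xt, snd xt))"
      by (auto simp: q_def fun_eq_iff)
    then show ?thesis using measurable_compose[OF shear m] by simp
  qed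
  interpret regular_levy_density M X q
  proof (rule regular_levy_density.intro[OF X], unfold_locales)
    show "(\<lambda>(x, t). q x t) \<in> borel_measurable (borel \<Otimes>\<^sub>M borel)" by (rule q_measurable)
    show "0 \<le> q x t" for x t by (simp add: q_def density_nonneg)
    fix t :: real assume t: "0 < t"
    have rvXt: "X t \<in> borel_measurable M" and rvY: "Y t \<in> borel_measurable M"
      using t by (auto intro: rvX Y.random_variable)
    have "distributed M lborel (\<lambda>x. - (c1 * t) + 1 * Y t x) (\<lambda>x. ennreal (p ((x - - (c1 * t)) / 1) t) / ennreal \<bar>1\<bar>)"
      by (rule Y.distributed_affine[OF density[OF t]]) simp
    then have "distributed M lborel (\<lambda>x. Y t x - c1 * t) (\<lambda>x. ennreal (q x t))"
      using t divide_ennreal[of "p _ t" 1] by (simp add: q_def density_nonneg)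
    moreover have "distr M lborel (\<lambda>x. Y t x - c1 * t) = distr M lborel (X t)"
    proof (rule distr_cong_AE)
      show "AE \<omega> in M. Y t \<omega> - c1 * t = X t \<omega>" using XY by eventually_elim simp
    qed (use rvXt rvY in auto)
    ultimately show "distributed M lborel (X t) (\<lambda>x. ennreal (q x t))"
      using rvXt by (simp add: distributed_def)
  qed
  \<comment> \<open>Under the shear, the line \<open>u + c1 * s\<close> becomes the constant level
    \<open>u\<close>, and the hypothesis on the version of \<open>p\<close> turns into the premise
    of \<open>kendall_at\<close>.\<close>
  have version: "AE s in lborel. 0 < s \<and> s < T \<longrightarrow> (cdf (distr M borel (X s)) has_real_derivative q u s) (at_right u)"
    using density_version
  proof eventually_elim
    case (elim s)
    show ?case
    proof
      assume s: "0 < s \<and> s < T"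
      then have [measurable]: "X s \<in> borel_measurable M" "Y s \<in> borel_measurable M"
        by (auto intro: rvX Y.random_variable)
      have "cdf (distr M borel (X s)) x = cdf (distr M borel (Y s)) (c1 * s + x)" for x
      proof -
        have "Y.prob (X s -` {..x} \<inter> space M) = Y.prob (Y s -` {..c1 * s + x} \<inter> space M)"
        proof (rule measure_eq_AE)
          show "AE \<omega> in M. \<omega> \<in> X s -` {..x} \<inter> space M \<longleftrightarrow> \<omega> \<in> Y s -` {..c1 * s + x} \<inter> space M"
            using XY by eventually_elim auto
        qed auto
        then show ?thesis by (simp add: cdf_def measure_distr)
      qed
      then have F: "cdf (distr M borel (X s)) = (\<lambda>x. cdf (distr M borel (Y s)) (c1 * s + x))" by auto
      have "(+) (c1 * s) ` {u<..} = {c1 * s + u<..}"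
      proof (rule set_eqI)
        fix x show "x \<in> (+) (c1 * s) ` {u<..} \<longleftrightarrow> x \<in> {c1 * s + u<..}"
          by (auto intro: image_eqI[of _ _ "x - c1 * s"])
      qed
      moreover have "(cdf (distr M borel (Y s)) has_real_derivative q u s) (at_right (c1 * s + u))"
        using elim s by (simp add: q_def add.commute)
      ultimately show "(cdf (distr M borel (X s)) has_real_derivative q u s) (at_right u)"
        unfolding F DERIV_at_within_shift[symmetric] by simp
    qed
  qed
  define r where "r = S - ereal T"
  define d where "d = c1 - c2"
  \<comment> \<open>If \<open>S\<close> is infinite, then so is \<open>r\<close>, and both sides
    hold for every \<open>s\<close>.\<close>
  have r_iff: "ereal s < r \<longleftrightarrow> ereal (T + s) < S" for s
    using TS by (cases S) (auto simp: r_def)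
  define Q where "Q z = Y.prob (exceed d r z)" for z
  have Q_eq: "prob_sup_gt M (\<lambda>t \<omega>. Y t \<omega> - c2 * t) (S - ereal T) z = Q z" for z
    unfolding Q_def r_def[symmetric]
  proof (rule Y.prob_sup_gt_eq[OF exceed_event])
    show "AE \<omega> in M. (\<exists>t. 0 \<le> t \<and> ereal t < r \<and> z < Y t \<omega> - c2 * t) \<longleftrightarrow> \<omega> \<in> exceed d r z"
      using XY AE_space by eventually_elim (auto simp: exceed_def d_def algebra_simps)
  qed
  have A_eq: "prob_sup_gt M (\<lambda>t \<omega>. Y t \<omega> - c1 * t) (ereal T) u = passage_prob T u"
    unfolding passage_prob_def
  proof (rule Y.prob_sup_gt_eq[OF passing_event])
    show "AE \<omega> in M. (\<exists>t. 0 \<le> t \<and> ereal t < ereal T \<and> u < Y t \<omega> - c1 * t) \<longleftrightarrow> \<omega> \<in> passing T u"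
      using XY AE_space by eventually_elim (auto simp: passing_def)
  qed
  have late: "late_exceed T d r u - passing T u \<in> Y.events" using T by (intro emeasure_late_not_early) simp
  have full_eq: "prob_sup_gt M (\<lambda>t \<omega>. Y t \<omega> - c t) S u = passage_prob T u + Y.prob (late_exceed T d r u - passing T u)"
  proof -
    have "prob_sup_gt M (\<lambda>t \<omega>. Y t \<omega> - c t) S u = Y.prob (passing T u \<union> (late_exceed T d r u - passing T u))"
    proof (rule Y.prob_sup_gt_eq)
      show "passing T u \<union> (late_exceed T d r u - passing T u) \<in> Y.events" using passing_event late by (rule sets.Un)
      show "AE \<omega> in M. (\<exists>t. 0 \<le> t \<and> ereal t < S \<and> u < Y t \<omega> - c t) \<longleftrightarrow> \<omega> \<in> passing T u \<union> (late_exceed T d r u - passing T u)"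
        using XY AE_space
      proof eventually_elim
        case (elim \<omega>)
        have Xe: "X s \<omega> = Y s \<omega> - c1 * s" for s using elim by blast
        \<comment> \<open>At \<open>s = 0\<close> the barrier is given by its first formula, for
          later times by the second; the two match at \<open>T\<close>.\<close>
        have after: "Y (T + s) \<omega> - c (T + s) = X (T + s) \<omega> + d * s" if "0 \<le> s" for s
          unfolding Xe using that c_early[of T] c_late[of "T + s"] T
          by (cases "s = 0") (simp_all add: d_def algebra_simps)
        have before: "Y s \<omega> - c s = X s \<omega>" if "0 \<le> s" "s < T" for s
          using that c_early[of s] elim by simp
        have "(\<exists>t. 0 \<le> t \<and> ereal t < S \<and> u < Y t \<omega> - c t) \<longleftrightarrow>
          (\<exists>s. 0 \<le> s \<and> s < T \<and> u < X s \<omega>) \<or> (\<exists>s. 0 \<le> s \<and> ereal s < r \<and> u < X (T + s) \<omega> + d * s)" (is "?L \<longleftrightarrow> ?R1 \<or> ?R2")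
        proof
          assume ?L
          then obtain t where t: "0 \<le> t" "ereal t < S" "u < Y t \<omega> - c t" by blast
          show "?R1 \<or> ?R2"
          proof (cases "t < T")
            case True
            then show ?thesis using t before by auto
          next
            case False
            then have "0 \<le> t - T" "ereal (t - T) < r" "u < X (T + (t - T)) \<omega> + d * (t - T)"
              using t after[of "t - T"] by (simp_all add: r_iff)
            then show ?thesis by blast
          qed
        next
          assume "?R1 \<or> ?R2"
          then show ?L
          proof
            assume ?R1
            then obtain s where s: "0 \<le> s" "s < T" "u < X s \<omega>" by blast
            moreover have "ereal s < S" using s(2) TS by (metis ereal_less_eq(3) le_less_trans less_imp_le)
            ultimately show ?L using before[of s] by auto
          next
            assume ?R2
            then obtain s where s: "0 \<le> s" "ereal s < r" "u < X (T + s) \<omega> + d * s" by blast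
            then show ?L using after[of s] T by (intro exI[of _ "T + s"]) (auto simp: r_iff)
          qed
        qed
        then show ?case using elim by (auto simp: passing_def late_exceed_def)
      qed
    qed
    also have "\<dots> = passage_prob T u + Y.prob (late_exceed T d r u - passing T u)"
      unfolding passage_prob_def using late by (intro Y.finite_measure_Union) auto
    finally show ?thesis .
  qed
  have [measurable]: "Q \<in> borel_measurable borel" unfolding Q_def by measurable
  have Q0: "0 \<le> Q z" "Q z \<le> 1" for z by (simp_all add: Q_def)
  have [measurable]: "(\<lambda>s. q u s) \<in> borel_measurable borel" "(\<lambda>z. q (u - z) T) \<in> borel_measurable borel"
    "(\<lambda>s. q u (T - s)) \<in> borel_measurable borel" "(\<lambda>zs. q (- fst zs) (snd zs)) \<in> borel_measurable (borel \<Otimes>\<^sub>M borel)"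
    using q_measurable by measurable
  have [measurable]: "(\<lambda>s. q (- z) s) \<in> borel_measurable borel" for z using q_measurable by measurable

  have "ennreal u * (\<integral>\<^sup>+s. ennreal (q u s / s) * indicator {0<..<T} s \<partial>lborel) = ennreal (passage_prob T u)"
  proof -
    have "ennreal u * (\<integral>\<^sup>+s. ennreal (q u s / s) * indicator {0<..<T} s \<partial>lborel) =
       (\<integral>\<^sup>+s. ennreal u * (ennreal (q u s / s) * indicator {0<..<T} s) \<partial>lborel)"
      by (rule nn_integral_cmult[symmetric]) measurable
    also have "\<dots> = (\<integral>\<^sup>+s. kendall_density u s * indicator {0<..<T} s \<partial>lborel)"
      using u by (intro nn_integral_cong) (auto simp: kendall_density_def indicator_def q_nonneg ennreal_mult[symmetric])
    also have "\<dots> = ennreal (passage_prob T u)" using kendall_at[OF T u version, of T] T by simp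
    finally show ?thesis .
  qed
  then have "(\<integral>\<^sup>+s. ennreal (q u s / s) * indicator {0<..<T} s \<partial>lborel) = ennreal (passage_prob T u / u)"
    using u by (metis passage_prob_bounds(1) divide_ennreal ennreal_mult_divide_eq ennreal_eq_0_iff ennreal_neq_top mult.commute not_le)
  note early = set_integral_nonneg_eqI[where F="\<lambda>s. p (u + c1 * s) s / s" and F'="\<lambda>s. q u s / s" and A="{0<..<T}", OF _ _ _ _ _ this]
  have early_int: "set_integrable lborel {0<..<T} (\<lambda>s. p (u + c1 * s) s / s)"
    by (rule early) (measurable, use u in \<open>simp_all add: q_def density_nonneg\<close>)
  have "(LINT s:{0<..<T}|lborel. p (u + c1 * s) s / s) = passage_prob T u / u"
    by (rule early) (measurable, use u in \<open>simp_all add: q_def density_nonneg\<close>)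
  then have early_eq: "passage_prob T u = u * (LINT s:{0<..<T}|lborel. p (u + c1 * s) s / s)" using u by simp

  define I1 where "I1 = enn2real (\<integral>\<^sup>+z. ennreal (Q z) * ennreal (q (u - z) T) * indicator {0<..} z \<partial>lborel)"
  \<comment> \<open>Finite, because it is the expectation of a function of \<open>X T\<close> with
    values at most 1.\<close>
  have I1: "(\<integral>\<^sup>+z. ennreal (Q z) * ennreal (q (u - z) T) * indicator {0<..} z \<partial>lborel) = ennreal I1"
  proof -
    have "(\<integral>\<^sup>+z. ennreal (Q z) * ennreal (q (u - z) T) * indicator {0<..} z \<partial>lborel) =
       (\<integral>\<^sup>+\<omega>. ennreal (Q (u - X T \<omega>)) * indicator {..<u} (X T \<omega>) \<partial>M)"
      by (rule terminal_integrals(1)[OF T u version, symmetric]) measurable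
    also have "\<dots> \<le> (\<integral>\<^sup>+\<omega>. 1 \<partial>M)"
      using Q0(2) by (intro nn_integral_mono) (auto simp: indicator_def)
    finally have "(\<integral>\<^sup>+z. ennreal (Q z) * ennreal (q (u - z) T) * indicator {0<..} z \<partial>lborel) < \<top>"
      by (simp add: Y.emeasure_space_1 le_less_trans)
    then show ?thesis by (simp add: I1_def)
  qed
  have first: "set_integrable lborel {0<..} (\<lambda>z. Q z * p (- z + u + c1 * T) T)"
    "(LINT z:{0<..}|lborel. Q z * p (- z + u + c1 * T) T) = I1"
  proof -
    have "(\<integral>\<^sup>+z. ennreal (Q z * q (u - z) T) * indicator {0<..} z \<partial>lborel) = ennreal I1"
      using I1 by (simp add: ennreal_mult Q0 q_nonneg)
    note * = set_integral_nonneg_eqI[where F="\<lambda>z. Q z * p (- z + u + c1 * T) T" and F'="\<lambda>z. Q z * q (u - z) T" and A="{0<..}", OF _ _ _ _ _ this]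
    show "set_integrable lborel {0<..} (\<lambda>z. Q z * p (- z + u + c1 * T) T)"
      by (rule *) (measurable, use T in \<open>simp_all add: q_def Q0 density_nonneg I1_def\<close>)
    show "(LINT z:{0<..}|lborel. Q z * p (- z + u + c1 * T) T) = I1"
      by (rule *) (measurable, use T in \<open>simp_all add: q_def Q0 density_nonneg I1_def\<close>)
  qed

  define h where "h z s = p (- z + c1 * s) s / (T - s) * p (u + c1 * (T - s)) (T - s)" for z s
  define h' where "h' z s = q (- z) s / (T - s) * q u (T - s)" for z s
  have hh': "h z s = h' z s" "0 \<le> h' z s" if "s \<in> {0<..<T}" for z s
    using that by (auto simp: h_def h'_def q_def density_nonneg)
  have h'_meas [measurable]: "h' z \<in> borel_measurable borel" for z unfolding h'_def[abs_def] by measurable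
  define H where "H z = (\<integral>\<^sup>+s. ennreal (h' z s) * indicator {0<..<T} s \<partial>lborel)" for z
  have [measurable]: "H \<in> borel_measurable borel" unfolding H_def h'_def by measurable
  have late_density_H: "late_density T u z = ennreal u * H z" for z
  proof -
    have "ennreal u * H z = (\<integral>\<^sup>+s. ennreal u * (ennreal (h' z s) * indicator {0<..<T} s) \<partial>lborel)"
      unfolding H_def by (rule nn_integral_cmult[symmetric]) measurable
    also have "\<dots> = late_density T u z"
      unfolding late_density_def using u
      by (intro nn_integral_cong) (auto simp: kendall_density_def h'_def indicator_def q_nonneg ennreal_mult[symmetric] mult_ac)
    finally show ?thesis by simp
  qed
  \<comment> \<open>Taking the constant 1 for \<open>Q\<close> in \<open>terminal_integrals\<close>
    shows that \<open>late_density\<close> has mass at most 1 on the positive half-line, so it is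
    finite almost everywhere.\<close>
  have H_fin: "AE z in lborel. 0 < z \<longrightarrow> H z < \<top>"
  proof -
    have "(\<integral>\<^sup>+z. late_density T u z * indicator {0<..} z \<partial>lborel) = (\<integral>\<^sup>+\<omega>. indicator (passing T u) \<omega> * (1 * indicator {..<u} (X T \<omega>)) \<partial>M)"
      using terminal_integrals(2)[OF T u version, of "\<lambda>_. 1"] by simp
    also have "\<dots> \<le> (\<integral>\<^sup>+\<omega>. 1 \<partial>M)" by (intro nn_integral_mono) (auto simp: indicator_def)
    finally have "(\<integral>\<^sup>+z. late_density T u z * indicator {0<..} z \<partial>lborel) < \<top>"
      by (simp add: Y.emeasure_space_1 le_less_trans)
    then have "AE z in lborel. late_density T u z * indicator {0<..} z \<noteq> \<infinity>" by (intro nn_integral_PInf_AE) auto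
    then show ?thesis
    proof eventually_elim
      case (elim z)
      then show ?case using u by (auto simp: late_density_H ennreal_mult_eq_top_iff less_top)
    qed
  qed
  have inner: "(LINT s:{0<..<T}|lborel. h z s) = enn2real (H z)" for z
    unfolding H_def by (rule set_integral_eq_enn2real) (auto simp: hh')
  have inner_int: "AE z in lborel. 0 < z \<longrightarrow> set_integrable lborel {0<..<T} (h z)"
    using H_fin
  proof eventually_elim
    case (elim z)
    show ?case
    proof
      assume "0 < z"
      then have "(\<integral>\<^sup>+s. ennreal (h' z s) * indicator {0<..<T} s \<partial>lborel) = ennreal (enn2real (H z))"
        using elim by (simp add: H_def)
      then show "set_integrable lborel {0<..<T} (h z)"
        by (intro set_integral_nonneg_eqI(1)[of "h' z" "{0<..<T}" "h z" "enn2real (H z)"]) (auto simp: hh')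
    qed
  qed

  \<comment> \<open>The real inner integral takes its default value 0 where \<open>H\<close> is
    infinite. For positive \<open>z\<close> this happens only on a null set, so
    \<open>enn2real (H z)\<close> may replace \<open>H z\<close> under the outer integral.\<close>
  define I2 where "I2 = enn2real (\<integral>\<^sup>+z. ennreal (Q z * enn2real (H z)) * indicator {0<..} z \<partial>lborel)"
  have u_I2: "ennreal u * (\<integral>\<^sup>+z. ennreal (Q z * enn2real (H z)) * indicator {0<..} z \<partial>lborel) =
      (\<integral>\<^sup>+z. ennreal (Q z) * late_density T u z * indicator {0<..} z \<partial>lborel)"
  proof -
    have "ennreal u * (\<integral>\<^sup>+z. ennreal (Q z * enn2real (H z)) * indicator {0<..} z \<partial>lborel) =
       (\<integral>\<^sup>+z. ennreal u * (ennreal (Q z * enn2real (H z)) * indicator {0<..} z) \<partial>lborel)"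
      by (rule nn_integral_cmult[symmetric]) measurable
    also have "\<dots> = (\<integral>\<^sup>+z. ennreal (Q z) * late_density T u z * indicator {0<..} z \<partial>lborel)"
    proof (rule nn_integral_cong_AE)
      show "AE z in lborel. ennreal u * (ennreal (Q z * enn2real (H z)) * indicator {0<..} z) = ennreal (Q z) * late_density T u z * indicator {0<..} z"
        using H_fin
      proof eventually_elim
        case (elim z)
        then show ?case by (auto simp: late_density_H indicator_def ennreal_mult Q0 mult_ac)
      qed
    qed
    finally show ?thesis .
  qed
  have balance: "ennreal (Y.prob (late_exceed T d r u - passing T u)) + (\<integral>\<^sup>+z. ennreal (Q z) * late_density T u z * indicator {0<..} z \<partial>lborel) = ennreal I1"
    using late_not_early[OF T u version, of d r] unfolding I1[symmetric] Q_def Y.emeasure_eq_measure .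
  \<comment> \<open>Multiplied by \<open>u\<close>, this integral is a summand of the finite
    quantity \<open>I1\<close>, and \<open>u\<close> is positive; only now may the balance be
    rewritten as a difference of real numbers.\<close>
  have I2: "(\<integral>\<^sup>+z. ennreal (Q z * enn2real (H z)) * indicator {0<..} z \<partial>lborel) = ennreal I2"
  proof -
    have "ennreal u * (\<integral>\<^sup>+z. ennreal (Q z * enn2real (H z)) * indicator {0<..} z \<partial>lborel) \<le> ennreal I1"
      unfolding u_I2 balance[symmetric] by simp
    then have "ennreal u * (\<integral>\<^sup>+z. ennreal (Q z * enn2real (H z)) * indicator {0<..} z \<partial>lborel) < \<top>" by (simp add: le_less_trans)
    then have "(\<integral>\<^sup>+z. ennreal (Q z * enn2real (H z)) * indicator {0<..} z \<partial>lborel) < \<top>"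
      using u by (auto simp: ennreal_mult_less_top)
    then show ?thesis by (simp add: I2_def)
  qed
  have I2_nonneg: "0 \<le> I2" by (simp add: I2_def)
  have second: "set_integrable lborel {0<..} (\<lambda>z. Q z * (LINT s:{0<..<T}|lborel. h z s))"
    "(LINT z:{0<..}|lborel. Q z * (LINT s:{0<..<T}|lborel. h z s)) = I2"
    unfolding inner using I2 I2_nonneg
    by (auto intro!: set_integral_nonneg_eqI[where F'="\<lambda>z. Q z * enn2real (H z)"] simp: Q0)
  have "ennreal (Y.prob (late_exceed T d r u - passing T u) + u * I2) = ennreal I1"
    using balance u I2_nonneg unfolding u_I2[symmetric] I2 by (simp add: ennreal_mult)
  then have "Y.prob (late_exceed T d r u - passing T u) + u * I2 = I1"
    using u I2_nonneg by (subst (asm) ennreal_inj) (auto simp: I1_def)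
  then have "prob_sup_gt M (\<lambda>t \<omega>. Y t \<omega> - c t) S u = passage_prob T u + (I1 - u * I2)" unfolding full_eq by simp
  then show ?thesis
    unfolding Let_def Q_eq A_eq h_def[symmetric]
    using early_int early_eq first second inner_int by (auto simp: h_def[abs_def])
qed

end
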